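(* Let $0<\delta$ be a constant. There exists a hitting set $\mathcal H$ of size $|\mathcal H| = 2^{\tilde{O}(n^{\frac{2}{3}+\frac{2}{3}\delta})}$ for the class of multilinear $\Sigma\Pi\Sigma$ (depth-$3$) formulas in $n$ variables of size at most $2^{n^\delta}$, and $\mathcal H$ can be constructed in time $\mathrm{poly}(|\mathcal H|)$.
   Context: A depth-$3$ ($\Sigma\Pi\Sigma$) formula computes a polynomial of the form $f=\sum_{i=1}^{s}\prod_{j=1}^{d_i}\ell_{i,j}$ where the $\ell_{i,j}$ are affine linear functions in $x_1,\dots,x_n$ over a field $\mathbb F$; it is multilinear if in every product gate the linear functions $\ell_{i,1},\dots,\ell_{i,d_i}$ are supported on pairwise disjoint sets of variables. The size of a formula is its number of gates. A hitting set for a class $\mathcal C$ of $n$-variate polynomials is a set $\mathcal H\subseteq \mathbb F^n$ such that every nonzero polynomial in $\mathcal C$ is nonzero at some point of $\mathcal H$. $\tilde O(\cdot)$ hides factors polylogarithmic in $n$. Standing assumption: for formulas of size $2^{n^\delta}$ the field satisfies $|\mathbb F|\ge 2^{n^{2\delta}\mathrm{polylog}(n)}$, or else one is allowed to take the points of $\mathcal H$ from an extension field of that size (in particular the result holds over fields of characteristic zero or of size $\exp(n)$). *)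

theory Defs
  imports Complex_Main "HOL-Algebra.Subrings" "HOL-Algebra.Indexed_Polynomials"
begin

section \<open>Polynomials\<close>

text \<open>
  A polynomial is a function from monomials (multisets of variables) to coefficients, as in
  \<^theory>\<open>HOL-Algebra.Indexed_Polynomials\<close>; \<open>K[\<X>\<^bsub>I\<^esub>]\<close> is the set of polynomials with
  coefficients in \<open>K\<close> and variables in \<open>I\<close>. That theory provides no product of two polynomials and
  no evaluation at a point.
\<close>

definition (in ring) indexed_mult ::
  "('c multiset \<Rightarrow> 'a) \<Rightarrow> ('c multiset \<Rightarrow> 'a) \<Rightarrow> ('c multiset \<Rightarrow> 'a)" where
  "indexed_mult P Q = (\<lambda>m. \<Oplus>a\<in>{a. a \<subseteq># m}. P a \<otimes> Q (m - a))"

definition (in ring) indexed_value :: "(nat multiset \<Rightarrow> 'a) \<Rightarrow> 'a list \<Rightarrow> 'a" where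
  "indexed_value P x =
     (\<Oplus>m\<in>{m. P m \<noteq> \<zero>}. P m \<otimes> (\<Otimes>i\<in>set_mset m. (x ! i) [^] count m i))"

text \<open>The points of \<open>H\<close> may have coordinates in all of \<open>R\<close> even if the polynomials in \<open>C\<close> have
  coefficients in a subfield.\<close>

definition (in ring) hitting_set :: "nat \<Rightarrow> (nat multiset \<Rightarrow> 'a) set \<Rightarrow> 'a list set \<Rightarrow> bool" where
  "hitting_set n C H \<longleftrightarrow>
     (\<forall>x\<in>H. length x = n \<and> set x \<subseteq> carrier R) \<and>
     (\<forall>P\<in>C. P \<noteq> indexed_const \<zero> \<longrightarrow> (\<exists>x\<in>H. indexed_value P x \<noteq> \<zero>))"


section \<open>Multilinear depth-3 formulas\<close>

definition (in ring) affine_linear :: "'a set \<Rightarrow> nat \<Rightarrow> (nat multiset \<Rightarrow> 'a) set" where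
  "affine_linear K n = {l \<in> K[\<X>\<^bsub>{..<n}\<^esub>]. \<forall>m. l m \<noteq> \<zero> \<longrightarrow> size m \<le> 1}"

text \<open>A depth-3 formula is the list of its product gates, each of which is the list of the affine
  linear functions that it multiplies.\<close>

type_synonym 'a depth3 = "(nat multiset \<Rightarrow> 'a) list list"

definition (in ring) depth3_formula :: "'a set \<Rightarrow> nat \<Rightarrow> 'a depth3 \<Rightarrow> bool" where
  "depth3_formula K n \<Phi> \<longleftrightarrow> (\<forall>g\<in>set \<Phi>. set g \<subseteq> affine_linear K n)"

text \<open>A variable lies in the support of \<open>l\<close> iff \<open>l\<close> is not \<open>index_free\<close> of it.\<close>

definition (in ring) multilinear :: "'a depth3 \<Rightarrow> bool" where
  "multilinear \<Phi> \<longleftrightarrow>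
     (\<forall>g\<in>set \<Phi>. \<forall>j<length g. \<forall>k<length g. j \<noteq> k \<longrightarrow>
        {i. \<not> index_free (g ! j) i} \<inter> {i. \<not> index_free (g ! k) i} = {})"

text \<open>The gates are the output sum gate, the product gates, and one sum gate for each affine linear
  function. Leaves are not counted, which only enlarges the class of formulas of a given size.\<close>

definition formula_size :: "'a depth3 \<Rightarrow> nat" where
  "formula_size \<Phi> = 1 + length \<Phi> + sum_list (map length \<Phi>)"

definition (in ring) formula_poly :: "'a depth3 \<Rightarrow> (nat multiset \<Rightarrow> 'a)" where
  "formula_poly \<Phi> =
     foldr (\<lambda>g P. indexed_padd (foldr indexed_mult g (indexed_const \<one>)) P) \<Phi> (indexed_const \<zero>)"

definition (in ring) multilinear_depth3_class ::
  "'a set \<Rightarrow> nat \<Rightarrow> real \<Rightarrow> (nat multiset \<Rightarrow> 'a) set" where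
  "multilinear_depth3_class K n s =
     {formula_poly \<Phi> | \<Phi>. depth3_formula K n \<Phi> \<and> multilinear \<Phi> \<and> real (formula_size \<Phi>) \<le> s}"


section \<open>Construction by an algorithm\<close>

text \<open>
  The model is a random access machine over a field (in the style of Blum, Shub and Smale), written
  with structured control flow. It has a memory of natural numbers, a memory of field elements that
  is indexed by natural numbers, and a write-only output tape of field elements. Every operation
  and every test costs 1. On natural numbers there are only addition and truncated subtraction, so
  that after \<open>t\<close> steps numbers have at most \<open>O(t)\<close> more bits than the input and constants, and
  unit cost agrees with Turing machine time up to a polynomial. Programs contain no field elements,
  so the same program can be run over every field.

  An arithmetic program can only reach the prime field from \<open>0\<close> and \<open>1\<close>. Therefore the field
  comes with an enumeration \<open>e\<close> of distinct elements (for instance \<open>0, 1, 2, \<dots>\<close> in characteristic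
  zero), and \<open>FElem\<close> fetches an element by its number.
\<close>

datatype com =
    NConst nat nat       \<comment> \<open>\<open>N[x] := k\<close>\<close>
  | NAdd nat nat nat     \<comment> \<open>\<open>N[x] := N[y] + N[z]\<close>\<close>
  | NSub nat nat nat     \<comment> \<open>\<open>N[x] := N[y] - N[z]\<close>, truncated at 0\<close>
  | NLoad nat nat        \<comment> \<open>\<open>N[x] := N[N[y]]\<close>\<close>
  | NStore nat nat       \<comment> \<open>\<open>N[N[x]] := N[y]\<close>\<close>
  | FZero nat            \<comment> \<open>\<open>F[x] := 0\<close>\<close>
  | FOne nat             \<comment> \<open>\<open>F[x] := 1\<close>\<close>
  | FElem nat nat        \<comment> \<open>\<open>F[x] := e(N[y])\<close>\<close>
  | FAdd nat nat nat     \<comment> \<open>\<open>F[x] := F[y] + F[z]\<close>\<close>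
  | FSub nat nat nat     \<comment> \<open>\<open>F[x] := F[y] - F[z]\<close>\<close>
  | FMult nat nat nat    \<comment> \<open>\<open>F[x] := F[y] * F[z]\<close>\<close>
  | FInv nat nat         \<comment> \<open>\<open>F[x] := 1 / F[y]\<close>, where \<open>1 / 0 = 0\<close>\<close>
  | FLoad nat nat        \<comment> \<open>\<open>F[x] := F[N[y]]\<close>\<close>
  | FStore nat nat       \<comment> \<open>\<open>F[N[x]] := F[y]\<close>\<close>
  | Emit nat             \<comment> \<open>append \<open>F[x]\<close> to the output\<close>
  | Seq com com
  | IfLess nat nat com com    \<comment> \<open>test \<open>N[x] < N[y]\<close>\<close>
  | IfZero nat com com        \<comment> \<open>test \<open>F[x] = 0\<close>\<close>
  | WhileLess nat nat com     \<comment> \<open>test \<open>N[x] < N[y]\<close>\<close>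

record 'a machine =
  nmem :: "nat \<Rightarrow> nat"
  fmem :: "nat \<Rightarrow> 'a"
  outp :: "'a list"

inductive exec ::
  "('a, 'b) ring_scheme \<Rightarrow> (nat \<Rightarrow> 'a) \<Rightarrow> com \<Rightarrow> 'a machine \<Rightarrow> nat \<Rightarrow> 'a machine \<Rightarrow> bool"
  for R (structure) and e where
  "exec R e (NConst x k) s 1 (s\<lparr>nmem := (nmem s)(x := k)\<rparr>)"
| "exec R e (NAdd x y z) s 1 (s\<lparr>nmem := (nmem s)(x := nmem s y + nmem s z)\<rparr>)"
| "exec R e (NSub x y z) s 1 (s\<lparr>nmem := (nmem s)(x := nmem s y - nmem s z)\<rparr>)"
| "exec R e (NLoad x y) s 1 (s\<lparr>nmem := (nmem s)(x := nmem s (nmem s y))\<rparr>)"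
| "exec R e (NStore x y) s 1 (s\<lparr>nmem := (nmem s)(nmem s x := nmem s y)\<rparr>)"
| "exec R e (FZero x) s 1 (s\<lparr>fmem := (fmem s)(x := \<zero>)\<rparr>)"
| "exec R e (FOne x) s 1 (s\<lparr>fmem := (fmem s)(x := \<one>)\<rparr>)"
| "exec R e (FElem x y) s 1 (s\<lparr>fmem := (fmem s)(x := e (nmem s y))\<rparr>)"
| "exec R e (FAdd x y z) s 1 (s\<lparr>fmem := (fmem s)(x := fmem s y \<oplus> fmem s z)\<rparr>)"
| "exec R e (FSub x y z) s 1 (s\<lparr>fmem := (fmem s)(x := fmem s y \<ominus> fmem s z)\<rparr>)"
| "exec R e (FMult x y z) s 1 (s\<lparr>fmem := (fmem s)(x := fmem s y \<otimes> fmem s z)\<rparr>)"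
| "exec R e (FInv x y) s 1
     (s\<lparr>fmem := (fmem s)(x := if fmem s y = \<zero> then \<zero> else inv (fmem s y))\<rparr>)"
| "exec R e (FLoad x y) s 1 (s\<lparr>fmem := (fmem s)(x := fmem s (nmem s y))\<rparr>)"
| "exec R e (FStore x y) s 1 (s\<lparr>fmem := (fmem s)(nmem s x := fmem s y)\<rparr>)"
| "exec R e (Emit x) s 1 (s\<lparr>outp := outp s @ [fmem s x]\<rparr>)"
| "exec R e p s t s' \<Longrightarrow> exec R e q s' t' s'' \<Longrightarrow> exec R e (Seq p q) s (t + t') s''"
| "nmem s x < nmem s y \<Longrightarrow> exec R e p s t s' \<Longrightarrow> exec R e (IfLess x y p q) s (t + 1) s'"
| "\<not> nmem s x < nmem s y \<Longrightarrow> exec R e q s t s' \<Longrightarrow> exec R e (IfLess x y p q) s (t + 1) s'"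
| "fmem s x = \<zero> \<Longrightarrow> exec R e p s t s' \<Longrightarrow> exec R e (IfZero x p q) s (t + 1) s'"
| "fmem s x \<noteq> \<zero> \<Longrightarrow> exec R e q s t s' \<Longrightarrow> exec R e (IfZero x p q) s (t + 1) s'"
| "nmem s x < nmem s y \<Longrightarrow> exec R e p s t s' \<Longrightarrow> exec R e (WhileLess x y p) s' t' s'' \<Longrightarrow>
     exec R e (WhileLess x y p) s (t + t' + 1) s''"
| "\<not> nmem s x < nmem s y \<Longrightarrow> exec R e (WhileLess x y p) s 1 s"

definition input_state :: "('a, 'b) ring_scheme \<Rightarrow> nat list \<Rightarrow> 'a machine" where
  "input_state R inp =
     \<lparr>nmem = (\<lambda>i. if i < length inp then inp ! i else 0), fmem = (\<lambda>_. \<zero>\<^bsub>R\<^esub>), outp = []\<rparr>"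

text \<open>In time \<open>t\<close> the program writes down the points of \<open>H\<close>, coordinate by coordinate and one after
  the other (possibly with repetitions).\<close>

definition constructs ::
  "('a, 'b) ring_scheme \<Rightarrow> (nat \<Rightarrow> 'a) \<Rightarrow> com \<Rightarrow> nat list \<Rightarrow> nat \<Rightarrow> 'a list set \<Rightarrow> nat \<Rightarrow> bool" where
  "constructs R e p inp n H t \<longleftrightarrow>
     (\<exists>s' pts. exec R e p (input_state R inp) t s' \<and> outp s' = concat pts \<and>
        (\<forall>x\<in>set pts. length x = n) \<and> H = set pts)"

definition enumerates_field :: "('a, 'b) ring_scheme \<Rightarrow> (nat \<Rightarrow> 'a) \<Rightarrow> bool" where
  "enumerates_field R e \<longleftrightarrow> range e \<subseteq> carrier R \<and>
     inj_on e {i. infinite (carrier R) \<or> i < card (carrier R)}"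

definition card_at_least :: "'a set \<Rightarrow> real \<Rightarrow> bool" where
  "card_at_least A b \<longleftrightarrow> infinite A \<or> b \<le> real (card A)"

text \<open>\<open>log 2 (n + 1)\<close> instead of \<open>log 2 n\<close> avoids a vanishing factor at \<open>n = 1\<close>.\<close>

definition polylog :: "nat \<Rightarrow> nat \<Rightarrow> real" where
  "polylog c n = real c * log 2 (real n + 1) ^ c"

end

theory Submission
  imports Defs
begin

text \<open>
  Let \<open>f \<noteq> 0\<close> be computed by a formula with fewer than \<open>2 ^ k\<close> gates, where \<open>k\<close> is about
  \<open>n powr \<delta>\<close>, and let \<open>m\<close> be about \<open>(n\<^sup>2 / k) powr (1/3)\<close>.

  If a linear function has at least \<open>n / m\<close> variables, some variable occurs in at least a fraction
  \<open>1 / m\<close> of all such wide functions. The derivative with respect to it has a smaller formula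
  without them, and it is the difference of \<open>f\<close> at \<open>1\<close> and at \<open>0\<close>. Hence after setting \<open>m k\<close>
  variables to Boolean values that are part of the seed, all linear functions are narrow.

  Next, arrange the variables in rows of length \<open>m\<close>, shift every row, and take the columns as
  blocks. For some shifts the linear functions that meet a block in several variables are so rare
  that \<open>f\<close>, as a polynomial in a single block, is a sum of \<open>2 ^ O(k + log n)\<close> products of
  univariate functions. For such sums there are weights \<open>w\<close>, built along a binary tree from \<open>log n\<close>
  multipliers, such that the substitution \<open>x\<^sub>i = t ^ w\<^sub>i\<close> keeps \<open>f \<noteq> 0\<close>: the weights single out a
  basis of the space of coefficients. The degree of the result is \<open>2 ^ O(k log\<^sup>2 n)\<close>, which
  bounds the number of values of \<open>t\<close> that are needed. Substituting block after block, starting from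
  a point where \<open>f\<close> does not vanish, uses seeds of \<open>O(m k log\<^sup>2 n)\<close> bits in total.

  For \<open>\<delta> \<ge> 1/2\<close> the points of \<open>{0, 1} ^ n\<close> suffice; the parameters \<open>m = n\<close> and \<open>k = 1\<close> give them.
\<close>

section \<open>Isolating weights\<close>

text \<open>The exponent comes from balancing two costs. Two given variables in different rows fall
  into a given block with probability at most \<open>1 / m^2\<close>, so a gate of narrow functions
  with \<open>s\<close> variables each splits on average into at most exp(sum of
  \<open>s^2 / m^2\<close>) products. With \<open>s < n / m\<close> and disjoint supports the sum is
  at most \<open>n^2 / m^3\<close>. Asking for \<open>n^2 \<le> m^3 * k\<close> keeps it below
  \<open>k\<close>, and then \<open>m * k\<close> is about \<open>(n * k)^(2/3)\<close>.

  Fields are given here as records, while the argument is best run in a type class. \<open>Z\<close>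
  therefore stands for membership in a prime ideal of a commutative ring, nonzero always means not
  in \<open>Z\<close>, and a field enters later as a quotient.

  The time has to be polynomial in the number of points, and different seeds may give the same
  point. This is why a lower bound on the number of points is needed at the end.\<close>

locale prime_zero =
  fixes Z :: "'b::comm_ring_1 \<Rightarrow> bool"
  assumes Z_0: "Z 0"
    and Z_add: "Z a \<Longrightarrow> Z b \<Longrightarrow> Z (a + b)"
    and Z_mult: "Z a \<Longrightarrow> Z (r * a)"
    and not_Z_1: "\<not> Z 1"
    and Z_prime: "Z (a * b) \<Longrightarrow> Z a \<or> Z b"
begin

lemma Z_mult_right: "Z a \<Longrightarrow> Z (a * r)"
  using Z_mult[of a r] by (simp add: mult.commute)

lemma Z_mult_iff: "Z (a * b) \<longleftrightarrow> Z a \<or> Z b"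
  using Z_prime Z_mult Z_mult_right by blast

lemma Z_uminus: "Z a \<Longrightarrow> Z (- a)"
  using Z_mult[of a "-1"] by simp

lemma Z_diff: "Z a \<Longrightarrow> Z b \<Longrightarrow> Z (a - b)"
  using Z_add[of a "- b"] Z_uminus by simp

lemma Z_add_cancel: "Z b \<Longrightarrow> Z (a + b) \<longleftrightarrow> Z a"
  using Z_diff[of "a + b" b] Z_add by auto

lemma Z_diff_cancel: "Z b \<Longrightarrow> Z (a - b) \<longleftrightarrow> Z a"
  using Z_add[of "a - b" b] Z_diff by auto

lemma Z_sum: "(\<And>i. i \<in> A \<Longrightarrow> Z (f i)) \<Longrightarrow> Z (sum f A)"
  by (induction A rule: infinite_finite_induct) (auto simp: Z_0 Z_add)

lemma not_Z_sumE:
  assumes "\<not> Z (sum f A)"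
  obtains i where "i \<in> A" "\<not> Z (f i)"
proof -
  have "\<exists>i\<in>A. \<not> Z (f i)"
    using assms Z_sum[of A f] by auto
  then show ?thesis using that by auto
qed

text \<open>Dividing by \<open>s - s0\<close> for one root \<open>s0\<close> lowers the degree;
  primality removes the factor at the other points, and Horner's scheme carries the vanishing from
  the quotient back to the coefficients.\<close>

lemma polynomial_roots:
  assumes "finite S" "card S > d"
    and "\<And>s s'. s \<in> S \<Longrightarrow> s' \<in> S \<Longrightarrow> s \<noteq> s' \<Longrightarrow> \<not> Z (s - s')"
    and "\<And>s. s \<in> S \<Longrightarrow> Z (\<Sum>k\<le>d. c k * s ^ k)"
    and "k \<le> d"
  shows "Z (c k)"
  using assms
proof (induction d arbitrary: S c k)
  case 0
  then obtain s where "s \<in> S" by fastforce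
  with 0 show ?case by fastforce
next
  case (Suc d)
  obtain s0 where s0: "s0 \<in> S" using Suc.prems(2) by fastforce
  \<comment> \<open>These are the coefficients of the quotient by \<open>s - s0\<close>, read off
    from the factorization of \<open>s ^ i - s0 ^ i\<close>.\<close>
  define q where "q j = (\<Sum>i=Suc j..Suc d. c i * s0 ^ (i - j - 1))" for j
  have diff: "(\<Sum>k\<le>Suc d. c k * s ^ k) - (\<Sum>k\<le>Suc d. c k * s0 ^ k)
      = (s - s0) * (\<Sum>j\<le>d. q j * s ^ j)" for s
  proof -
    have power: "s ^ i - s0 ^ i = (s - s0) * (\<Sum>j<i. s ^ j * s0 ^ (i - j - 1))" for i
      by (cases i) (simp_all add: diff_power_eq_sum del: sum.lessThan_Suc power_Suc)
    have "(\<Sum>k\<le>Suc d. c k * s ^ k) - (\<Sum>k\<le>Suc d. c k * s0 ^ k)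
        = (\<Sum>k\<le>Suc d. c k * (s ^ k - s0 ^ k))"
      by (simp add: sum_subtractf right_diff_distrib del: sum.atMost_Suc)
    also have "\<dots> = (s - s0) * (\<Sum>i\<le>Suc d. \<Sum>j<i. c i * s ^ j * s0 ^ (i - j - 1))"
      unfolding power sum_distrib_left by (simp add: ac_simps)
    also have "(\<Sum>i\<le>Suc d. \<Sum>j<i. c i * s ^ j * s0 ^ (i - j - 1)) = (\<Sum>j\<le>d. q j * s ^ j)"
      unfolding sum.nested_swap' q_def sum_distrib_right lessThan_Suc_atMost by (simp add: ac_simps)
    finally show ?thesis .
  qed
  have qZ: "Z (q j)" if "j \<le> d" for j
  proof (rule Suc.IH[of "S - {s0}"])
    show "d < card (S - {s0})" using Suc.prems(1,2) s0 by simp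
    show "Z (\<Sum>k\<le>d. q k * s ^ k)" if "s \<in> S - {s0}" for s
    proof -
      have "Z ((s - s0) * (\<Sum>j\<le>d. q j * s ^ j))"
        unfolding diff[symmetric] using that s0 by (intro Z_diff Suc.prems(4)) auto
      then show ?thesis using Suc.prems(3)[of s s0] that s0 Z_prime by blast
    qed
  qed (use Suc.prems that in auto)
  have rec: "q j = c (Suc j) + s0 * q (Suc j)" if "j \<le> d" for j
  proof -
    have "q j = c (Suc j) + (\<Sum>i=Suc (Suc j)..Suc d. c i * s0 ^ (i - j - 1))"
      unfolding q_def using that by (subst sum.atLeast_Suc_atMost) auto
    also have "(\<Sum>i=Suc (Suc j)..Suc d. c i * s0 ^ (i - j - 1)) = s0 * q (Suc j)"
      unfolding q_def sum_distrib_left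
    proof (rule sum.cong[OF refl])
      fix i assume "i \<in> {Suc (Suc j)..Suc d}"
      then have "i - j - 1 = Suc (i - Suc j - 1)" by auto
      then show "c i * s0 ^ (i - j - 1) = s0 * (c i * s0 ^ (i - Suc j - 1))" by simp
    qed
    finally show ?thesis .
  qed
  have cZ: "Z (c (Suc j))" if "j \<le> d" for j
  proof -
    have "Z (q (Suc j))"
      using qZ[of "Suc j"] by (cases "Suc j \<le> d") (auto simp: q_def Z_0)
    then have "Z (q j - s0 * q (Suc j))" using qZ[OF that] by (intro Z_diff Z_mult)
    then show ?thesis using rec[OF that] by simp
  qed
  show ?case
  proof (cases k)
    \<comment> \<open>The recurrence does not reach the constant coefficient; it follows from the
      value at \<open>s0\<close>.\<close>
    case 0
    have "(\<Sum>k\<le>Suc d. c k * s0 ^ k) = c 0 + (\<Sum>k\<le>d. c (Suc k) * s0 ^ Suc k)"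
      by (subst sum.atMost_Suc_shift) simp
    moreover have "Z (\<Sum>k\<le>d. c (Suc k) * s0 ^ Suc k)"
      using cZ by (intro Z_sum Z_mult_right) auto
    ultimately show ?thesis using Suc.prems(4)[OF s0] Z_add_cancel 0 by simp
  next
    case (Suc j)
    then show ?thesis using cZ Suc.prems(5) by simp
  qed
qed


section \<open>Linear functionals and isolated bases\<close>

definition dot :: "'g set \<Rightarrow> ('g \<Rightarrow> 'b) \<Rightarrow> ('g \<Rightarrow> 'b) \<Rightarrow> 'b" where
  "dot I c v = (\<Sum>g\<in>I. c g * v g)"

text \<open>Moving one pointwise factor into the functional freezes it, so that spanning statements
  about the other factor apply to products.\<close>

lemma dot_mult: "dot I c (\<lambda>g. u g * v g) = dot I (\<lambda>g. c g * u g) v"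
  by (simp add: dot_def mult.assoc)

lemma dot_mult': "dot I c (\<lambda>g. u g * v g) = dot I (\<lambda>g. c g * v g) u"
  by (simp add: dot_def ac_simps)

text \<open>The functionals witness that the vectors are linearly independent modulo
  \<open>Z\<close>, in a space with \<open>card I\<close> coordinates. Gaussian elimination: the
  vector of least weight clears one coordinate in all the others, whose functionals remain witnesses
  because they vanish on it.\<close>

lemma card_triangular_le:
  fixes wt :: "'i \<Rightarrow> nat"
  assumes "finite I" "finite B" "inj_on wt B"
    and "\<And>b. b \<in> B \<Longrightarrow> \<exists>c. (\<forall>q\<in>B. wt q < wt b \<longrightarrow> Z (dot I c (v q))) \<and> \<not> Z (dot I c (v b))"
  shows "card B \<le> card I"
  using assms
proof (induction "card I" arbitrary: I B v)
  case 0
  then have "I = {}" by simp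
  have "B = {}"
  proof (rule ccontr)
    assume "B \<noteq> {}"
    then obtain b where "b \<in> B" by blast
    from 0(5)[OF this] show False using \<open>I = {}\<close> by (simp add: dot_def Z_0)
  qed
  then show ?case by simp
next
  case (Suc n)
  show ?case
  proof (cases "B = {}")
    case False
    obtain b0 where b0: "b0 \<in> B" "\<And>b. b \<in> B \<Longrightarrow> wt b0 \<le> wt b"
      using arg_min_if_finite[OF Suc.prems(2) False, of wt] by (meson not_less)
    have less: "wt b0 < wt b" if "b \<in> B - {b0}" for b
    proof -
      have "wt b0 \<noteq> wt b" using inj_onD[OF Suc.prems(3), of b0 b] b0(1) that by auto
      then show ?thesis using b0(2)[of b] that by simp
    qed
    obtain c0 where "\<not> Z (dot I c0 (v b0))" using Suc.prems(4)[OF b0(1)] by blast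
    then obtain p where p: "p \<in> I" "\<not> Z (v b0 p)"
      unfolding dot_def by (elim not_Z_sumE) (auto simp: Z_mult_iff)
    \<comment> \<open>Cross-multiplication instead of division by the pivot; coordinate
      \<open>p\<close> becomes 0.\<close>
    define v' where "v' b = (\<lambda>g. v b0 p * v b g - v b p * v b0 g)" for b
    have dot': "dot (I - {p}) c (v' q) = v b0 p * dot I c (v q) - v q p * dot I c (v b0)" for c q
    proof -
      have "dot (I - {p}) c (v' q) = dot I c (v' q)"
        unfolding dot_def by (rule sum.mono_neutral_left) (use Suc.prems(1) in \<open>auto simp: v'_def\<close>)
      then show ?thesis
        by (simp add: dot_def v'_def sum_distrib_left sum_subtractf algebra_simps)
    qed
    have "card (B - {b0}) \<le> card (I - {p})"
    proof (rule Suc.hyps(1)[of "I - {p}" "B - {b0}" v'])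
      show "n = card (I - {p})" using Suc.hyps(2) p(1) Suc.prems(1) by simp
      show "finite (I - {p})" "finite (B - {b0})" "inj_on wt (B - {b0})"
        using Suc.prems(1-3) by (auto intro: inj_on_subset)
      fix b assume b: "b \<in> B - {b0}"
      then obtain c where c: "\<And>q. q \<in> B \<Longrightarrow> wt q < wt b \<Longrightarrow> Z (dot I c (v q))"
          "\<not> Z (dot I c (v b))"
        using Suc.prems(4)[of b] by blast
      have c0: "Z (dot I c (v b0))" using c(1) b0(1) less[OF b] by blast
      have "Z (dot (I - {p}) c (v' q))" if "q \<in> B - {b0}" "wt q < wt b" for q
        unfolding dot' using that c(1) c0 by (intro Z_diff Z_mult) auto
      moreover have "\<not> Z (dot (I - {p}) c (v' b))"
        unfolding dot' using c(2) c0 p(2) by (simp add: Z_diff_cancel Z_mult_iff)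
      ultimately show "\<exists>c. (\<forall>q\<in>B - {b0}. wt q < wt b \<longrightarrow> Z (dot (I - {p}) c (v' q))) \<and>
          \<not> Z (dot (I - {p}) c (v' b))" by blast
    qed
    then show ?thesis
      using card_Suc_Diff1[OF Suc.prems(2) b0(1)] card_Suc_Diff1[OF Suc.prems(1) p(1)] by simp
  qed simp
qed

text \<open>A vector lies in the span of other vectors iff every functional \<open>dot I c\<close> that vanishes on
  these vanishes on it. Working with functionals only avoids spans. The set \<open>B\<close> is a basis with
  distinct weights such that every vector is spanned by the basis vectors of smaller weight.\<close>

definition isolated :: "'g set \<Rightarrow> 'i set \<Rightarrow> ('i \<Rightarrow> nat) \<Rightarrow> ('i \<Rightarrow> 'g \<Rightarrow> 'b) \<Rightarrow> 'i set \<Rightarrow> bool" where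
  "isolated I J wt v B \<longleftrightarrow> B \<subseteq> J \<and> finite B \<and> card B \<le> card I \<and> inj_on wt B \<and>
     (\<forall>x\<in>J - B. \<forall>c. (\<forall>b\<in>B. wt b < wt x \<longrightarrow> Z (dot I c (v b))) \<longrightarrow> Z (dot I c (v x)))"

text \<open>Any spanning set with distinct weights can be thinned to at most \<open>card I\<close>
  vectors: keep exactly those that are not spanned by vectors of smaller weight. The kept vectors
  are in triangular position, hence few.\<close>

lemma isolated_subset:
  assumes "finite I" "finite Y" "inj_on wt Y" "Y \<subseteq> J"
    and span: "\<And>x c. x \<in> J - Y \<Longrightarrow> (\<And>b. b \<in> Y \<Longrightarrow> wt b < wt x \<Longrightarrow> Z (dot I c (v b))) \<Longrightarrow>
       Z (dot I c (v x))"
  shows "\<exists>B. isolated I J wt v B"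
proof -
  define B where "B = {b \<in> Y. \<exists>c. (\<forall>q\<in>Y. wt q < wt b \<longrightarrow> Z (dot I c (v q))) \<and> \<not> Z (dot I c (v b))}"
  have "B \<subseteq> Y" by (auto simp: B_def)
  then have fin: "finite B" and inj: "inj_on wt B"
    using assms finite_subset inj_on_subset by blast+
  have "card B \<le> card I"
    by (rule card_triangular_le[where v = v, OF assms(1) fin inj]) (auto simp: B_def)
  \<comment> \<open>Discarded vectors unfold into members of \<open>Y\<close> of smaller weight, and
    by induction on the weight into members of \<open>B\<close>; the bound \<open>k\<close> records
    that the weight never grows.\<close>
  have Y: "Z (dot I c (v x))"
    if "x \<in> Y" "\<And>b. b \<in> B \<Longrightarrow> wt b \<le> k \<Longrightarrow> Z (dot I c (v b))" "wt x \<le> k" for x c k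
    using that(1,3)
  proof (induction "wt x" arbitrary: x rule: less_induct)
    case less
    show ?case
    proof (cases "x \<in> B")
      case True
      then show ?thesis using that(2) less.prems by blast
    next
      case False
      have "\<forall>q\<in>Y. wt q < wt x \<longrightarrow> Z (dot I c (v q))" using less by fastforce
      then show ?thesis using False less.prems by (auto simp: B_def)
    qed
  qed
  have "Z (dot I c (v x))"
    if x: "x \<in> J - B" and c: "\<And>b. b \<in> B \<Longrightarrow> wt b < wt x \<Longrightarrow> Z (dot I c (v b))" for x c
  proof -
    have *: "Z (dot I c (v y))" if "y \<in> Y" "wt y < wt x" for y
      using Y[OF that(1), of "wt y" c] c that(2) by fastforce
    show ?thesis
    proof (cases "x \<in> Y")
      case True
      then show ?thesis using x * by (auto simp: B_def)
    next
      case False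
      then show ?thesis using x * span by blast
    qed
  qed
  then have "isolated I J wt v B"
    unfolding isolated_def using \<open>B \<subseteq> Y\<close> assms(4) fin inj \<open>card B \<le> card I\<close>
    by (intro conjI ballI allI impI) auto
  then show ?thesis by blast
qed

text \<open>Replacing one factor by basis vectors of smaller weight lowers the weight of the
  product, so \<open>B1 \<times> B2\<close> spans. It may have \<open>(card I)^2\<close> elements;
  thinning brings it back to \<open>card I\<close>, so the size does not grow along the
  tree.\<close>

lemma isolated_prod:
  assumes "finite I" "isolated I X1 w1 v1 B1" "isolated I X2 w2 v2 B2"
    and "inj_on (\<lambda>(x, y). w1 x + a * w2 y) (B1 \<times> B2)" "a > 0"
  shows "\<exists>B. isolated I (X1 \<times> X2) (\<lambda>(x, y). w1 x + a * w2 y) (\<lambda>(x, y) g. v1 x g * v2 y g) B"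
proof (rule isolated_subset[OF assms(1) _ assms(4)])
  show "finite (B1 \<times> B2)" and "B1 \<times> B2 \<subseteq> X1 \<times> X2"
    using assms(2,3) by (auto simp: isolated_def)
  have span1: "Z (dot I c (v1 x))"
    if "x \<in> X1 - B1" "\<And>b. b \<in> B1 \<Longrightarrow> w1 b < w1 x \<Longrightarrow> Z (dot I c (v1 b))" for x c
    using assms(2) that unfolding isolated_def by blast
  have span2: "Z (dot I c (v2 x))"
    if "x \<in> X2 - B2" "\<And>b. b \<in> B2 \<Longrightarrow> w2 b < w2 x \<Longrightarrow> Z (dot I c (v2 b))" for x c
    using assms(3) that unfolding isolated_def by blast
  fix p c
  assume p: "p \<in> X1 \<times> X2 - B1 \<times> B2"
    and c: "\<And>b. b \<in> B1 \<times> B2 \<Longrightarrow> (case b of (x, y) \<Rightarrow> w1 x + a * w2 y) < (case p of (x, y) \<Rightarrow> w1 x + a * w2 y) \<Longrightarrow>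
      Z (dot I c (case b of (x, y) \<Rightarrow> \<lambda>g. v1 x g * v2 y g))"
  obtain x y where xy: "p = (x, y)" "x \<in> X1" "y \<in> X2" "x \<notin> B1 \<or> y \<notin> B2" using p by blast
  have c': "Z (dot I c (\<lambda>g. v1 b1 g * v2 b2 g))"
    if "b1 \<in> B1" "b2 \<in> B2" "w1 b1 + a * w2 b2 < w1 x + a * w2 y" for b1 b2
    using c[of "(b1, b2)"] that xy by auto
  have "Z (dot I c (\<lambda>g. v1 x g * v2 y g))"
  proof (cases "x \<in> B1")
    case True
    then have "y \<notin> B2" using xy by blast
    show ?thesis
      unfolding dot_mult
    proof (rule span2)
      fix b assume "b \<in> B2" "w2 b < w2 y"
      then show "Z (dot I (\<lambda>g. c g * v1 x g) (v2 b))"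
        using c'[OF True] \<open>a > 0\<close> by (simp add: dot_mult)
    qed (use xy \<open>y \<notin> B2\<close> in auto)
  next
    \<comment> \<open>First \<open>x\<close> is expanded over \<open>B1\<close>; each resulting
      product may still have \<open>y\<close> outside \<open>B2\<close>, and expanding
      \<open>y\<close> as well keeps the weight below that of the pair
      \<open>(x, y)\<close>.\<close>
    case False
    show ?thesis
      unfolding dot_mult'
    proof (rule span1)
      fix b assume b: "b \<in> B1" "w1 b < w1 x"
      have "Z (dot I c (\<lambda>g. v1 b g * v2 y g))"
      proof (cases "y \<in> B2")
        case True
        then show ?thesis using c' b by simp
      next
        case False
        show ?thesis
          unfolding dot_mult
        proof (rule span2)
          fix b' assume b': "b' \<in> B2" "w2 b' < w2 y"
          then have "w1 b + a * w2 b' < w1 x + a * w2 y"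
            using b by (intro add_less_le_mono mult_le_mono2) auto
          then show "Z (dot I (\<lambda>g. c g * v1 b g) (v2 b'))"
            using c' b b' by (simp add: dot_mult)
        qed (use xy False in auto)
      qed
      then show "Z (dot I (\<lambda>g. c g * v2 y g) (v1 b))" by (simp add: dot_mult')
    qed (use xy False in auto)
  qed
  then show "Z (dot I c (case p of (x, y) \<Rightarrow> \<lambda>g. v1 x g * v2 y g))" using xy by simp
qed

end

text \<open>Entry \<open>i\<close> is the product of the multipliers \<open>\<alpha> j\<close> over
  the binary digits \<open>j\<close> of \<open>i\<close> that are 1. Thus \<open>L\<close> numbers
  describe all \<open>2 ^ L\<close> weights, and all nodes on one level of the tree share a
  multiplier.\<close>

primrec weights :: "(nat \<Rightarrow> nat) \<Rightarrow> nat \<Rightarrow> nat list" where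
  "weights \<alpha> 0 = [1]"
| "weights \<alpha> (Suc j) = weights \<alpha> j @ map ((*) (\<alpha> j)) (weights \<alpha> j)"

lemma length_weights [simp]: "length (weights \<alpha> j) = 2 ^ j"
  by (induction j) auto

lemma weights_cong: "(\<And>i. i < j \<Longrightarrow> \<alpha> i = \<beta> i) \<Longrightarrow> weights \<alpha> j = weights \<beta> j"
  by (induction j) auto

lemma weights_nth_0 [simp]: "weights \<alpha> j ! 0 = 1"
  by (induction j) (auto simp: nth_append)

lemma weights_le:
  assumes "\<And>i. i < j \<Longrightarrow> \<alpha> i \<le> Q" "1 \<le> Q"
  shows "w \<in> set (weights \<alpha> j) \<Longrightarrow> w \<le> Q ^ j"
  using assms(1)
proof (induction j arbitrary: w)
  case (Suc j)
  have IH: "w \<le> Q ^ j" if "w \<in> set (weights \<alpha> j)" for w using Suc that by simp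
  have "\<alpha> j * w \<le> Q ^ Suc j" if "w \<in> set (weights \<alpha> j)" for w
    using mult_le_mono[OF Suc.prems(2)[of j] IH[OF that]] by simp
  moreover have "w \<le> Q ^ Suc j" if "w \<in> set (weights \<alpha> j)" for w
    using mult_le_mono[OF assms(2) IH[OF that]] by simp
  ultimately show ?case using Suc.prems(1) by auto
qed simp

definition wsum :: "bool list \<Rightarrow> nat list \<Rightarrow> nat" where
  "wsum xs ws = sum_list (map2 (\<lambda>b w. if b then w else 0) xs ws)"

lemma wsum_append:
  "length xs = length ws \<Longrightarrow> wsum (xs @ ys) (ws @ ws') = wsum xs ws + wsum ys ws'"
  by (simp add: wsum_def)

lemma wsum_simps [simp]:
  "wsum [] [] = 0" "wsum (x # xs) (w # ws) = (if x then w else 0) + wsum xs ws"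
  by (simp_all add: wsum_def)

lemma wsum_scale:
  "length xs = length ws \<Longrightarrow> wsum xs (map ((*) a) ws) = a * wsum xs ws"
  by (induction xs ws rule: list_induct2) (auto simp: algebra_simps)

lemma wsum_le: "length xs = length ws \<Longrightarrow> (\<And>w. w \<in> set ws \<Longrightarrow> w \<le> q) \<Longrightarrow> wsum xs ws \<le> length ws * q"
proof (induction xs ws rule: list_induct2)
  case (Cons x xs w ws)
  then have "w \<le> q" "wsum xs ws \<le> length ws * q" by auto
  then show ?case by auto
qed simp

text \<open>\<open>coef a b g k xs\<close> is the coefficient of the monomial selected by \<open>xs\<close> in the product of
  the factors \<open>a g i + b g i * z i\<close> for \<open>i = k, k + 1, \<dots>\<close>\<close>

fun coef :: "('g \<Rightarrow> nat \<Rightarrow> 'b::comm_ring_1) \<Rightarrow> ('g \<Rightarrow> nat \<Rightarrow> 'b) \<Rightarrow> 'g \<Rightarrow> nat \<Rightarrow> bool list \<Rightarrow> 'b" where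
  "coef a b g k [] = 1"
| "coef a b g k (x # xs) = (if x then b g k else a g k) * coef a b g (Suc k) xs"

lemma coef_append: "coef a b g k (xs @ ys) = coef a b g k xs * coef a b g (k + length xs) ys"
  by (induction xs arbitrary: k) (auto simp: mult.assoc)

fun mon :: "(nat \<Rightarrow> 'b::comm_ring_1) \<Rightarrow> nat \<Rightarrow> bool list \<Rightarrow> 'b" where
  "mon z k [] = 1"
| "mon z k (x # xs) = (if x then z k else 1) * mon z (Suc k) xs"

lemma mon_power:
  assumes "length xs = length ws" "\<And>i. i < length ws \<Longrightarrow> z (k + i) = t ^ (ws ! i)"
  shows "mon z k xs = t ^ wsum xs ws"
  using assms
proof (induction xs ws arbitrary: k rule: list_induct2)
  case (Cons x xs w ws)
  have "mon z (Suc k) xs = t ^ wsum xs ws"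
    using Cons.prems[of "Suc _"] by (intro Cons.IH) simp
  moreover have "z k = t ^ w" using Cons.prems[of 0] by simp
  ultimately show ?case by (simp add: power_add)
qed simp

definition bool_lists :: "nat \<Rightarrow> bool list set" where
  "bool_lists k = {xs. length xs = k}"

lemma finite_bool_lists [simp]: "finite (bool_lists k)"
  using finite_lists_length_eq[of "UNIV :: bool set" k] by (simp add: bool_lists_def)

lemma bool_lists_Suc: "bool_lists (Suc k) = (\<lambda>(x, xs). x # xs) ` (UNIV \<times> bool_lists k)"
  by (auto simp: bool_lists_def length_Suc_conv image_iff)

lemma bool_lists_add: "bool_lists (j + k) = (\<lambda>(xs, ys). xs @ ys) ` (bool_lists j \<times> bool_lists k)"
proof (rule equalityI; rule subsetI)
  fix xs :: "bool list" assume "xs \<in> bool_lists (j + k)"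
  then have "(take j xs, drop j xs) \<in> bool_lists j \<times> bool_lists k" by (simp add: bool_lists_def)
  then show "xs \<in> (\<lambda>(xs, ys). xs @ ys) ` (bool_lists j \<times> bool_lists k)"
    by (rule rev_image_eqI) simp
qed (auto simp: bool_lists_def)

lemma prod_expand:
  "(\<Prod>i<k. a g (m + i) + b g (m + i) * z (m + i)) = (\<Sum>xs\<in>bool_lists k. coef a b g m xs * mon z m xs)"
proof (induction k arbitrary: m)
  case 0
  have "bool_lists 0 = {[]}" by (auto simp: bool_lists_def)
  then show ?case by simp
next
  case (Suc k)
  have "(\<Prod>i<Suc k. a g (m + i) + b g (m + i) * z (m + i)) =
      (a g m + b g m * z m) * (\<Prod>i<k. a g (Suc m + i) + b g (Suc m + i) * z (Suc m + i))"
    by (subst prod.lessThan_Suc_shift) simp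
  also have "\<dots> = (\<Sum>x\<in>UNIV. (if x then b g m * z m else a g m)) *
      (\<Sum>xs\<in>bool_lists k. coef a b g (Suc m) xs * mon z (Suc m) xs)"
    unfolding Suc.IH by (simp add: UNIV_bool add.commute)
  also have "\<dots> = (\<Sum>xs\<in>bool_lists (Suc k). coef a b g m xs * mon z m xs)"
    unfolding bool_lists_Suc
    by (subst sum.reindex)
      (auto intro!: inj_onI sum.cong simp: sum_product sum.cartesian_product ac_simps)
  finally show ?case .
qed

text \<open>A union bound. For two distinct pairs \<open>(x, y)\<close> and \<open>(x', y')\<close>
  the collision equation is linear in \<open>A\<close> and has at most one solution, so at most
  \<open>card C * R ^ 4\<close> multipliers are bad, counted over all nodes \<open>C\<close> of a
  level at once.\<close>

lemma good_multiplier: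
  fixes w :: "'i \<Rightarrow> nat" and C :: "'c set"
  assumes "finite C"
    and fin: "\<And>c. c \<in> C \<Longrightarrow> finite (B1 c) \<and> finite (B2 c) \<and> card (B1 c) \<le> R \<and> card (B2 c) \<le> R"
    and inj: "\<And>c. c \<in> C \<Longrightarrow> inj_on w (B1 c) \<and> inj_on w (B2 c)"
    and Q: "card C * R ^ 4 < Q"
  shows "\<exists>A>0. A \<le> Q \<and> (\<forall>c\<in>C. inj_on (\<lambda>(x, y). w x + A * w y) (B1 c \<times> B2 c))"
proof (rule ccontr)
  assume none: "\<not> ?thesis"
  define J where "J = Sigma C (\<lambda>c. (B1 c \<times> B2 c) \<times> (B1 c \<times> B2 c))"
  define coll where "coll A u \<longleftrightarrow> (case u of (c, (x, y), (x', y')) \<Rightarrow>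
      (x, y) \<noteq> (x', y') \<and> w x + A * w y = w x' + A * w y')"
    for A and u :: "'c \<times> ('i \<times> 'i) \<times> 'i \<times> 'i"
  have "\<exists>u\<in>J. coll A u" if A: "A \<in> {1..Q}" for A
  proof -
    obtain c where "c \<in> C" "\<not> inj_on (\<lambda>(x, y). w x + A * w y) (B1 c \<times> B2 c)"
      using none A by force
    then obtain p p' where "p \<in> B1 c \<times> B2 c" "p' \<in> B1 c \<times> B2 c" "p \<noteq> p'"
        "(case p of (x, y) \<Rightarrow> w x + A * w y) = (case p' of (x, y) \<Rightarrow> w x + A * w y)"
      unfolding inj_on_def by blast
    then show ?thesis
      using \<open>c \<in> C\<close> by (intro bexI[of _ "(c, p, p')"]) (auto simp: J_def coll_def split: prod.splits)
  qed
  then have "\<forall>A\<in>{1..Q}. \<exists>u. u \<in> J \<and> coll A u" by blast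
  then obtain u where u: "\<And>A. A \<in> {1..Q} \<Longrightarrow> u A \<in> J \<and> coll A (u A)" by metis
  have "inj_on u {1..Q}"
  proof (rule inj_onI, rule ccontr)
    fix A A' assume AA: "A \<in> {1..Q}" "A' \<in> {1..Q}" "u A = u A'" "A \<noteq> A'"
    obtain c x y x' y' where c: "u A = (c, (x, y), (x', y'))" by (metis surj_pair)
    have *: "c \<in> C" "x \<in> B1 c" "x' \<in> B1 c" "y \<in> B2 c" "y' \<in> B2 c" "(x, y) \<noteq> (x', y')"
      "w x + A * w y = w x' + A * w y'" "w x + A' * w y = w x' + A' * w y'"
      using u[OF AA(1)] u[OF AA(2)] AA(3) c by (auto simp: J_def coll_def)
    have "int (w x) + int A * int (w y) = int (w x') + int A * int (w y')"
      "int (w x) + int A' * int (w y) = int (w x') + int A' * int (w y')"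
      using *(7,8) by (metis of_nat_add of_nat_mult)+
    then have "(int A - int A') * (int (w y) - int (w y')) = 0" by (simp add: algebra_simps)
    then have wy: "w y = w y'" using AA(4) by simp
    then have "w x = w x'" using *(7) by simp
    then show False using wy * inj[OF *(1)] by (auto dest: inj_onD)
  qed
  moreover have "finite J" using assms(1) fin by (auto simp: J_def)
  moreover have "u ` {1..Q} \<subseteq> J" using u by blast
  ultimately have "Q \<le> card J" using card_inj_on_le[of u "{1..Q}" J] by simp
  also have "card J \<le> (\<Sum>c\<in>C. R ^ 4)"
  proof -
    have "card J = (\<Sum>c\<in>C. card ((B1 c \<times> B2 c) \<times> (B1 c \<times> B2 c)))"
      unfolding J_def using assms(1) fin by (subst card_SigmaI) auto
    also have "\<dots> \<le> (\<Sum>c\<in>C. R ^ 4)"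
    proof (rule sum_mono)
      fix c assume "c \<in> C"
      then have "card (B1 c) * card (B2 c) \<le> R * R" using fin by (intro mult_le_mono) auto
      from mult_le_mono[OF this this]
      show "card ((B1 c \<times> B2 c) \<times> (B1 c \<times> B2 c)) \<le> R ^ 4"
        by (simp add: card_cartesian_product power4_eq_xxxx mult.assoc)
    qed
    finally show ?thesis .
  qed
  finally show False using Q by simp
qed

context prime_zero
begin

lemma isolated_image:
  assumes "isolated I J w v B" "inj_on f J"
    and "\<And>x. x \<in> J \<Longrightarrow> w' (f x) = w x" "\<And>x. x \<in> J \<Longrightarrow> v' (f x) = v x"
  shows "isolated I (f ` J) w' v' (f ` B)"
proof -
  have B: "B \<subseteq> J" "finite B" "card B \<le> card I" "inj_on w B"
    and sp: "\<And>x c. x \<in> J - B \<Longrightarrow> (\<forall>b\<in>B. w b < w x \<longrightarrow> Z (dot I c (v b))) \<Longrightarrow> Z (dot I c (v x))"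
    using assms(1) unfolding isolated_def by auto
  have fB: "card (f ` B) = card B" by (rule card_image) (rule inj_on_subset[OF assms(2) B(1)])
  have "inj_on w' (f ` B)"
    using B(1,4) assms(3) by (auto simp: inj_on_def subset_iff)
  moreover have "Z (dot I c (v' y))"
    if y: "y \<in> f ` J - f ` B" "\<forall>b\<in>f ` B. w' b < w' y \<longrightarrow> Z (dot I c (v' b))" for y c
  proof -
    obtain x where x: "x \<in> J" "y = f x" "x \<notin> B" using y(1) by blast
    have "Z (dot I c (v x))"
      using x y(2) B(1) assms(3,4) by (intro sp) (auto simp: subset_iff)
    then show ?thesis using x assms(4) by simp
  qed
  ultimately show ?thesis
    using B fB unfolding isolated_def by auto
qed

text \<open>Node \<open>c\<close> of level \<open>j\<close> covers the variables from
  \<open>c * 2 ^ j\<close> on, and its children are the nodes \<open>2 * c\<close> and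
  \<open>2 * c + 1\<close> of the level below. The bound on \<open>Q\<close> is the union bound over
  at most \<open>2 ^ L\<close> nodes with bases of size at most \<open>card I\<close>.\<close>

lemma exists_isolating_weights:
  assumes "finite I" "card I ^ 4 * 2 ^ L < Q" "j \<le> L"
  shows "\<exists>\<alpha>. (\<forall>i. 0 < \<alpha> i \<and> \<alpha> i \<le> Q) \<and> (\<forall>c<2 ^ (L - j). \<exists>B.
    isolated I (bool_lists (2 ^ j)) (\<lambda>xs. wsum xs (weights \<alpha> j)) (\<lambda>xs g. coef a b g (c * 2 ^ j) xs) B)"
  using assms(3)
proof (induction j)
  case 0
  have bl: "bool_lists (Suc 0) = {[False], [True]}"
    by (auto simp: bool_lists_def length_Suc_conv)
  \<comment> \<open>A leaf has only two monomials, 1 and the variable, of weights 0 and 1.\<close>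
  have "\<exists>B. isolated I (bool_lists (2 ^ 0)) (\<lambda>xs. wsum xs (weights (\<lambda>_. 1) 0)) (\<lambda>xs g. coef a b g c xs) B" for c
    by (rule isolated_subset[OF assms(1), of "bool_lists (2 ^ 0)"]) (auto simp: bl inj_on_def)
  then show ?case using assms(2) by (intro exI[of _ "\<lambda>_. 1"]) auto
next
  case (Suc j)
  define V where "V c = (\<lambda>xs g. coef a b g (c * 2 ^ j) xs)" for c
  obtain \<alpha> where \<alpha>: "\<And>i. 0 < \<alpha> i \<and> \<alpha> i \<le> Q"
    and iso: "\<forall>c<2 ^ (L - j). \<exists>B. isolated I (bool_lists (2 ^ j)) (\<lambda>xs. wsum xs (weights \<alpha> j)) (V c) B"
    using Suc unfolding V_def by auto
  define w where "w xs = wsum xs (weights \<alpha> j)" for xs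
  obtain B where B: "\<And>c. c < 2 ^ (L - j) \<Longrightarrow> isolated I (bool_lists (2 ^ j)) w (V c) (B c)"
    using iso unfolding w_def by metis
  have L: "L - j = Suc (L - Suc j)" using Suc.prems by simp
  have B2: "isolated I (bool_lists (2 ^ j)) w (V (2 * c)) (B (2 * c))"
    "isolated I (bool_lists (2 ^ j)) w (V (2 * c + 1)) (B (2 * c + 1))"
    if "c < 2 ^ (L - Suc j)" for c
    using that by (auto intro!: B simp: L)
  have "card {..<(2::nat) ^ (L - Suc j)} * card I ^ 4 \<le> 2 ^ L * card I ^ 4" by simp
  also have "\<dots> < Q" using assms(2) by (simp add: mult.commute)
  finally obtain A where A: "A > 0" "A \<le> Q"
    "\<And>c. c < 2 ^ (L - Suc j) \<Longrightarrow> inj_on (\<lambda>(x, y). w x + A * w y) (B (2 * c) \<times> B (2 * c + 1))"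
    using good_multiplier[of "{..<2 ^ (L - Suc j)}" "\<lambda>c. B (2 * c)" "\<lambda>c. B (2 * c + 1)" "card I" w Q]
      B2 unfolding isolated_def by auto
  \<comment> \<open>The list of level \<open>j\<close> uses only multipliers below \<open>j\<close>,
    so setting entry \<open>j\<close> leaves it unchanged.\<close>
  define \<beta> where "\<beta> = \<alpha>(j := A)"
  have W: "weights \<beta> (Suc j) = weights \<alpha> j @ map ((*) A) (weights \<alpha> j)"
    using weights_cong[of j \<beta> \<alpha>] by (simp add: \<beta>_def)
  have "\<exists>B. isolated I (bool_lists (2 ^ Suc j)) (\<lambda>xs. wsum xs (weights \<beta> (Suc j)))
      (\<lambda>xs g. coef a b g (c * 2 ^ Suc j) xs) B" if c: "c < 2 ^ (L - Suc j)" for c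
  proof -
    obtain B' where B': "isolated I (bool_lists (2 ^ j) \<times> bool_lists (2 ^ j)) (\<lambda>(x, y). w x + A * w y)
        (\<lambda>(x, y) g. V (2 * c) x g * V (2 * c + 1) y g) B'"
      using isolated_prod[OF assms(1) B2[OF c] A(3)[OF c] A(1)] by blast
    have "isolated I ((\<lambda>(xs, ys). xs @ ys) ` (bool_lists (2 ^ j) \<times> bool_lists (2 ^ j)))
       (\<lambda>xs. wsum xs (weights \<beta> (Suc j))) (\<lambda>xs g. coef a b g (c * 2 ^ Suc j) xs) ((\<lambda>(xs, ys). xs @ ys) ` B')"
    proof (rule isolated_image[OF B'])
      show "inj_on (\<lambda>(xs, ys). xs @ ys) (bool_lists (2 ^ j) \<times> bool_lists (2 ^ j))"
        by (auto simp: inj_on_def bool_lists_def)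
    qed (auto simp: W w_def V_def bool_lists_def wsum_append wsum_scale coef_append algebra_simps
        simp del: weights.simps)
    then show ?thesis unfolding bool_lists_add[symmetric] by (auto simp: mult_2)
  qed
  moreover have "\<forall>i. 0 < \<beta> i \<and> \<beta> i \<le> Q" using \<alpha> A(1,2) by (simp add: \<beta>_def)
  ultimately show ?case by blast
qed

text \<open>The powers \<open>t ^ w\<^sub>i\<close> hit \<open>f\<close>: no other monomial contributes to the smallest power of \<open>t\<close> that
  comes from a basis vector on which the functional does not vanish.\<close>

lemma hit_prod_sum:
  assumes "r ^ 4 * 2 ^ L < Q"
    and f: "\<And>z. f z = (\<Sum>g<r. c g * (\<Prod>i<2 ^ L. a g i + b g i * z i))"
    and "\<not> Z (f z0)"
  shows "\<exists>\<alpha>. (\<forall>i. 0 < \<alpha> i \<and> \<alpha> i \<le> Q) \<and> (\<forall>S. finite S \<longrightarrow> card S > 2 ^ L * Q ^ L \<longrightarrow>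
     (\<forall>s\<in>S. \<forall>s'\<in>S. s \<noteq> s' \<longrightarrow> \<not> Z (s - s')) \<longrightarrow> (\<exists>t\<in>S. \<not> Z (f (\<lambda>i. t ^ (weights \<alpha> L ! i)))))"
proof -
  define I where "I = {..<r}"
  obtain \<alpha> B where \<alpha>: "\<And>i. 0 < \<alpha> i \<and> \<alpha> i \<le> Q"
    and iso: "isolated I (bool_lists (2 ^ L)) (\<lambda>xs. wsum xs (weights \<alpha> L)) (\<lambda>xs g. coef a b g 0 xs) B"
    using exists_isolating_weights[of I L Q L a b] assms(1) by (auto simp: I_def)
  define w where "w xs = wsum xs (weights \<alpha> L)" for xs
  define D where "D xs = dot I c (\<lambda>g. coef a b g 0 xs)" for xs
  define J where "J = bool_lists (2 ^ L)"
  have B: "B \<subseteq> J" "finite B" "inj_on w B"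
    and span: "\<And>x. x \<in> J - B \<Longrightarrow> (\<And>b. b \<in> B \<Longrightarrow> w b < w x \<Longrightarrow> Z (D b)) \<Longrightarrow> Z (D x)"
    using iso unfolding isolated_def J_def w_def D_def by auto
  have expand: "f z = (\<Sum>xs\<in>J. D xs * mon z 0 xs)" for z
  proof -
    have "f z = (\<Sum>g\<in>I. \<Sum>xs\<in>J. c g * coef a b g 0 xs * mon z 0 xs)"
      using prod_expand[where m = 0 and a = a and b = b]
      by (simp add: f I_def J_def sum_distrib_left mult.assoc)
    also have "\<dots> = (\<Sum>xs\<in>J. D xs * mon z 0 xs)"
      by (subst sum.swap) (simp add: D_def dot_def sum_distrib_right)
    finally show ?thesis .
  qed
  obtain x0 where x0: "x0 \<in> J" "\<not> Z (D x0)"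
    using assms(3) unfolding expand by (elim not_Z_sumE) (auto simp: Z_mult_iff)
  have "\<exists>b\<in>B. \<not> Z (D b)" using x0 span by blast
  then obtain b0 where b0: "b0 \<in> B" "\<not> Z (D b0)" "\<And>b. b \<in> B \<Longrightarrow> w b < w b0 \<Longrightarrow> Z (D b)"
  proof -
    assume *: "\<And>b0. b0 \<in> B \<Longrightarrow> \<not> Z (D b0) \<Longrightarrow> (\<And>b. b \<in> B \<Longrightarrow> w b < w b0 \<Longrightarrow> Z (D b)) \<Longrightarrow> thesis"
    define N where "N = {b \<in> B. \<not> Z (D b)}"
    have "finite N" "N \<noteq> {}" using B(2) \<open>\<exists>b\<in>B. \<not> Z (D b)\<close> by (auto simp: N_def)
    from arg_min_if_finite[OF this, of w] show thesis
      by (intro *[of "arg_min_on w N"]) (auto simp: N_def)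
  qed
  \<comment> \<open>Degree bound: a monomial has at most \<open>2 ^ L\<close> variables, each of
    weight at most \<open>Q ^ L\<close>.\<close>
  define d where "d = 2 ^ L * Q ^ L"
  define C where "C k = (\<Sum>xs\<in>{xs \<in> J. w xs = k}. D xs)" for k
  have "1 \<le> Q" using assms(1) by simp
  have w_le: "w xs \<le> d" if "xs \<in> J" for xs
    using that wsum_le[of xs "weights \<alpha> L" "Q ^ L"] weights_le[of L \<alpha> Q] \<alpha> \<open>1 \<le> Q\<close>
    by (auto simp: J_def bool_lists_def w_def d_def)
  have "finite J" by (simp add: J_def)
  have poly: "f (\<lambda>i. t ^ (weights \<alpha> L ! i)) = (\<Sum>k\<le>d. C k * t ^ k)" for t
  proof -
    have "f (\<lambda>i. t ^ (weights \<alpha> L ! i)) = (\<Sum>xs\<in>J. D xs * t ^ w xs)"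
      unfolding expand by (intro sum.cong refl arg_cong2[where f = times])
        (auto simp: w_def J_def bool_lists_def intro!: mon_power)
    also have "\<dots> = (\<Sum>k\<le>d. \<Sum>xs\<in>{xs \<in> J. w xs = k}. D xs * t ^ w xs)"
      using w_le \<open>finite J\<close> by (intro sum.group[symmetric]) auto
    also have "\<dots> = (\<Sum>k\<le>d. C k * t ^ k)"
      by (simp add: C_def sum_distrib_right)
    finally show ?thesis .
  qed
  have "\<not> Z (C (w b0))"
  proof -
    have b0X: "b0 \<in> J" using b0 B by auto
    have "Z (D xs)" if "xs \<in> J" "w xs = w b0" "xs \<noteq> b0" for xs
    proof (rule span)
      show "xs \<in> J - B" using that b0(1) B(3) by (auto dest: inj_onD)
    qed (use b0(3) that in auto)
    then have "Z (\<Sum>xs\<in>{xs \<in> J. w xs = w b0} - {b0}. D xs)" by (intro Z_sum) auto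
    moreover have "C (w b0) = D b0 + (\<Sum>xs\<in>{xs \<in> J. w xs = w b0} - {b0}. D xs)"
      unfolding C_def using b0X \<open>finite J\<close> by (intro sum.remove) auto
    ultimately show ?thesis using b0(2) Z_add_cancel by simp
  qed
  have "\<exists>t\<in>S. \<not> Z (f (\<lambda>i. t ^ (weights \<alpha> L ! i)))"
    if S: "finite S" "card S > 2 ^ L * Q ^ L" "\<And>s s'. s \<in> S \<Longrightarrow> s' \<in> S \<Longrightarrow> s \<noteq> s' \<Longrightarrow> \<not> Z (s - s')" for S
  proof (rule ccontr)
    assume no: "\<not> (\<exists>t\<in>S. \<not> Z (f (\<lambda>i. t ^ (weights \<alpha> L ! i))))"
    have "Z (C (w b0))"
    proof (rule polynomial_roots[OF S(1) _ S(3), of d])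
      show "w b0 \<le> d" using w_le b0 B by auto
    qed (use S(2) no in \<open>auto simp: d_def poly\<close>)
    then show False using \<open>\<not> Z (C (w b0))\<close> by contradiction
  qed
  note hit = this
  have "\<forall>S. finite S \<longrightarrow> card S > 2 ^ L * Q ^ L \<longrightarrow>
     (\<forall>s\<in>S. \<forall>s'\<in>S. s \<noteq> s' \<longrightarrow> \<not> Z (s - s')) \<longrightarrow> (\<exists>t\<in>S. \<not> Z (f (\<lambda>i. t ^ (weights \<alpha> L ! i))))"
    by (intro allI impI hit) simp_all
  then show ?thesis using \<alpha> by (intro exI[of _ \<alpha>]) simp
qed

end

section \<open>Removing wide linear functions\<close>

type_synonym 'b aff = "'b \<times> (nat \<Rightarrow> 'b)"

definition aff_val :: "nat \<Rightarrow> 'b::comm_ring_1 aff \<Rightarrow> (nat \<Rightarrow> 'b) \<Rightarrow> 'b" where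
  "aff_val n l x = fst l + (\<Sum>i<n. snd l i * x i)"

definition gate_val :: "nat \<Rightarrow> 'b::comm_ring_1 aff list \<Rightarrow> (nat \<Rightarrow> 'b) \<Rightarrow> 'b" where
  "gate_val n g x = prod_list (map (\<lambda>l. aff_val n l x) g)"

definition form_val :: "nat \<Rightarrow> 'b::comm_ring_1 aff list list \<Rightarrow> (nat \<Rightarrow> 'b) \<Rightarrow> 'b" where
  "form_val n \<Phi> x = sum_list (map (\<lambda>g. gate_val n g x) \<Phi>)"

definition supp :: "nat \<Rightarrow> 'b::comm_ring_1 aff \<Rightarrow> nat set" where
  "supp n l = {i. i < n \<and> snd l i \<noteq> 0}"

definition disj_gate :: "nat \<Rightarrow> 'b::comm_ring_1 aff list \<Rightarrow> bool" where
  "disj_gate n g = sorted_wrt (\<lambda>l l'. supp n l \<inter> supp n l' = {}) g"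

lemma finite_supp [simp]: "finite (supp n l)"
  by (simp add: supp_def)

lemma gate_val_simps [simp]:
  "gate_val n [] x = 1" "gate_val n (l # g) x = aff_val n l x * gate_val n g x"
  by (simp_all add: gate_val_def)

lemma form_val_simps [simp]:
  "form_val n [] x = 0" "form_val n (g # \<Phi>) x = gate_val n g x + form_val n \<Phi> x"
  by (simp_all add: form_val_def)

lemma disj_gate_simps [simp]:
  "disj_gate n []" "disj_gate n (l # g) \<longleftrightarrow> (\<forall>l'\<in>set g. supp n l \<inter> supp n l' = {}) \<and> disj_gate n g"
  by (simp_all add: disj_gate_def)

lemma aff_val_cong:
  assumes "\<And>i. i \<in> supp n l \<Longrightarrow> x i = y i"
  shows "aff_val n l x = aff_val n l y"
proof -
  have "snd l i * x i = snd l i * y i" if "i < n" for i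
    using assms[of i] that by (cases "snd l i = 0") (auto simp: supp_def)
  then show ?thesis by (simp add: aff_val_def)
qed

lemma gate_val_cong:
  assumes "\<And>l i. l \<in> set g \<Longrightarrow> i \<in> supp n l \<Longrightarrow> x i = y i"
  shows "gate_val n g x = gate_val n g y"
  using assms by (induction g) (auto intro!: arg_cong2[where f = times] aff_val_cong)

lemma form_val_cong:
  assumes "\<And>i. i < n \<Longrightarrow> x i = y i"
  shows "form_val n \<Phi> x = form_val n \<Phi> y"
proof -
  have "gate_val n g x = gate_val n g y" for g
    by (rule gate_val_cong) (auto simp: supp_def assms)
  then show ?thesis by (simp add: form_val_def)
qed

lemma aff_val_upd:
  assumes "v < n"
  shows "aff_val n l (x(v := a)) = aff_val n l (x(v := 0)) + a * snd l v"
proof -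
  have "(\<Sum>i<n. snd l i * (x(v := b)) i) = snd l v * b + (\<Sum>i\<in>{..<n} - {v}. snd l i * x i)" for b
    using assms by (subst sum.remove[of _ v]) auto
  then show ?thesis by (simp add: aff_val_def algebra_simps)
qed

definition deriv_aff :: "nat \<Rightarrow> 'b::comm_ring_1 aff \<Rightarrow> 'b aff" where
  "deriv_aff v l = (if snd l v = 0 then l else (snd l v, \<lambda>_. 0))"

text \<open>In a product of functions with disjoint supports only one factor contains
  \<open>v\<close>, so the derivative is again such a product. Gates without \<open>v\<close> are
  removed since their derivative is 0, whereas \<open>deriv_aff\<close> would keep them.\<close>

definition deriv_form :: "nat \<Rightarrow> nat \<Rightarrow> 'b::comm_ring_1 aff list list \<Rightarrow> 'b aff list list" where
  "deriv_form n v \<Phi> = map (map (deriv_aff v)) (filter (\<lambda>g. \<exists>l\<in>set g. v \<in> supp n l) \<Phi>)"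

lemma supp_deriv_aff_subset: "i \<in> supp n (deriv_aff v l) \<Longrightarrow> i \<in> supp n l"
  by (auto simp: supp_def deriv_aff_def split: if_splits)

lemma supp_deriv_aff: "v < n \<Longrightarrow> supp n (deriv_aff v l) = (if v \<in> supp n l then {} else supp n l)"
  by (auto simp: supp_def deriv_aff_def)

lemma gate_val_upd:
  assumes "v < n" "disj_gate n g"
  shows "gate_val n g (x(v := a)) = gate_val n g (x(v := 0)) +
    a * (if \<exists>l\<in>set g. v \<in> supp n l then gate_val n (map (deriv_aff v) g) x else 0)"
  using assms(2)
proof (induction g)
  case (Cons l g)
  define xa x0 where xa: "xa = x(v := a)" and x0: "x0 = x(v := 0)"
  have IH: "gate_val n g xa = gate_val n g x0 +
      a * (if \<exists>l\<in>set g. v \<in> supp n l then gate_val n (map (deriv_aff v) g) x else 0)"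
    unfolding xa x0 using Cons.prems by (intro Cons.IH) simp
  show ?case
    unfolding xa[symmetric] x0[symmetric]
  proof (cases "v \<in> supp n l")
    case True
    then have nv: "v \<notin> supp n l'" if "l' \<in> set g" for l' using Cons.prems that by auto
    have g: "gate_val n g xa = gate_val n g x" "gate_val n g x0 = gate_val n g x"
      unfolding xa x0 using nv by (intro gate_val_cong; auto)+
    have "map (deriv_aff v) g = g"
      using nv assms(1) by (intro map_idI) (auto simp: deriv_aff_def supp_def)
    moreover have "aff_val n (deriv_aff v l) x = snd l v"
      using True by (simp add: deriv_aff_def supp_def aff_val_def)
    moreover have "aff_val n l xa = aff_val n l x0 + a * snd l v"
      unfolding xa x0 by (rule aff_val_upd[OF assms(1)])
    ultimately show "gate_val n (l # g) xa = gate_val n (l # g) x0 + a *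
        (if \<exists>l\<in>set (l # g). v \<in> supp n l then gate_val n (map (deriv_aff v) (l # g)) x else 0)"
      using True by (simp add: g algebra_simps)
  next
    case False
    have l: "aff_val n l xa = aff_val n l x" "aff_val n l x0 = aff_val n l x"
      unfolding xa x0 using False by (intro aff_val_cong; auto)+
    have "deriv_aff v l = l" using False assms(1) by (simp add: deriv_aff_def supp_def)
    then show "gate_val n (l # g) xa = gate_val n (l # g) x0 + a *
        (if \<exists>l\<in>set (l # g). v \<in> supp n l then gate_val n (map (deriv_aff v) (l # g)) x else 0)"
      using False IH by (simp add: l algebra_simps)
  qed
qed simp

lemma form_val_upd:
  assumes "v < n" "\<forall>g\<in>set \<Phi>. disj_gate n g"
  shows "form_val n \<Phi> (x(v := a)) = form_val n \<Phi> (x(v := 0)) + a * form_val n (deriv_form n v \<Phi>) x"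
  using assms(2)
  by (induction \<Phi>) (auto simp: deriv_form_def gate_val_upd[OF assms(1), of _ x a] algebra_simps)

definition drop_aff :: "nat \<Rightarrow> 'b::comm_ring_1 aff \<Rightarrow> 'b aff" where
  "drop_aff v l = (fst l, (snd l)(v := 0))"

definition drop_var :: "nat \<Rightarrow> 'b::comm_ring_1 aff list list \<Rightarrow> 'b aff list list" where
  "drop_var v \<Phi> = map (map (drop_aff v)) \<Phi>"

lemma form_val_drop_var:
  assumes "v < n"
  shows "form_val n (drop_var v \<Phi>) x = form_val n \<Phi> (x(v := 0))"
proof -
  have "aff_val n (drop_aff v l) x = aff_val n l (x(v := 0))" for l
    unfolding aff_val_def drop_aff_def by (auto intro!: sum.cong)
  then show ?thesis
    by (simp add: form_val_def gate_val_def drop_var_def comp_def)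
qed

lemma supp_drop_aff: "supp n (drop_aff v l) = supp n l - {v}"
  by (auto simp: supp_def drop_aff_def)

lemma disj_gate_map:
  assumes "disj_gate n g" "\<And>l i. i \<in> supp n (f l) \<Longrightarrow> i \<in> supp n l"
  shows "disj_gate n (map f g)"
  using assms(1)
proof (induction g)
  case (Cons l g)
  have "supp n (f l) \<inter> supp n (f l') = {}" if "l' \<in> set g" for l'
    using Cons.prems that assms(2)[of _ l] assms(2)[of _ l'] by auto
  then show ?case using Cons by simp
qed simp

definition wide :: "nat \<Rightarrow> nat \<Rightarrow> 'b::comm_ring_1 aff \<Rightarrow> bool" where
  "wide n m l \<longleftrightarrow> n \<le> m * card (supp n l)"

definition wide_count :: "nat \<Rightarrow> nat \<Rightarrow> 'b::comm_ring_1 aff list list \<Rightarrow> nat" where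
  "wide_count n m \<Phi> = length (filter (wide n m) (concat \<Phi>))"

text \<open>Differentiation turns each function that contains \<open>v\<close> into a constant,
  which is not wide because \<open>n > 0\<close>; the others are unchanged or disappear with their
  gate.\<close>

lemma wide_count_deriv:
  assumes "v < n"
  shows "wide_count n m (deriv_form n v \<Phi>) +
     length (filter (\<lambda>l. wide n m l \<and> v \<in> supp n l) (concat \<Phi>)) \<le> wide_count n m \<Phi>"
proof -
  have gate: "length (filter (wide n m) (map (deriv_aff v) g)) +
      length (filter (\<lambda>l. wide n m l \<and> v \<in> supp n l) g) \<le> length (filter (wide n m) g)" for g
    using assms by (induction g) (auto simp: wide_def supp_deriv_aff)
  have no: "filter (\<lambda>l. wide n m l \<and> v \<in> supp n l) g = []" if "\<not> (\<exists>l\<in>set g. v \<in> supp n l)" for g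
    using that by (auto simp: filter_empty_conv)
  show ?thesis
  proof (induction \<Phi>)
    case (Cons g \<Phi>)
    then show ?case
      using gate[of g] no[of g] by (auto simp: wide_count_def deriv_form_def)
  qed (simp add: wide_count_def deriv_form_def)
qed

lemma wide_count_drop_var: "wide_count n m (drop_var v \<Phi>) \<le> wide_count n m \<Phi>"
proof -
  have *: "length (filter (wide n m) (map (drop_aff v) g)) \<le> length (filter (wide n m) g)"
    for g :: "'a aff list"
  proof (induction g)
    case (Cons l g)
    have "wide n m l" if "wide n m (drop_aff v l)"
      using that mult_le_mono2[OF card_mono[OF finite_supp[of n l] Diff_subset], of m "{v}"]
      unfolding wide_def supp_drop_aff by linarith
    with Cons show ?case by auto
  qed simp
  show ?thesis
  proof (induction \<Phi>)
    case (Cons g \<Phi>)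
    then show ?case using *[of g] by (simp add: wide_count_def drop_var_def)
  qed (simp add: wide_count_def drop_var_def)
qed

text \<open>Double counting of pairs of a wide function and a variable in it: each wide function
  contributes at least \<open>n / m\<close> pairs, so one of the \<open>n\<close> variables occurs
  in a fraction \<open>1 / m\<close> of them.\<close>

lemma popular_variable:
  assumes "0 < n"
  shows "\<exists>v<n. wide_count n m \<Phi> \<le> m * length (filter (\<lambda>l. wide n m l \<and> v \<in> supp n l) (concat \<Phi>))"
proof (rule ccontr)
  define cnt where "cnt v = length (filter (\<lambda>l. wide n m l \<and> v \<in> supp n l) (concat \<Phi>))" for v
  assume "\<not> ?thesis"
  then have "(\<Sum>v<n. m * cnt v) < (\<Sum>v<n. wide_count n m \<Phi>)"
    using assms unfolding cnt_def by (intro sum_strict_mono) (auto simp: not_le)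
  also have "(\<Sum>v<n. wide_count n m \<Phi>) = n * wide_count n m \<Phi>" by simp
  also have "n * length (filter (wide n m) ls)
      \<le> m * (\<Sum>v<n. length (filter (\<lambda>l. wide n m l \<and> v \<in> supp n l) ls))" for ls :: "'a aff list"
  proof (induction ls)
    case (Cons l ls)
    have "(\<Sum>v<n. length (filter (\<lambda>l. wide n m l \<and> v \<in> supp n l) (l # ls)))
      = (\<Sum>v<n. of_bool (wide n m l \<and> v \<in> supp n l)) +
        (\<Sum>v<n. length (filter (\<lambda>l. wide n m l \<and> v \<in> supp n l) ls))"
      by (subst sum.distrib[symmetric]) (auto intro!: sum.cong)
    moreover have "(\<Sum>v<n. of_bool (wide n m l \<and> v \<in> supp n l)) = (if wide n m l then card (supp n l) else 0)"
    proof -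
      have "{v. v < n \<and> v \<in> supp n l} = supp n l" by (auto simp: supp_def)
      then show ?thesis by (auto simp: sum_of_bool_eq Int_def)
    qed
    ultimately show ?case
      using Cons by (auto simp: wide_def algebra_simps)
  qed (simp add: wide_def)
  then have "n * wide_count n m \<Phi> \<le> (\<Sum>v<n. m * cnt v)"
    by (simp add: wide_count_def cnt_def sum_distrib_left)
  finally show False by simp
qed

text \<open>Each derivative step multiplies the number of wide functions by at most
  \<open>1 - 1 / m\<close> and uses up one unit of \<open>d\<close>; the hypothesis on
  \<open>wide_count\<close> is the resulting invariant in integers. A variable with vanishing
  derivative is set to 0 in the formula instead, which costs nothing. Either way it leaves
  \<open>V\<close>, so the recursion ends.\<close>

lemma (in prime_zero) remove_wide:
  assumes "0 < n" "\<forall>g\<in>set \<Phi>. disj_gate n g" "finite V" "\<forall>g\<in>set \<Phi>. \<forall>l\<in>set g. supp n l \<subseteq> V"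
    and "wide_count n m \<Phi> * (m - 1) ^ d < m ^ d" "\<not> Z (form_val n \<Phi> x0)"
  shows "\<exists>A \<Psi>. A \<subseteq> {..<n} \<and> card A \<le> d \<and> length \<Psi> \<le> length \<Phi> \<and>
     (\<forall>g\<in>set \<Psi>. disj_gate n g \<and> (\<forall>l\<in>set g. \<not> wide n m l)) \<and> (\<exists>x. \<not> Z (form_val n \<Psi> x)) \<and>
     (\<forall>x. \<not> Z (form_val n \<Psi> x) \<longrightarrow>
        (\<exists>Y. \<not> Z (form_val n \<Phi> (\<lambda>i. if i \<in> A then of_bool (i \<in> Y) else x i))))"
  using assms(2-)
proof (induction "card V" arbitrary: V d \<Phi> x0 rule: less_induct)
  case less
  show ?case
  proof (cases "wide_count n m \<Phi> = 0")
    case True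
    then show ?thesis
      using less.prems
      by (intro exI[of _ "{}"] exI[of _ \<Phi>]) (auto simp: wide_count_def filter_empty_conv)
  next
    case False
    obtain v where v: "v < n"
      "wide_count n m \<Phi> \<le> m * length (filter (\<lambda>l. wide n m l \<and> v \<in> supp n l) (concat \<Phi>))" (is "_ \<le> m * ?c")
      using popular_variable[OF assms(1)] by blast
    have "filter (\<lambda>l. wide n m l \<and> v \<in> supp n l) (concat \<Phi>) \<noteq> []" using v(2) False by auto
    then have vV: "v \<in> V" using less.prems(3) by (auto simp: filter_empty_conv)
    then have cardV: "card (V - {v}) < card V" using less.prems(2) by (meson card_Diff1_less)
    show ?thesis
    proof (cases "\<exists>x. \<not> Z (form_val n (deriv_form n v \<Phi>) x)")
      case True
      then obtain x1 where x1: "\<not> Z (form_val n (deriv_form n v \<Phi>) x1)" by blast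
      \<comment> \<open>With \<open>d = 0\<close> the invariant would leave no wide
        function.\<close>
      obtain d' where d: "d = Suc d'" using False less.prems(4) by (cases d) auto
      have wc: "wide_count n m (deriv_form n v \<Phi>) * (m - 1) ^ d' < m ^ d'"
      proof -
        have "m * wide_count n m (deriv_form n v \<Phi>) + m * ?c \<le> m * wide_count n m \<Phi>"
          using wide_count_deriv[OF v(1), of m \<Phi>] by (metis add_mult_distrib2 mult_le_mono2)
        then have "m * wide_count n m (deriv_form n v \<Phi>) \<le> (m - 1) * wide_count n m \<Phi>"
          using v(2) by (simp add: diff_mult_distrib)
        then have "m * wide_count n m (deriv_form n v \<Phi>) * (m - 1) ^ d'
            \<le> (m - 1) * wide_count n m \<Phi> * (m - 1) ^ d'"
          by (rule mult_le_mono1)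
        also have "\<dots> < m * m ^ d'" using less.prems(4) by (simp add: d ac_simps)
        finally show ?thesis by (simp add: mult.assoc)
      qed
      have disj_gate': "\<forall>g\<in>set (deriv_form n v \<Phi>). disj_gate n g"
        using less.prems(1)
        by (auto simp: deriv_form_def intro!: disj_gate_map intro: supp_deriv_aff_subset)
      have supp': "\<forall>g\<in>set (deriv_form n v \<Phi>). \<forall>l\<in>set g. supp n l \<subseteq> V - {v}"
        using less.prems(3) v(1) by (fastforce simp: deriv_form_def supp_deriv_aff split: if_splits)
      obtain A \<Psi> where A: "A \<subseteq> {..<n}" "card A \<le> d'" "length \<Psi> \<le> length (deriv_form n v \<Phi>)"
        "\<forall>g\<in>set \<Psi>. disj_gate n g \<and> (\<forall>l\<in>set g. \<not> wide n m l)" "\<exists>x. \<not> Z (form_val n \<Psi> x)"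
        "\<And>x. \<not> Z (form_val n \<Psi> x) \<Longrightarrow>
          \<exists>Y. \<not> Z (form_val n (deriv_form n v \<Phi>) (\<lambda>i. if i \<in> A then of_bool (i \<in> Y) else x i))"
        using less.hyps[OF cardV disj_gate' _ supp' wc x1] less.prems(2) by auto
      have "length (deriv_form n v \<Phi>) \<le> length \<Phi>" by (simp add: deriv_form_def)
      moreover have "\<exists>Y. \<not> Z (form_val n \<Phi> (\<lambda>i. if i \<in> insert v A then of_bool (i \<in> Y) else x i))"
        if x: "\<not> Z (form_val n \<Psi> x)" for x
      proof -
        obtain Y where Y: "\<not> Z (form_val n (deriv_form n v \<Phi>) (\<lambda>i. if i \<in> A then of_bool (i \<in> Y) else x i))"
          using A(6)[OF x] by blast
        define x' where "x' = (\<lambda>i. if i \<in> A then of_bool (i \<in> Y) else x i)"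
        have "form_val n \<Phi> (x'(v := 1)) - form_val n \<Phi> (x'(v := 0)) = form_val n (deriv_form n v \<Phi>) x'"
          using form_val_upd[OF v(1) less.prems(1), of x' 1] by simp
        then have "\<not> Z (form_val n \<Phi> (x'(v := 1))) \<or> \<not> Z (form_val n \<Phi> (x'(v := 0)))"
          using Y Z_diff[of "form_val n \<Phi> (x'(v := 1))" "form_val n \<Phi> (x'(v := 0))"]
          by (auto simp add: x'_def[symmetric] simp del: fun_upd_apply)
        moreover have "x'(v := 1) = (\<lambda>i. if i \<in> insert v A then of_bool (i \<in> insert v Y) else x i)"
          "x'(v := 0) = (\<lambda>i. if i \<in> insert v A then of_bool (i \<in> Y - {v}) else x i)"
          by (auto simp: x'_def)
        ultimately show ?thesis by (elim disjE) (rule exI, simp only: not_False_eq_True)+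
      qed
      moreover have "card (insert v A) \<le> d"
        using A(1,2) card_insert_le_m1[of d A v] by (simp add: d card_insert_if finite_subset)
      ultimately show ?thesis
        using A v(1) by (intro exI[of _ "insert v A"] exI[of _ \<Psi>]) auto
    next
      case False
      \<comment> \<open>The derivative is in \<open>Z\<close> at every point, so coordinate
        \<open>v\<close> has no influence on whether the value is in \<open>Z\<close>. This is why
        \<open>A\<close> does not have to grow in this case.\<close>
      then have indep: "Z (form_val n \<Phi> x) \<longleftrightarrow> Z (form_val n \<Phi> (x(v := 0)))" for x
        using form_val_upd[OF v(1) less.prems(1), of x "x v"] Z_add_cancel Z_mult by simp
      have x1: "\<not> Z (form_val n (drop_var v \<Phi>) x0)"
        using less.prems(5) indep by (simp add: form_val_drop_var[OF v(1)])
      have disj_gate': "\<forall>g\<in>set (drop_var v \<Phi>). disj_gate n g"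
        using less.prems(1) by (auto simp: drop_var_def supp_drop_aff intro!: disj_gate_map)
      have supp': "\<forall>g\<in>set (drop_var v \<Phi>). \<forall>l\<in>set g. supp n l \<subseteq> V - {v}"
        using less.prems(3) by (fastforce simp: drop_var_def supp_drop_aff)
      have wc: "wide_count n m (drop_var v \<Phi>) * (m - 1) ^ d < m ^ d"
        using mult_le_mono1[OF wide_count_drop_var] less.prems(4) by (rule le_less_trans)
      obtain A \<Psi> where A: "A \<subseteq> {..<n}" "card A \<le> d" "length \<Psi> \<le> length (drop_var v \<Phi>)"
        "\<forall>g\<in>set \<Psi>. disj_gate n g \<and> (\<forall>l\<in>set g. \<not> wide n m l)" "\<exists>x. \<not> Z (form_val n \<Psi> x)"
        "\<And>x. \<not> Z (form_val n \<Psi> x) \<Longrightarrow>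
          \<exists>Y. \<not> Z (form_val n (drop_var v \<Phi>) (\<lambda>i. if i \<in> A then of_bool (i \<in> Y) else x i))"
        using less.hyps[OF cardV disj_gate' _ supp' wc x1] less.prems(2) by auto
      have "Z (form_val n (drop_var v \<Phi>) x) \<longleftrightarrow> Z (form_val n \<Phi> x)" for x
        unfolding form_val_drop_var[OF v(1)] by (rule indep[symmetric])
      moreover have "length (drop_var v \<Phi>) = length \<Phi>" by (simp add: drop_var_def)
      ultimately show ?thesis
        using A by (intro exI[of _ A] exI[of _ \<Psi>]) simp
    qed
  qed
qed

section \<open>Restriction to a block\<close>

text \<open>A bound \<open>r\<close> on the tensor rank, where an affine function of
  \<open>z i\<close> is a vector in slot \<open>i\<close>. The scalars \<open>c\<close> make
  constants expressible when \<open>S\<close> is empty.\<close>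

definition prod_sum :: "nat set \<Rightarrow> nat \<Rightarrow> ((nat \<Rightarrow> 'b::comm_ring_1) \<Rightarrow> 'b) \<Rightarrow> bool" where
  "prod_sum S r f \<longleftrightarrow>
     (\<exists>c a b. \<forall>z. f z = (\<Sum>g<r. c g * (\<Prod>i\<in>S. a g i + b g i * z i)))"

lemma prod_sum_const: "prod_sum {} 1 (\<lambda>_. k)"
  unfolding prod_sum_def by (rule exI[of _ "\<lambda>_. k"]) simp

lemma prod_sum_mono:
  assumes "prod_sum S r f" "S \<subseteq> S'" "finite S'"
  shows "prod_sum S' r f"
proof -
  obtain c a b where f: "\<And>z. f z = (\<Sum>g<r. c g * (\<Prod>i\<in>S. a g i + b g i * z i))"
    using assms(1) unfolding prod_sum_def by blast
  define a' where "a' g i = (if i \<in> S then a g i else 1)" for g i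
  define b' where "b' g i = (if i \<in> S then b g i else 0)" for g i
  have "(\<Prod>i\<in>S'. a' g i + b' g i * z i) = (\<Prod>i\<in>S. a g i + b g i * z i)" for g z
    using assms(2,3) by (intro prod.mono_neutral_cong_right) (auto simp: a'_def b'_def)
  then have "\<forall>z. f z = (\<Sum>g<r. c g * (\<Prod>i\<in>S'. a' g i + b' g i * z i))" using f by simp
  then show ?thesis unfolding prod_sum_def by blast
qed

lemma prod_sum_mult_const:
  assumes "prod_sum S r f"
  shows "prod_sum S r (\<lambda>z. k * f z)"
proof -
  obtain c a b where f: "\<And>z. f z = (\<Sum>g<r. c g * (\<Prod>i\<in>S. a g i + b g i * z i))"
    using assms(1) unfolding prod_sum_def by blast
  then have "\<forall>z. k * f z = (\<Sum>g<r. (k * c g) * (\<Prod>i\<in>S. a g i + b g i * z i))"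
    by (simp add: sum_distrib_left mult.assoc)
  then show ?thesis
    unfolding prod_sum_def by (intro exI[of _ "\<lambda>g. k * c g"] exI[of _ a] exI[of _ b])
qed

lemma prod_sum_add:
  assumes "prod_sum S r f" "prod_sum S r' f'"
  shows "prod_sum S (r + r') (\<lambda>z. f z + f' z)"
proof -
  obtain c a b where f: "\<And>z. f z = (\<Sum>g<r. c g * (\<Prod>i\<in>S. a g i + b g i * z i))"
    using assms(1) unfolding prod_sum_def by blast
  obtain c' a' b' where f': "\<And>z. f' z = (\<Sum>g<r'. c' g * (\<Prod>i\<in>S. a' g i + b' g i * z i))"
    using assms(2) unfolding prod_sum_def by blast
  define C where "C g = (if g < r then c g else c' (g - r))" for g
  define A where "A g = (if g < r then a g else a' (g - r))" for g
  define B where "B g = (if g < r then b g else b' (g - r))" for g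
  have split: "(\<Sum>g<r + r'. h g) = (\<Sum>g<r. h g) + (\<Sum>g<r'. h (r + g))" for h :: "nat \<Rightarrow> 'a"
  proof -
    have "(\<Sum>g<r + r'. h g) = (\<Sum>g=0..<r. h g) + (\<Sum>g=r..<r + r'. h g)"
      by (simp add: lessThan_atLeast0 sum.atLeastLessThan_concat)
    also have "(\<Sum>g=r..<r + r'. h g) = (\<Sum>g<r'. h (r + g))"
      using sum.shift_bounds_nat_ivl[of h 0 r r'] by (simp add: lessThan_atLeast0 ac_simps)
    finally show ?thesis by (simp add: lessThan_atLeast0)
  qed
  have "\<forall>z. f z + f' z = (\<Sum>g<r + r'. C g * (\<Prod>i\<in>S. A g i + B g i * z i))"
    unfolding split f f' by (simp add: C_def A_def B_def)
  then show ?thesis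
    unfolding prod_sum_def by blast
qed

lemma prod_sum_zero: "prod_sum S 0 (\<lambda>_. 0)"
  by (simp add: prod_sum_def)

lemma prod_sum_sum:
  assumes "finite T" "\<And>i. i \<in> T \<Longrightarrow> prod_sum S r (f i)"
  shows "prod_sum S (card T * r) (\<lambda>z. \<Sum>i\<in>T. f i z)"
  using assms
proof (induction T rule: finite_induct)
  case empty
  then show ?case by (simp add: prod_sum_zero)
next
  case (insert i T)
  then have "prod_sum S (r + card T * r) (\<lambda>z. f i z + (\<Sum>i\<in>T. f i z))"
    by (intro prod_sum_add) auto
  then show ?case using insert by simp
qed

lemma prod_sum_mult_affine:
  assumes "finite S" "i \<notin> S" "prod_sum S r f"
  shows "prod_sum (insert i S) r (\<lambda>z. (k + d * z i) * f z)"
proof -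
  obtain c a b where f: "\<And>z. f z = (\<Sum>g<r. c g * (\<Prod>i\<in>S. a g i + b g i * z i))"
    using assms(3) unfolding prod_sum_def by blast
  define A where "A g j = (if j = i then k else a g j)" for g j
  define B where "B g j = (if j = i then d else b g j)" for g j
  have "(\<Prod>j\<in>S. A g j + B g j * z j) = (\<Prod>i\<in>S. a g i + b g i * z i)" for g z
    using assms(2) by (intro prod.cong) (auto simp: A_def B_def)
  then have "(k + d * z i) * f z = (\<Sum>g<r. c g * (\<Prod>j\<in>insert i S. A g j + B g j * z j))" for z
    using assms(1,2) by (simp add: f sum_distrib_left A_def B_def ac_simps)
  then show ?thesis unfolding prod_sum_def by blast
qed

text \<open>The number of univariate summands into which an affine function of \<open>k\<close> variables is split.\<close>

definition pieces :: "nat \<Rightarrow> nat" where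
  "pieces k = (if k \<le> 1 then 1 else k + 1)"

text \<open>Expanding the sum multiplies the number of summands, except when the function has at
  most one variable in the block: then it is itself a univariate factor. Hence only functions with
  several variables in a block are expensive.\<close>

lemma prod_sum_mult_multi:
  assumes "finite S" "finite T" "T \<inter> S = {}" "prod_sum S r f"
  shows "prod_sum (T \<union> S) (pieces (card T) * r) (\<lambda>z. (k + (\<Sum>i\<in>T. d i * z i)) * f z)"
proof (cases "card T \<le> 1")
  case True
  then consider "T = {}" | i where "T = {i}"
    using assms(2) by (metis One_nat_def card_0_eq card_1_singletonE le_Suc_eq le_zero_eq)
  then show ?thesis
  proof cases
    case 1
    then show ?thesis using prod_sum_mult_const[OF assms(4)] by (simp add: pieces_def)
  next
    case 2
    then show ?thesis using prod_sum_mult_affine[OF assms(1) _ assms(4), of i k "d i"] assms(3)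
      by (simp add: pieces_def)
  qed
next
  case False
  have "prod_sum (T \<union> S) r (\<lambda>z. d i * z i * f z)" if "i \<in> T" for i
  proof (rule prod_sum_mono)
    show "prod_sum (insert i S) r (\<lambda>z. d i * z i * f z)"
      using prod_sum_mult_affine[OF assms(1) _ assms(4), of i 0 "d i"] that assms(3) by auto
  qed (use that assms in auto)
  then have "prod_sum (T \<union> S) (card T * r) (\<lambda>z. \<Sum>i\<in>T. d i * z i * f z)"
    by (rule prod_sum_sum[OF assms(2)])
  moreover have "prod_sum (T \<union> S) r (\<lambda>z. k * f z)"
    using assms by (intro prod_sum_mult_const prod_sum_mono[OF assms(4)]) auto
  ultimately have "prod_sum (T \<union> S) (r + card T * r) (\<lambda>z. k * f z + (\<Sum>i\<in>T. d i * z i * f z))"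
    by (rule prod_sum_add[rotated])
  moreover have "k * f z + (\<Sum>i\<in>T. d i * z i * f z) = (k + (\<Sum>i\<in>T. d i * z i)) * f z" for z
    by (simp add: distrib_right sum_distrib_right)
  ultimately show ?thesis
    using False by (simp add: pieces_def)
qed

definition override :: "(nat \<Rightarrow> 'b) \<Rightarrow> nat set \<Rightarrow> (nat \<Rightarrow> 'b) \<Rightarrow> nat \<Rightarrow> 'b" where
  "override x B z = (\<lambda>i. if i \<in> B then z i else x i)"

definition gate_pieces :: "nat \<Rightarrow> nat set \<Rightarrow> 'b::comm_ring_1 aff list \<Rightarrow> nat" where
  "gate_pieces n B g = prod_list (map (\<lambda>l. pieces (card (supp n l \<inter> B))) g)"

text \<open>Variables outside \<open>B\<close> are fixed by \<open>x\<close> and join the constant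
  term. Disjoint supports keep the index sets of different factors disjoint, as multiplication by a
  univariate factor requires.\<close>

lemma prod_sum_gate:
  assumes "disj_gate n g"
  shows "prod_sum ((\<Union>l\<in>set g. supp n l) \<inter> B) (gate_pieces n B g) (\<lambda>z. gate_val n g (override x B z))"
  using assms
proof (induction g)
  case Nil
  then show ?case using prod_sum_const[of 1] by (simp add: gate_pieces_def)
next
  case (Cons l g)
  define S where "S = (\<Union>l\<in>set g. supp n l) \<inter> B"
  define k where "k = fst l + (\<Sum>i\<in>{..<n} - supp n l \<inter> B. snd l i * x i)"
  have l: "aff_val n l (override x B z) = k + (\<Sum>i\<in>supp n l \<inter> B. snd l i * z i)" for z
  proof -
    have "(\<Sum>i<n. snd l i * override x B z i) =
      (\<Sum>i\<in>{..<n} - supp n l \<inter> B. snd l i * override x B z i) + (\<Sum>i\<in>supp n l \<inter> B. snd l i * override x B z i)"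
      by (rule sum.subset_diff) (auto simp: supp_def)
    also have "(\<Sum>i\<in>{..<n} - supp n l \<inter> B. snd l i * override x B z i) = (\<Sum>i\<in>{..<n} - supp n l \<inter> B. snd l i * x i)"
      by (rule sum.cong) (auto simp: override_def supp_def)
    also have "(\<Sum>i\<in>supp n l \<inter> B. snd l i * override x B z i) = (\<Sum>i\<in>supp n l \<inter> B. snd l i * z i)"
      by (rule sum.cong) (auto simp: override_def)
    finally show ?thesis by (simp add: aff_val_def k_def)
  qed
  have "prod_sum (supp n l \<inter> B \<union> S) (pieces (card (supp n l \<inter> B)) * gate_pieces n B g)
     (\<lambda>z. (k + (\<Sum>i\<in>supp n l \<inter> B. snd l i * z i)) * gate_val n g (override x B z))"
    using Cons by (intro prod_sum_mult_multi) (auto simp: S_def)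
  moreover have "supp n l \<inter> B \<union> S = (\<Union>l\<in>set (l # g). supp n l) \<inter> B" by (auto simp: S_def)
  ultimately show ?case by (simp add: l gate_pieces_def)
qed

lemma prod_sum_form:
  assumes "\<forall>g\<in>set \<Phi>. disj_gate n g" "finite B"
  shows "prod_sum B (sum_list (map (gate_pieces n B) \<Phi>)) (\<lambda>z. form_val n \<Phi> (override x B z))"
  using assms(1)
proof (induction \<Phi>)
  case Nil
  then show ?case by (simp add: prod_sum_zero)
next
  case (Cons g \<Phi>)
  have "prod_sum B (gate_pieces n B g) (\<lambda>z. gate_val n g (override x B z))"
    using Cons.prems assms(2) by (intro prod_sum_mono[OF prod_sum_gate[of n g B x]]) auto
  then show ?case using Cons by (simp add: prod_sum_add)
qed

section \<open>Splitting the variables into blocks\<close>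

text \<open>The variables form a matrix with rows of length \<open>m\<close>. Row \<open>i\<close> is shifted by \<open>s i\<close> and the blocks
  are the columns of the resulting arrangement.\<close>

definition blk :: "nat \<Rightarrow> (nat \<Rightarrow> nat) \<Rightarrow> nat \<Rightarrow> nat" where
  "blk m s v = s (v div m) + v mod m"

definition block :: "nat \<Rightarrow> nat \<Rightarrow> (nat \<Rightarrow> nat) \<Rightarrow> nat \<Rightarrow> nat set" where
  "block n m s b = {v. v < n \<and> blk m s v = b}"

text \<open>The sample space for random shifts. Restricting functions to \<open>{..<r}\<close> keeps
  it finite, so that means are finite sums.\<close>

definition shifts :: "nat \<Rightarrow> nat \<Rightarrow> (nat \<Rightarrow> nat) set" where
  "shifts r m = PiE {..<r} (\<lambda>_. {..<m})"

lemma finite_shifts [simp]: "finite (shifts r m)"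
  by (simp add: shifts_def finite_PiE)

lemma card_shifts: "card (shifts r m) = m ^ r"
  by (simp add: shifts_def card_PiE)

lemma finite_block [simp]: "finite (block n m s b)"
  by (simp add: block_def)

text \<open>Rows are shifted independently, so the variables of \<open>V\<close> all lie in block
  \<open>b\<close> with probability at most \<open>1 / m ^ card V\<close>; two variables of one row
  never share a block.\<close>

lemma shifts_in_block:
  assumes "n \<le> r * m" "finite V" "V \<subseteq> {..<n}"
  shows "card {s \<in> shifts r m. V \<subseteq> block n m s b} * m ^ card V \<le> m ^ r"
  using assms(2,3)
proof (induction V rule: finite_induct)
  case empty
  then show ?case by (simp add: card_shifts)
next
  case (insert v V)
  define J where "J = {s \<in> shifts r m. insert v V \<subseteq> block n m s b}"
  define Y where "Y = {s \<in> shifts r m. V \<subseteq> block n m s b}"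
  have vr: "v div m < r" using insert.prems assms(1) by (simp add: less_mult_imp_div_less)
  have "card J * m \<le> card Y"
  proof (cases "\<exists>u\<in>V. u div m = v div m")
    case True
    then obtain u where u: "u \<in> V" "u div m = v div m" by blast
    have "J = {}"
    proof (rule ccontr)
      assume "J \<noteq> {}"
      then obtain s where "s \<in> J" by blast
      then have "v \<in> block n m s b" "u \<in> block n m s b" using u(1) by (auto simp: J_def)
      then have "u mod m = v mod m" using u(2) by (auto simp: block_def blk_def)
      then have "u = v" using u(2) by (metis div_mult_mod_eq)
      then show False using u(1) insert.hyps by simp
    qed
    then show ?thesis by simp
  next
    case False
    \<comment> \<open>The shift of the row of \<open>v\<close> is forced by \<open>b\<close> in
      \<open>J\<close> but free in \<open>Y\<close>, since \<open>V\<close> has no variable in that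
      row; so every element of \<open>J\<close> yields \<open>m\<close> elements of
      \<open>Y\<close>.\<close>
    define h where "h = (\<lambda>(s :: nat \<Rightarrow> nat, y). s(v div m := y))"
    have "inj_on h (J \<times> {..<m})"
    proof (rule inj_onI)
      fix p p' assume p: "p \<in> J \<times> {..<m}" "p' \<in> J \<times> {..<m}" "h p = h p'"
      obtain s y s' y' where sy: "p = (s, y)" "p' = (s', y')" by fastforce
      have "s \<in> J" "s' \<in> J" using p sy by auto
      then have "s (v div m) = s' (v div m)" by (auto simp: J_def block_def blk_def)
      moreover have eq: "s(v div m := y) = s'(v div m := y')" using p(3) sy by (simp add: h_def)
      ultimately have "s = s'" by (metis fun_upd_triv fun_upd_upd)
      moreover have "y = y'" using fun_cong[OF eq, of "v div m"] by simp
      ultimately show "p = p'" using sy by simp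
    qed
    moreover have "h ` (J \<times> {..<m}) \<subseteq> Y"
    proof (rule image_subsetI)
      fix p assume "p \<in> J \<times> {..<m}"
      then obtain s y where p: "p = (s, y)" "s \<in> J" "y < m" by auto
      have "s(v div m := y) \<in> shifts r m"
        using p vr by (auto simp: J_def shifts_def PiE_def extensional_def)
      moreover have "V \<subseteq> block n m (s(v div m := y)) b"
        using p(2) False by (auto simp: J_def block_def blk_def)
      ultimately show "h p \<in> Y" by (simp add: Y_def p h_def)
    qed
    moreover have "finite Y" by (simp add: Y_def)
    ultimately have "card (J \<times> {..<m}) \<le> card Y" by (rule card_inj_on_le)
    then show ?thesis by (simp add: card_cartesian_product)
  qed
  then have "card J * m * m ^ card V \<le> card Y * m ^ card V" by (rule mult_le_mono1)
  also have "\<dots> \<le> m ^ r" unfolding Y_def using insert by simp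
  finally show ?case using insert.hyps by (simp add: J_def mult.assoc)
qed

text \<open>The right-hand side counts ordered pairs of distinct elements and is exact for
  \<open>k \<le> 1\<close>, so that functions with one variable in the block contribute the factor
  1.\<close>

lemma pieces_le: "real (pieces k) \<le> 1 + real k * (real k - 1)"
proof (cases "k \<le> 1")
  case True
  then have "k = 0 \<or> k = 1" by auto
  then show ?thesis by (auto simp: pieces_def)
next
  case False
  then have "real k * 1 \<le> real k * (real k - 1)" by (intro mult_left_mono) auto
  then show ?thesis using False by (simp add: pieces_def)
qed

lemma expected_pieces:
  fixes g :: "'b::comm_ring_1 aff list"
  assumes "n \<le> r * m" "0 < m" "disj_gate n g" "finite V" "V \<subseteq> {..<n}" "\<forall>l\<in>set g. supp n l \<inter> V = {}"
  shows "(\<Sum>s\<in>{s \<in> shifts r m. V \<subseteq> block n m s b}. real (gate_pieces n (block n m s b) g))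
    \<le> real m ^ r / real m ^ card V * prod_list (map (\<lambda>l. 1 + (real (card (supp n l)) / real m)\<^sup>2) g)"
  using assms(3-)
proof (induction g arbitrary: V)
  case Nil
  have "real (card {s \<in> shifts r m. V \<subseteq> block n m s b} * m ^ card V) \<le> real (m ^ r)"
    using shifts_in_block[OF assms(1) Nil(2,3)] of_nat_le_iff by blast
  then show ?case using assms(2) by (simp add: gate_pieces_def field_simps)
next
  case (Cons l g)
  define S where "S V = {s \<in> shifts r m. V \<subseteq> block n m s b}" for V
  define G where "G s = real (gate_pieces n (block n m s b) g)" for s
  define P where "P = {(u, v). u \<in> supp n l \<and> v \<in> supp n l \<and> u \<noteq> v}"
  define Q where "Q = prod_list (map (\<lambda>l. 1 + (real (card (supp n l)) / real m)\<^sup>2) g)"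
  have Psub: "P \<subseteq> supp n l \<times> supp n l" by (auto simp: P_def)
  have finP: "finite P" by (rule finite_subset[OF Psub]) simp
  have cardP: "card P \<le> (card (supp n l))\<^sup>2"
    using card_mono[OF _ Psub] by (simp add: card_cartesian_product power2_eq_square)
  have Q0: "Q \<ge> 0" unfolding Q_def by (rule prod_list_nonneg) auto
  have finS: "finite (S V)" for V by (simp add: S_def)
  have pairs: "real (pieces (card (supp n l \<inter> block n m s b))) \<le>
      1 + (\<Sum>(u, v)\<in>P. of_bool ({u, v} \<subseteq> block n m s b))" for s
  proof -
    define K where "K = supp n l \<inter> block n m s b"
    have "finite K" by (simp add: K_def)
    have "(\<Sum>(u, v)\<in>P. of_bool ({u, v} \<subseteq> block n m s b)) = real (card {(u, v). u \<in> K \<and> v \<in> K \<and> u \<noteq> v})"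
    proof -
      have "(\<Sum>(u, v)\<in>P. of_bool ({u, v} \<subseteq> block n m s b)) =
          (\<Sum>p\<in>{(u, v). u \<in> K \<and> v \<in> K \<and> u \<noteq> v}. 1 :: real)"
        using finP by (intro sum.mono_neutral_cong_right) (auto simp: P_def K_def)
      then show ?thesis by simp
    qed
    also have "{(u, v). u \<in> K \<and> v \<in> K \<and> u \<noteq> v} = K \<times> K - (\<lambda>u. (u, u)) ` K" by auto
    also have "card \<dots> = card K * card K - card K"
      using \<open>finite K\<close> by (subst card_Diff_subset) (auto simp: card_cartesian_product card_image inj_on_def)
    also have "real \<dots> = real (card K) * (real (card K) - 1)"
      by (cases "card K") (auto simp: algebra_simps)
    finally show ?thesis using pieces_le[of "card K"] by (simp add: K_def)
  qed
  have "(\<Sum>s\<in>S V. real (gate_pieces n (block n m s b) (l # g))) \<le>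
      (\<Sum>s\<in>S V. (1 + (\<Sum>(u, v)\<in>P. of_bool ({u, v} \<subseteq> block n m s b))) * G s)"
    using pairs by (intro sum_mono) (auto simp: gate_pieces_def G_def intro!: mult_right_mono)
  also have "\<dots> = (\<Sum>s\<in>S V. G s) + (\<Sum>p\<in>P. \<Sum>s\<in>S V. of_bool ({fst p, snd p} \<subseteq> block n m s b) * G s)"
    by (subst sum.swap) (simp add: distrib_right sum.distrib sum_distrib_right case_prod_beta)
  \<comment> \<open>The indicator restricts the sum to shifts that put the pair \<open>p\<close>
    into the block as well, where the induction hypothesis applies with a larger
    \<open>V\<close>.\<close>
  also have "\<dots> = (\<Sum>s\<in>S V. G s) + (\<Sum>p\<in>P. \<Sum>s\<in>S (V \<union> {fst p, snd p}). G s)"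
    by (intro arg_cong2[where f = "(+)"] refl sum.cong sum.mono_neutral_cong_right finS)
      (auto simp: S_def)
  also have "\<dots> \<le> real m ^ r / real m ^ card V * Q +
      (\<Sum>p\<in>P. real m ^ r / real m ^ (card V + 2) * Q)"
  proof (intro add_mono sum_mono)
    show "sum G (S V) \<le> real m ^ r / real m ^ card V * Q"
      unfolding S_def G_def Q_def using Cons.prems by (intro Cons.IH) auto
    fix p assume p: "p \<in> P"
    then have uv: "fst p \<in> supp n l" "snd p \<in> supp n l" "fst p \<noteq> snd p" by (auto simp: P_def)
    then have "card (V \<union> {fst p, snd p}) = card V + card {fst p, snd p}"
      using Cons.prems by (intro card_Un_disjoint) auto
    then have c: "card (V \<union> {fst p, snd p}) = card V + 2" using uv by simp
    have "supp n l' \<inter> (V \<union> {fst p, snd p}) = {}" if "l' \<in> set g" for l'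
      using that uv Cons.prems(1,4) by auto
    then show "sum G (S (V \<union> {fst p, snd p})) \<le> real m ^ r / real m ^ (card V + 2) * Q"
      unfolding S_def G_def Q_def c[symmetric] using Cons.prems uv
      by (intro Cons.IH) (auto simp: supp_def)
  qed
  also have "\<dots> = real m ^ r / real m ^ card V * Q * (1 + real (card P) / (real m)\<^sup>2)"
    using assms(2) by (simp add: field_simps power2_eq_square)
  also have "\<dots> \<le> real m ^ r / real m ^ card V * Q * (1 + (real (card (supp n l)) / real m)\<^sup>2)"
  proof (intro mult_left_mono add_left_mono)
    have "real (card P) \<le> (real (card (supp n l)))\<^sup>2" using cardP by (metis of_nat_le_iff of_nat_power)
    then show "real (card P) / (real m)\<^sup>2 \<le> (real (card (supp n l)) / real m)\<^sup>2"
      using assms(2) by (simp add: power_divide divide_right_mono)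
  qed (use Q0 in auto)
  finally show ?case by (simp add: S_def Q_def ac_simps)
qed

lemma sum_card_supp:
  assumes "disj_gate n g"
  shows "sum_list (map (\<lambda>l. card (supp n l)) g) \<le> n"
proof -
  have "sum_list (map (\<lambda>l. card (supp n l)) g) = card (\<Union>l\<in>set g. supp n l)"
    using assms
  proof (induction g)
    case (Cons l g)
    then have "card (supp n l \<union> (\<Union>l\<in>set g. supp n l)) = card (supp n l) + card (\<Union>l\<in>set g. supp n l)"
      by (intro card_Un_disjoint) auto
    then show ?case using Cons by simp
  qed simp
  also have "\<dots> \<le> card {..<n}" by (rule card_mono) (auto simp: supp_def)
  finally show ?thesis by simp
qed

text \<open>By \<open>1 + q \<le> exp q\<close> it suffices to bound the sum of the squares
  \<open>(s / m)^2\<close> over the support sizes \<open>s\<close>. Narrowness replaces one factor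
  \<open>s\<close> by \<open>n / m\<close>, disjointness bounds the remaining sum of
  \<open>s\<close> by \<open>n\<close>, and \<open>n^2 / m^3 \<le> k\<close> is the condition that
  determines \<open>m\<close>.\<close>

lemma narrow_gate_bound:
  assumes "0 < m" "n\<^sup>2 \<le> m ^ 3 * k" "disj_gate n g" "\<forall>l\<in>set g. \<not> wide n m l"
  shows "prod_list (map (\<lambda>l. 1 + (real (card (supp n l)) / real m)\<^sup>2) g) \<le> 4 ^ k"
proof -
  define q where "q l = (real (card (supp n l)) / real m)\<^sup>2" for l :: "'a aff"
  have "prod_list (map (\<lambda>l. 1 + q l) g) \<le> exp (sum_list (map q g))"
  proof (induction g)
    case (Cons l g)
    have "0 \<le> prod_list (map (\<lambda>l. 1 + q l) g)" by (rule prod_list_nonneg) (auto simp: q_def)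
    then show ?case
      using Cons exp_ge_add_one_self[of "q l"] by (simp add: exp_add mult_mono)
  qed simp
  also have "sum_list (map q g) \<le> sum_list (map (\<lambda>l. real n / real m ^ 3 * real (card (supp n l))) g)"
  proof (rule sum_list_mono)
    fix l assume "l \<in> set g"
    then have "real m * real (card (supp n l)) \<le> real n"
      using assms(4) by (auto simp: wide_def not_le simp flip: of_nat_mult)
    then have "real m * real (card (supp n l)) * real (card (supp n l)) \<le> real n * real (card (supp n l))"
      by (rule mult_right_mono) simp
    then show "q l \<le> real n / real m ^ 3 * real (card (supp n l))"
      using assms(1) by (simp add: q_def field_simps power2_eq_square power3_eq_cube)
  qed
  also have "\<dots> = real n / real m ^ 3 * real (sum_list (map (\<lambda>l. card (supp n l)) g))"
    by (induction g) (simp_all add: algebra_simps)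
  also have "\<dots> \<le> real n / real m ^ 3 * real n"
    using sum_card_supp[OF assms(3)] by (intro mult_left_mono) auto
  also have "\<dots> \<le> real k"
  proof -
    have "real (n\<^sup>2) \<le> real (m ^ 3 * k)" using assms(2) of_nat_le_iff by blast
    then show ?thesis using assms(1) by (simp add: field_simps power2_eq_square)
  qed
  also have "exp (real k) = exp 1 ^ k" by (simp add: exp_of_nat_mult[symmetric])
  also have "\<dots> \<le> 4 ^ k" using exp_le by (intro power_mono) auto
  finally show ?thesis by (simp add: q_def)
qed

text \<open>Averaging over shifts. The number of summands, added up over \<open>2 * m\<close> blocks
  and at most \<open>2 ^ k\<close> gates, has mean at most \<open>2 * m * 2 ^ k * 4 ^ k\<close>,
  hence at most \<open>2 ^ (3 * k + L + 1)\<close>; some shift respects this bound for all blocks at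
  once.\<close>

lemma exists_good_shift:
  fixes \<Phi> :: "'b::comm_ring_1 aff list list"
  assumes "0 < m" "n \<le> r * m" "n\<^sup>2 \<le> m ^ 3 * k" "length \<Phi> \<le> 2 ^ k" "m \<le> 2 ^ L"
    and "\<forall>g\<in>set \<Phi>. disj_gate n g \<and> (\<forall>l\<in>set g. \<not> wide n m l)"
  shows "\<exists>s\<in>shifts r m. \<forall>b<2 * m. sum_list (map (gate_pieces n (block n m s b)) \<Phi>) \<le> 2 ^ (3 * k + L + 1)"
proof (rule ccontr)
  define T where "T s b = sum_list (map (gate_pieces n (block n m s b)) \<Phi>)" for s b
  assume "\<not> ?thesis"
  then have big: "\<exists>b<2 * m. 2 ^ (3 * k + L + 1) < T s b" if "s \<in> shifts r m" for s
    using that unfolding T_def by (auto simp: not_le)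
  have one: "(\<Sum>s\<in>shifts r m. real (T s b)) \<le> real m ^ r * (2 ^ k * 4 ^ k)" for b
  proof -
    have "(\<Sum>s\<in>shifts r m. real (gate_pieces n (block n m s b) g)) \<le> real m ^ r * 4 ^ k" if "g \<in> set \<Phi>" for g
    proof -
      have "(\<Sum>s\<in>{s \<in> shifts r m. {} \<subseteq> block n m s b}. real (gate_pieces n (block n m s b) g)) \<le>
        real m ^ r / real m ^ card ({} :: nat set) *
          prod_list (map (\<lambda>l. 1 + (real (card (supp n l)) / real m)\<^sup>2) g)"
        using assms that by (intro expected_pieces) auto
      also have "\<dots> \<le> real m ^ r / real m ^ card ({} :: nat set) * 4 ^ k"
        using assms that by (intro mult_left_mono narrow_gate_bound) auto
      finally show ?thesis by simp
    qed
    then have "sum_list (map (\<lambda>g. \<Sum>s\<in>shifts r m. real (gate_pieces n (block n m s b) g)) \<Phi>)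
        \<le> sum_list (map (\<lambda>g. real m ^ r * 4 ^ k) \<Phi>)"
      by (intro sum_list_mono) auto
    also have "sum_list (map (\<lambda>g. \<Sum>s\<in>shifts r m. real (gate_pieces n (block n m s b) g)) \<Phi>)
        = (\<Sum>s\<in>shifts r m. real (T s b))"
      unfolding T_def by (induction \<Phi>) (simp_all add: sum.distrib)
    also have "sum_list (map (\<lambda>g. real m ^ r * 4 ^ k) \<Phi>) = real (length \<Phi>) * (real m ^ r * 4 ^ k)"
      by (simp add: sum_list_triv)
    also have "\<dots> \<le> real (2 ^ k) * (real m ^ r * 4 ^ k)"
      using assms(4) by (intro mult_right_mono) (auto simp flip: of_nat_le_iff)
    finally show ?thesis by (simp add: ac_simps)
  qed
  have pos: "shifts r m \<noteq> {}" using assms(1) card_shifts[of r m] by (metis card.empty less_irrefl zero_less_power)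
  have "real m ^ r * 2 ^ (3 * k + L + 1) = (\<Sum>s\<in>shifts r m. 2 ^ (3 * k + L + 1))"
    by (simp add: card_shifts)
  also have "\<dots> < (\<Sum>s\<in>shifts r m. \<Sum>b<2 * m. real (T s b))"
  proof (rule sum_strict_mono[OF _ pos])
    fix s assume "s \<in> shifts r m"
    then obtain b where b: "b < 2 * m" "2 ^ (3 * k + L + 1) < T s b" using big by blast
    have "real (2 ^ (3 * k + L + 1)) < real (T s b)" using b(2) by (simp only: of_nat_less_iff)
    then have "(2::real) ^ (3 * k + L + 1) < real (T s b)" by simp
    also have "\<dots> \<le> (\<Sum>b<2 * m. real (T s b))" using b(1) by (intro member_le_sum) auto
    finally show "(2::real) ^ (3 * k + L + 1) < (\<Sum>b<2 * m. real (T s b))" .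
  qed simp
  also have "\<dots> = (\<Sum>b<2 * m. \<Sum>s\<in>shifts r m. real (T s b))" by (rule sum.swap)
  also have "\<dots> \<le> (\<Sum>b<2 * m. real m ^ r * (2 ^ k * 4 ^ k))" by (intro sum_mono one)
  also have "\<dots> = 2 * real m * (real m ^ r * 2 ^ (3 * k))"
    by (simp add: power_mult power_mult_distrib[symmetric])
  also have "\<dots> \<le> 2 * 2 ^ L * (real m ^ r * 2 ^ (3 * k))"
    using assms(5) by (intro mult_right_mono mult_left_mono) (auto simp flip: of_nat_le_iff)
  finally show False by (simp add: power_add ac_simps)
qed

section \<open>Existence of a good seed\<close>

text \<open>Bernoulli's inequality for \<open>(1 + 1 / (m - 1)) ^ m\<close>. In the application,
  \<open>m\<close> derivative steps halve the number of wide functions, so \<open>m * k\<close>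
  steps remove fewer than \<open>2 ^ k\<close> of them.\<close>

lemma two_times_pred_power_le:
  assumes "0 < m"
  shows "2 * (m - 1) ^ m \<le> (m :: nat) ^ m"
proof (cases "m = 1")
  case False
  define p where "p = m - 1"
  have p: "p \<ge> 1" "m = p + 1" using assms False by (auto simp: p_def)
  have "2 \<le> 1 + real m * (1 / real p)" using p by (simp add: field_simps)
  also have "\<dots> \<le> (1 + 1 / real p) ^ m" 
    by (rule Bernoulli_inequality) (rule order_trans[of _ 0], simp_all)
  also have "1 + 1 / real p = real m / real p" using p by (simp add: field_simps)
  finally have "2 \<le> real m ^ m / real p ^ m" by (simp add: power_divide)
  then have "2 * real p ^ m \<le> real m ^ m" using p by (simp add: field_simps)
  then have "real (2 * p ^ m) \<le> real (m ^ m)" by simp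
  then show ?thesis unfolding of_nat_le_iff by (simp add: p_def)
qed simp

lemma wide_count_small:
  assumes "0 < m" "w < 2 ^ k"
  shows "w * (m - 1) ^ (m * k) < (m :: nat) ^ (m * k)"
proof (cases "(m - 1) ^ (m * k) = 0")
  case False
  have "w * (m - 1) ^ (m * k) < 2 ^ k * (m - 1) ^ (m * k)"
    using assms(2) False by (intro mult_strict_right_mono) linarith+
  also have "\<dots> = (2 * (m - 1) ^ m) ^ k" by (simp add: power_mult_distrib power_mult)
  also have "\<dots> \<le> (m ^ m) ^ k" by (intro power_mono two_times_pred_power_le assms) simp
  finally show ?thesis by (simp add: power_mult)
next
  case True
  then show ?thesis using assms(1) by (simp only: mult_0_right zero_less_power)
qed

text \<open>The first exponent is \<open>4 * (3 * k + L + 1) + L\<close>, from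
  \<open>r ^ 4 * 2 ^ L\<close> with \<open>r \<le> 2 ^ (3 * k + L + 1)\<close>. One more bit, and
  replacing \<open>k\<close>, \<open>L\<close> and 1 by \<open>k * L\<close>, gives 12 + 5 + 5 = 22.
  The degree bound \<open>2 ^ L * Q ^ L\<close> then needs \<open>L + 22 * k * L^2\<close> bits,
  rounded up to 24.\<close>

lemma seed_exponents:
  fixes k L :: nat
  assumes "1 \<le> k" "1 \<le> L"
  shows "(2::nat) ^ (12 * k + 5 * L + 4) + 1 < 2 ^ (22 * k * L)"
    and "(2::nat) ^ L * (2 ^ (12 * k + 5 * L + 4) + 1) ^ L < 2 ^ (24 * k * L\<^sup>2)"
proof -
  have "k \<le> k * L" "L \<le> k * L" "1 \<le> k * L" using assms by auto
  then have "12 * k + 5 * L + 5 \<le> 22 * k * L" by linarith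
  then have "(2::nat) ^ (12 * k + 5 * L + 5) \<le> 2 ^ (22 * k * L)" by (intro power_increasing) auto
  moreover have "(2::nat) ^ (12 * k + 5 * L + 4) + 1 < 2 ^ (12 * k + 5 * L + 5)"
  proof -
    have "(2::nat) ^ (12 * k + 5 * L + 5) = 2 * 2 ^ (12 * k + 5 * L + 4)"
      by (simp add: numeral_eq_Suc)
    then show ?thesis using one_less_power[of "2::nat" "12 * k + 5 * L + 4"] by linarith
  qed
  ultimately show *: "(2::nat) ^ (12 * k + 5 * L + 4) + 1 < 2 ^ (22 * k * L)" by linarith
  have "(2::nat) ^ L * (2 ^ (12 * k + 5 * L + 4) + 1) ^ L < 2 ^ L * (2 ^ (22 * k * L)) ^ L"
    using * assms by (intro mult_strict_left_mono power_strict_mono) auto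
  also have "\<dots> = 2 ^ (L + 22 * k * L * L)" by (simp add: power_add power_mult)
  also have "\<dots> \<le> 2 ^ (24 * k * L\<^sup>2)"
  proof (intro power_increasing)
    have "L \<le> k * L * L" using assms by simp
    then show "L + 22 * k * L * L \<le> 24 * k * L\<^sup>2" by (simp add: power2_eq_square)
  qed simp
  finally show "(2::nat) ^ L * (2 ^ (12 * k + 5 * L + 4) + 1) ^ L < 2 ^ (24 * k * L\<^sup>2)" .
qed

context prime_zero
begin

lemma hit_block:
  fixes e :: "nat \<Rightarrow> 'b"
  assumes "1 \<le> k" "1 \<le> L" "0 < m" "n \<le> m * 2 ^ L"
    and e: "\<And>i j. i < 2 ^ (24 * k * L\<^sup>2) \<Longrightarrow> j < 2 ^ (24 * k * L\<^sup>2) \<Longrightarrow> i \<noteq> j \<Longrightarrow> \<not> Z (e i - e j)"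
    and "\<forall>g\<in>set \<Psi>. disj_gate n g"
    and "sum_list (map (gate_pieces n (block n m s b)) \<Psi>) \<le> 2 ^ (3 * k + L + 1)"
    and "\<not> Z (form_val n \<Psi> x)"
  shows "\<exists>t \<alpha>. t < 2 ^ (24 * k * L\<^sup>2) \<and> (\<forall>j. \<alpha> j < 2 ^ (22 * k * L)) \<and>
    \<not> Z (form_val n \<Psi> (override x (block n m s b) (\<lambda>v. e t ^ (weights \<alpha> L ! (v div m)))))"
proof -
  define B where "B = block n m s b"
  define r where "r = sum_list (map (gate_pieces n B) \<Psi>)"
  define Q :: nat where "Q = 2 ^ (12 * k + 5 * L + 4) + 1"
  define S where "S = e ` {..<2 ^ (24 * k * L\<^sup>2)}"
  \<comment> \<open>A row meets a block in at most one variable, so the row number serves as index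
    within the block; \<open>var\<close> recovers the variable from it.\<close>
  define var where "var i = i * m + (b - s i)" for i
  have var: "var (v div m) = v" if "v \<in> B" for v
    using that by (auto simp: var_def B_def block_def blk_def)
  have inj: "inj_on (\<lambda>v. v div m) B" using var by (rule inj_on_inverseI)
  have rows: "(\<lambda>v. v div m) ` B \<subseteq> {..<2 ^ L}"
    using assms(3,4) by (auto simp: B_def block_def less_mult_imp_div_less mult.commute)
  have "prod_sum B r (\<lambda>z. form_val n \<Psi> (override x B z))"
    unfolding r_def using assms(6) by (rule prod_sum_form) (simp add: B_def)
  then obtain c a b where f: "\<And>z. form_val n \<Psi> (override x B z) = (\<Sum>g<r. c g * (\<Prod>i\<in>B. a g i + b g i * z i))"
    unfolding prod_sum_def by blast
  \<comment> \<open>Rows that miss the block are padded by the factor 1, to reach exactly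
    \<open>2 ^ L\<close> factors.\<close>
  define a' where "a' g i = (if i \<in> (\<lambda>v. v div m) ` B then a g (var i) else 1)" for g i
  define b' where "b' g i = (if i \<in> (\<lambda>v. v div m) ` B then b g (var i) else 0)" for g i
  define F where "F y = form_val n \<Psi> (override x B (\<lambda>v. y (v div m)))" for y
  have prod: "(\<Prod>i\<in>B. a g i + b g i * y (i div m)) = (\<Prod>i<2 ^ L. a' g i + b' g i * y i)" for g y
  proof -
    have "(\<Prod>i<2 ^ L. a' g i + b' g i * y i) = (\<Prod>i\<in>(\<lambda>v. v div m) ` B. a g (var i) + b g (var i) * y i)"
      using rows by (intro prod.mono_neutral_cong_right) (auto simp: a'_def b'_def)
    also have "\<dots> = (\<Prod>i\<in>B. a g i + b g i * y (i div m))"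
      using inj by (simp add: prod.reindex var)
    finally show ?thesis by simp
  qed
  have F: "F y = (\<Sum>g<r. c g * (\<Prod>i<2 ^ L. a' g i + b' g i * y i))" for y
    unfolding F_def f by (simp only: prod)
  \<comment> \<open>The given point \<open>x\<close> is itself a value of the block function, which
    shows that this function is not identically in \<open>Z\<close>.\<close>
  have "override x B (\<lambda>v. x (var (v div m))) = x" using var by (auto simp: override_def)
  then have nz: "\<not> Z (F (\<lambda>i. x (var i)))" using assms(8) by (simp add: F_def)
  have "r ^ 4 * 2 ^ L \<le> (2 ^ (3 * k + L + 1)) ^ 4 * 2 ^ L"
    using assms(7) by (intro mult_le_mono1 power_mono) (auto simp: r_def B_def)
  also have "\<dots> = 2 ^ (12 * k + 5 * L + 4)" 
    unfolding power_mult[symmetric] power_add[symmetric] by (rule arg_cong[of _ _ "(^) 2"]) simp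
  also have "\<dots> < Q" by (simp add: Q_def)
  finally have "r ^ 4 * 2 ^ L < Q" .
  from hit_prod_sum[OF this F nz] obtain \<alpha> where \<alpha>: "\<forall>i. 0 < \<alpha> i \<and> \<alpha> i \<le> Q"
    and hit: "\<forall>S. finite S \<longrightarrow> card S > 2 ^ L * Q ^ L \<longrightarrow>
      (\<forall>s\<in>S. \<forall>s'\<in>S. s \<noteq> s' \<longrightarrow> \<not> Z (s - s')) \<longrightarrow> (\<exists>t\<in>S. \<not> Z (F (\<lambda>i. t ^ (weights \<alpha> L ! i))))"
    by (elim exE conjE) (rule that)
  have "inj_on e {..<2 ^ (24 * k * L\<^sup>2)}"
  proof (rule inj_onI, rule ccontr)
    fix i j assume "i \<in> {..<2 ^ (24 * k * L\<^sup>2)}" "j \<in> {..<2 ^ (24 * k * L\<^sup>2)}" "e i = e j" "i \<noteq> j"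
    then show False using e[of i j] Z_0 by simp
  qed
  then have "card S = 2 ^ (24 * k * L\<^sup>2)" by (simp add: S_def card_image)
  then have "card S > 2 ^ L * Q ^ L"
    using seed_exponents(2)[OF assms(1,2)] by (simp add: Q_def)
  moreover have "\<forall>s\<in>S. \<forall>s'\<in>S. s \<noteq> s' \<longrightarrow> \<not> Z (s - s')" using e by (auto simp: S_def)
  moreover have "finite S" by (simp add: S_def)
  ultimately obtain t where "t \<in> S" "\<not> Z (F (\<lambda>i. t ^ (weights \<alpha> L ! i)))"
    using hit by blast
  then obtain i where "i < 2 ^ (24 * k * L\<^sup>2)" "\<not> Z (F (\<lambda>j. e i ^ (weights \<alpha> L ! j)))"
    by (auto simp: S_def)
  moreover have "\<alpha> j < 2 ^ (22 * k * L)" for j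
    using \<alpha> seed_exponents(1)[OF assms(1,2)] unfolding Q_def by (metis le_less_trans)
  ultimately show ?thesis unfolding F_def B_def by blast
qed

text \<open>A hybrid argument: after \<open>c\<close> steps, blocks below \<open>c\<close> take
  their final values and the others still have those of \<open>x\<close>. The formula is nonzero at
  every intermediate point, so \<open>hit_block\<close> applies to the next block.\<close>

lemma hit_narrow:
  fixes e :: "nat \<Rightarrow> 'b"
  assumes "1 \<le> k" "1 \<le> L" "0 < m" "n \<le> m * 2 ^ L"
    and e: "\<And>i j. i < 2 ^ (24 * k * L\<^sup>2) \<Longrightarrow> j < 2 ^ (24 * k * L\<^sup>2) \<Longrightarrow> i \<noteq> j \<Longrightarrow> \<not> Z (e i - e j)"
    and "\<forall>g\<in>set \<Psi>. disj_gate n g" "\<And>i. s i < m"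
    and "\<And>b. b < 2 * m \<Longrightarrow> sum_list (map (gate_pieces n (block n m s b)) \<Psi>) \<le> 2 ^ (3 * k + L + 1)"
    and "\<not> Z (form_val n \<Psi> x)"
  shows "\<exists>t \<alpha>. (\<forall>b. t b < 2 ^ (24 * k * L\<^sup>2)) \<and> (\<forall>b j. \<alpha> b j < 2 ^ (22 * k * L)) \<and>
    \<not> Z (form_val n \<Psi> (\<lambda>v. e (t (blk m s v)) ^ (weights (\<alpha> (blk m s v)) L ! (v div m))))"
proof -
  define pt where "pt t \<alpha> v = e (t (blk m s v)) ^ (weights (\<alpha> (blk m s v)) L ! (v div m))"
    for t :: "nat \<Rightarrow> nat" and \<alpha> :: "nat \<Rightarrow> nat \<Rightarrow> nat" and v
  have "\<exists>t \<alpha>. (\<forall>b. t b < 2 ^ (24 * k * L\<^sup>2)) \<and> (\<forall>b j. \<alpha> b j < 2 ^ (22 * k * L)) \<and>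
    \<not> Z (form_val n \<Psi> (\<lambda>v. if blk m s v < c then pt t \<alpha> v else x v))" if "c \<le> 2 * m" for c
    using that
  proof (induction c)
    case 0
    then show ?case using assms(9) by (intro exI[of _ "\<lambda>_. 0"] exI[of _ "\<lambda>_ _. 0"]) simp
  next
    case (Suc c)
    then obtain t \<alpha> where IH: "\<And>b. t b < 2 ^ (24 * k * L\<^sup>2)" "\<And>b j. \<alpha> b j < 2 ^ (22 * k * L)"
      "\<not> Z (form_val n \<Psi> (\<lambda>v. if blk m s v < c then pt t \<alpha> v else x v))" by auto
    have c: "sum_list (map (gate_pieces n (block n m s c)) \<Psi>) \<le> 2 ^ (3 * k + L + 1)"
      using assms(8) Suc.prems by simp
    obtain t0 \<alpha>0 where new: "t0 < 2 ^ (24 * k * L\<^sup>2)" "\<And>j. \<alpha>0 j < 2 ^ (22 * k * L)"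
      "\<not> Z (form_val n \<Psi> (override (\<lambda>v. if blk m s v < c then pt t \<alpha> v else x v) (block n m s c)
          (\<lambda>v. e t0 ^ (weights \<alpha>0 L ! (v div m)))))"
      using hit_block[where e = e, OF assms(1-4) e assms(6) c IH(3)] by auto
    define t' \<alpha>' where "t' = t(c := t0)" and "\<alpha>' = \<alpha>(c := \<alpha>0)"
    have "form_val n \<Psi> (override (\<lambda>v. if blk m s v < c then pt t \<alpha> v else x v) (block n m s c)
          (\<lambda>v. e t0 ^ (weights \<alpha>0 L ! (v div m)))) =
        form_val n \<Psi> (\<lambda>v. if blk m s v < Suc c then pt t' \<alpha>' v else x v)"
      by (rule form_val_cong) (auto simp: override_def block_def pt_def t'_def \<alpha>'_def)
    moreover have "\<forall>b. t' b < 2 ^ (24 * k * L\<^sup>2)" "\<forall>b j. \<alpha>' b j < 2 ^ (22 * k * L)"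
      using IH(1,2) new(1,2) by (auto simp: t'_def \<alpha>'_def)
    ultimately show ?case using new(3) by (intro exI[of _ t'] exI[of _ \<alpha>'] conjI) simp_all
  qed
  from this[of "2 * m"] obtain t \<alpha> where *: "\<forall>b. t b < 2 ^ (24 * k * L\<^sup>2)" "\<forall>b j. \<alpha> b j < 2 ^ (22 * k * L)"
    "\<not> Z (form_val n \<Psi> (\<lambda>v. if blk m s v < 2 * m then pt t \<alpha> v else x v))" by auto
  have "blk m s v < 2 * m" for v
    using assms(7)[of "v div m"] mod_less_divisor[OF assms(3), of v] unfolding blk_def by linarith
  then have "\<not> Z (form_val n \<Psi> (pt t \<alpha>))" using *(3) by simp
  then have "\<not> Z (form_val n \<Psi> (\<lambda>v. e (t (blk m s v)) ^ (weights (\<alpha> (blk m s v)) L ! (v div m))))"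
    by (simp add: pt_def[abs_def])
  then show ?thesis using *(1,2) by (intro exI[of _ t] exI[of _ \<alpha>] conjI)
qed

lemma exists_seed:
  fixes e :: "nat \<Rightarrow> 'b"
  assumes "1 \<le> k" "1 \<le> L" "0 < n" "0 < m" "n \<le> m * 2 ^ L" "m \<le> 2 ^ L" "n\<^sup>2 \<le> m ^ 3 * k"
    and e: "\<And>i j. i < 2 ^ (24 * k * L\<^sup>2) \<Longrightarrow> j < 2 ^ (24 * k * L\<^sup>2) \<Longrightarrow> i \<noteq> j \<Longrightarrow> \<not> Z (e i - e j)"
    and "\<forall>g\<in>set \<Phi>. disj_gate n g" "length \<Phi> + length (concat \<Phi>) < 2 ^ k"
    and "\<not> Z (form_val n \<Phi> x)"
  shows "\<exists>s t \<alpha> A Y. (\<forall>i. s i < m) \<and> (\<forall>b. t b < 2 ^ (24 * k * L\<^sup>2)) \<and> (\<forall>b j. \<alpha> b j < 2 ^ (22 * k * L)) \<and>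
    A \<subseteq> {..<n} \<and> card A \<le> m * k \<and>
    \<not> Z (form_val n \<Phi> (\<lambda>v. if v \<in> A then of_bool (v \<in> Y)
        else e (t (blk m s v)) ^ (weights (\<alpha> (blk m s v)) L ! (v div m))))"
proof -
  have "wide_count n m \<Phi> \<le> length (concat \<Phi>)" by (simp add: wide_count_def)
  then have "wide_count n m \<Phi> < 2 ^ k" using assms(10) by linarith
  then have wc: "wide_count n m \<Phi> * (m - 1) ^ (m * k) < m ^ (m * k)"
    by (rule wide_count_small[OF assms(4)])
  have sub: "\<forall>g\<in>set \<Phi>. \<forall>l\<in>set g. supp n l \<subseteq> {..<n}" by (auto simp: supp_def)
  obtain A \<Psi> y where A: "A \<subseteq> {..<n}" "card A \<le> m * k" "length \<Psi> \<le> length \<Phi>"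
     "\<forall>g\<in>set \<Psi>. disj_gate n g \<and> (\<forall>l\<in>set g. \<not> wide n m l)" "\<not> Z (form_val n \<Psi> y)"
     "\<And>x. \<not> Z (form_val n \<Psi> x) \<Longrightarrow>
        (\<exists>Y. \<not> Z (form_val n \<Phi> (\<lambda>i. if i \<in> A then of_bool (i \<in> Y) else x i)))"
    using remove_wide[OF assms(3) assms(9) finite_lessThan sub wc assms(11)] by blast
  have "length \<Psi> \<le> 2 ^ k" using A(3) assms(10) by linarith
  moreover have "n \<le> 2 ^ L * m" using assms(5) by (simp add: mult.commute)
  ultimately obtain s where s: "s \<in> shifts (2 ^ L) m"
    "\<And>b. b < 2 * m \<Longrightarrow> sum_list (map (gate_pieces n (block n m s b)) \<Psi>) \<le> 2 ^ (3 * k + L + 1)"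
    using exists_good_shift[OF assms(4) _ assms(7) _ assms(6) A(4)] by blast
  \<comment> \<open>Elements of \<open>shifts\<close> are \<open>undefined\<close> outside their
    domain; the total function \<open>s'\<close> gives the same blocks because all rows are below
    \<open>2 ^ L\<close>.\<close>
  define s' where "s' i = (if i < 2 ^ L then s i else 0)" for i
  have s': "s' i < m" for i using s(1) assms(4) by (auto simp: s'_def shifts_def)
  have blk_eq: "block n m s' b = block n m s b" for b
    using assms(4,5) by (auto simp: block_def blk_def s'_def less_mult_imp_div_less mult.commute)
  have small: "sum_list (map (gate_pieces n (block n m s' b)) \<Psi>) \<le> 2 ^ (3 * k + L + 1)"
    if "b < 2 * m" for b
    using s(2)[OF that] by (simp only: blk_eq)
  have disj: "\<forall>g\<in>set \<Psi>. disj_gate n g" using A(4) by blast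
  obtain t \<alpha> where *: "\<forall>b. t b < 2 ^ (24 * k * L\<^sup>2)" "\<forall>b j. \<alpha> b j < 2 ^ (22 * k * L)"
    "\<not> Z (form_val n \<Psi> (\<lambda>v. e (t (blk m s' v)) ^ (weights (\<alpha> (blk m s' v)) L ! (v div m))))"
    using hit_narrow[where e = e and s = s', OF assms(1,2,4,5) e disj s' small A(5)] by blast
  obtain Y where "\<not> Z (form_val n \<Phi> (\<lambda>v. if v \<in> A then of_bool (v \<in> Y)
        else e (t (blk m s' v)) ^ (weights (\<alpha> (blk m s' v)) L ! (v div m))))"
    using A(6)[OF *(3)] by blast
  then show ?thesis
    using A(1,2) *(1,2) s'
    by (intro exI[of _ s'] exI[of _ t] exI[of _ \<alpha>] exI[of _ A] exI[of _ Y] conjI allI) simp_all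
qed

end

section \<open>All fields as quotients of one ring\<close>

text \<open>The product of the integers and all fields with carrier in \<open>'a\<close> is a commutative ring on a whole
  type, so that the library for type classes applies. A field \<open>E\<close> is its quotient by the
  prime ideal of the elements with component \<open>\<zero>\<^bsub>E\<^esub>\<close>. The integers only make \<open>0 \<noteq> 1\<close>.\<close>

typedef 'a total = "{f :: int \<times> ('a ring \<Rightarrow> 'a).
   \<forall>E. if field E then snd f E \<in> carrier E else snd f E = undefined}"
  by (rule exI[of _ "(0, \<lambda>E. if field E then \<zero>\<^bsub>E\<^esub> else undefined)"])
    (auto simp: field_def domain_def cring_def ring.ring_simprules(2))

setup_lifting type_definition_total

instantiation total :: (type) comm_ring_1
begin

lift_definition zero_total :: "'a total" is "(0, \<lambda>E. if field E then \<zero>\<^bsub>E\<^esub> else undefined)"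
  by (auto simp: field_def domain_def cring_def ring.ring_simprules(2))

lift_definition one_total :: "'a total" is "(1, \<lambda>E. if field E then \<one>\<^bsub>E\<^esub> else undefined)"
  by (auto simp: field_def domain_def cring_def ring.ring_simprules(6))

lift_definition plus_total :: "'a total \<Rightarrow> 'a total \<Rightarrow> 'a total" is
  "\<lambda>f g. (fst f + fst g, \<lambda>E. if field E then snd f E \<oplus>\<^bsub>E\<^esub> snd g E else undefined)"
  by (auto simp: field_def domain_def cring_def ring.ring_simprules(1))

lift_definition times_total :: "'a total \<Rightarrow> 'a total \<Rightarrow> 'a total" is
  "\<lambda>f g. (fst f * fst g, \<lambda>E. if field E then snd f E \<otimes>\<^bsub>E\<^esub> snd g E else undefined)"
  by (auto simp: field_def domain_def cring_def ring.ring_simprules(5))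

lift_definition uminus_total :: "'a total \<Rightarrow> 'a total" is
  "\<lambda>f. (- fst f, \<lambda>E. if field E then \<ominus>\<^bsub>E\<^esub> snd f E else undefined)"
  by (auto simp: field_def domain_def cring_def ring.ring_simprules(3))

definition minus_total :: "'a total \<Rightarrow> 'a total \<Rightarrow> 'a total" where
  "minus_total f g = f + - g"

instance
proof
  fix a b c :: "'a total"
  have cr: "cring E" if "field E" for E :: "'a ring"
    using that by (simp add: field_def domain_def)
  note rules = cring.cring_simprules[OF cr]
  show "a + b + c = a + (b + c)"
    by transfer (auto simp: fun_eq_iff rules(7))
  show "a + b = b + a"
    by transfer (auto simp: fun_eq_iff rules(10))
  show "0 + a = a"
    by transfer (auto simp: fun_eq_iff prod_eq_iff rules(8))
  show "- a + a = 0"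
    by transfer (auto simp: fun_eq_iff rules(9))
  show "a - b = a + - b" by (simp add: minus_total_def)
  show "a * b * c = a * (b * c)"
    by transfer (auto simp: fun_eq_iff rules(11))
  show "a * b = b * a"
    by transfer (auto simp: fun_eq_iff rules(14))
  show "1 * a = a"
    by transfer (auto simp: fun_eq_iff prod_eq_iff rules(12))
  show "(a + b) * c = a * c + b * c"
    by transfer (auto simp: fun_eq_iff rules(13) algebra_simps)
  show "(0 :: 'a total) \<noteq> 1"
    by transfer auto
qed

end

lift_definition proj :: "'a ring \<Rightarrow> 'a total \<Rightarrow> 'a" is "\<lambda>E f. snd f E" .

text \<open>The other components are zero, so \<open>emb\<close> maps the zero of \<open>E\<close>
  to 0 and preserves supports. It is not unital; only \<open>proj\<close> is used as a
  homomorphism.\<close>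

lift_definition emb :: "'a ring \<Rightarrow> 'a \<Rightarrow> 'a total" is
  "\<lambda>E a. (0, \<lambda>E'. if field E' then (if E' = E \<and> a \<in> carrier E then a else \<zero>\<^bsub>E'\<^esub>) else undefined)"
  by (auto simp: field_def domain_def cring_def ring.ring_simprules(2))

context
  fixes E :: "'a ring"
  assumes E: "field E"
begin

interpretation field E by (rule E)

lemma proj_closed [simp]: "proj E x \<in> carrier E"
  using E by transfer (auto split: if_splits)

lemma proj_simps [simp]:
  "proj E 0 = \<zero>\<^bsub>E\<^esub>" "proj E 1 = \<one>\<^bsub>E\<^esub>" "proj E (x + y) = proj E x \<oplus>\<^bsub>E\<^esub> proj E y"
  "proj E (x * y) = proj E x \<otimes>\<^bsub>E\<^esub> proj E y" "proj E (- x) = \<ominus>\<^bsub>E\<^esub> proj E x"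
  using E by (transfer; simp)+

lemma proj_diff [simp]: "proj E (x - y) = proj E x \<ominus>\<^bsub>E\<^esub> proj E y"
  unfolding minus_total_def proj_simps minus_eq ..

lemma proj_emb: "a \<in> carrier E \<Longrightarrow> proj E (emb E a) = a"
  using E by transfer simp

lemma emb_zero: "emb E \<zero>\<^bsub>E\<^esub> = 0"
  using E by transfer (auto simp: fun_eq_iff)

lemma proj_power [simp]: "proj E (x ^ k) = proj E x [^]\<^bsub>E\<^esub> k"
  by (induction k) (auto simp: m_comm)

lemma proj_sum: "proj E (sum f A) = (\<Oplus>\<^bsub>E\<^esub>i\<in>A. proj E (f i))"
  by (induction A rule: infinite_finite_induct) (auto simp: finsum_infinite)

lemma proj_prod: "proj E (prod f A) = (\<Otimes>\<^bsub>E\<^esub>i\<in>A. proj E (f i))"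
  by (induction A rule: infinite_finite_induct) auto

lemma prime_zero_proj: "prime_zero (\<lambda>x. proj E x = \<zero>\<^bsub>E\<^esub>)"
  by unfold_locales (auto simp: integral)

end

section \<open>Evaluation of polynomials\<close>

text \<open>Polynomials over \<open>total\<close> as coefficient functions. \<open>mmult\<close>,
  \<open>mone\<close> and \<open>mval\<close> mirror the operations over a field record, and
  \<open>proj\<close> maps the former to the latter.\<close>

definition msupp :: "(nat multiset \<Rightarrow> 'b::comm_ring_1) \<Rightarrow> nat multiset set" where
  "msupp P = {m. P m \<noteq> 0}"

definition mmult :: "(nat multiset \<Rightarrow> 'b::comm_ring_1) \<Rightarrow> (nat multiset \<Rightarrow> 'b) \<Rightarrow> nat multiset \<Rightarrow> 'b" where
  "mmult P Q m = (\<Sum>a\<in>{a. a \<subseteq># m}. P a * Q (m - a))"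

definition mone :: "nat multiset \<Rightarrow> 'b::comm_ring_1" where
  "mone m = (if m = {#} then 1 else 0)"

definition mmon :: "(nat \<Rightarrow> 'b::comm_ring_1) \<Rightarrow> nat multiset \<Rightarrow> 'b" where
  "mmon x m = (\<Prod>i\<in>#m. x i)"

definition mval :: "(nat multiset \<Rightarrow> 'b::comm_ring_1) \<Rightarrow> (nat \<Rightarrow> 'b) \<Rightarrow> 'b" where
  "mval P x = (\<Sum>m\<in>msupp P. P m * mmon x m)"

lemma finite_submultisets: "finite {a. a \<subseteq># (m :: nat multiset)}"
proof (induction m)
  case (add x m)
  have "a \<in> {a. a \<subseteq># m} \<union> add_mset x ` {a. a \<subseteq># m}" if "a \<subseteq># add_mset x m" for a
  proof (cases "x \<in># a")
    case True
    then obtain b where "a = add_mset x b" by (meson multi_member_split)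
    then show ?thesis using that by auto
  next
    case False
    then have "count a i \<le> count m i" for i
      using mset_subset_eq_count[OF that, of i] by (cases "i = x") (auto simp: not_in_iff)
    then show ?thesis by (simp add: subseteq_mset_def)
  qed
  then have "{a. a \<subseteq># add_mset x m} \<subseteq> {a. a \<subseteq># m} \<union> add_mset x ` {a. a \<subseteq># m}" by auto
  then show ?case using add finite_subset by blast
qed simp

lemma mval_superset:
  assumes "finite A" "msupp P \<subseteq> A"
  shows "mval P x = (\<Sum>m\<in>A. P m * mmon x m)"
  unfolding mval_def using assms by (intro sum.mono_neutral_left) (auto simp: msupp_def)

lemma msupp_mmultE:
  assumes "m \<in> msupp (mmult P Q)"
  obtains a b where "m = a + b" "a \<in> msupp P" "b \<in> msupp Q"
proof -
  have "(\<Sum>a\<in>{a. a \<subseteq># m}. P a * Q (m - a)) \<noteq> 0"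
    using assms by (simp add: msupp_def mmult_def)
  then obtain a where "a \<subseteq># m" "P a * Q (m - a) \<noteq> 0"
    by (metis (mono_tags, lifting) mem_Collect_eq sum.neutral)
  then show thesis by (intro that[of a "m - a"]) (auto simp: msupp_def)
qed

lemma finite_msupp_mmult:
  assumes "finite (msupp P)" "finite (msupp Q)"
  shows "finite (msupp (mmult P Q))"
proof (rule finite_subset)
  show "msupp (mmult P Q) \<subseteq> (\<lambda>(a, b). a + b) ` (msupp P \<times> msupp Q)"
    by (auto elim!: msupp_mmultE)
qed (use assms in simp)

lemma mval_mmult:
  assumes "finite (msupp P)" "finite (msupp Q)"
  shows "mval (mmult P Q) x = mval P x * mval Q x"
proof -
  define A where "A = msupp P \<times> msupp Q"
  define C where "C = (\<lambda>p. fst p + snd p) ` A"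
  have fin: "finite A" "finite C" using assms by (auto simp: A_def C_def)
  have "mval P x * mval Q x = (\<Sum>p\<in>A. (P (fst p) * Q (snd p)) * mmon x (fst p + snd p))"
    by (auto simp: mval_def A_def sum_product sum.cartesian_product mmon_def case_prod_beta ac_simps
        intro!: sum.cong)
  also have "\<dots> = (\<Sum>m\<in>C. \<Sum>p\<in>{p \<in> A. fst p + snd p = m}. (P (fst p) * Q (snd p)) * mmon x (fst p + snd p))"
    unfolding C_def by (rule sum.image_gen[OF fin(1)])
  also have "\<dots> = (\<Sum>m\<in>C. mmult P Q m * mmon x m)"
  proof (rule sum.cong[OF refl])
    fix m
    have "mmult P Q m = (\<Sum>p\<in>{p \<in> A. fst p + snd p = m}. P (fst p) * Q (snd p))"
    proof -
      have "mmult P Q m = (\<Sum>a\<in>{a. a \<subseteq># m \<and> a \<in> msupp P \<and> m - a \<in> msupp Q}. P a * Q (m - a))"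
        unfolding mmult_def by (rule sum.mono_neutral_right[OF finite_submultisets]) (auto simp: msupp_def)
      also have "\<dots> = (\<Sum>p\<in>{p \<in> A. fst p + snd p = m}. P (fst p) * Q (snd p))"
        by (rule sum.reindex_bij_witness[of _ fst "\<lambda>a. (a, m - a)"]) (auto simp: A_def)
      finally show ?thesis .
    qed
    then show "(\<Sum>p\<in>{p \<in> A. fst p + snd p = m}. (P (fst p) * Q (snd p)) * mmon x (fst p + snd p))
        = mmult P Q m * mmon x m"
      by (simp add: sum_distrib_right)
  qed
  also have "\<dots> = mval (mmult P Q) x"
  proof (rule mval_superset[symmetric, OF fin(2)])
    show "msupp (mmult P Q) \<subseteq> C"
      by (force simp: C_def A_def elim!: msupp_mmultE)
  qed
  finally show ?thesis ..
qed

lemma msupp_mone: "msupp (mone :: nat multiset \<Rightarrow> 'b::comm_ring_1) = {{#}}"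
  by (auto simp: msupp_def mone_def)

lemma mval_mone: "mval mone x = 1"
  by (simp add: mval_def msupp_mone) (simp add: mone_def mmon_def)

lemma mval_add:
  assumes "finite (msupp P)" "finite (msupp Q)"
  shows "mval (\<lambda>m. P m + Q m) x = mval P x + mval Q x"
proof -
  have "msupp (\<lambda>m. P m + Q m) \<subseteq> msupp P \<union> msupp Q" by (auto simp: msupp_def)
  then show ?thesis
    using assms mval_superset[of "msupp P \<union> msupp Q" "\<lambda>m. P m + Q m" x]
      mval_superset[of "msupp P \<union> msupp Q" P x] mval_superset[of "msupp P \<union> msupp Q" Q x]
    by (simp add: distrib_right sum.distrib)
qed

definition gate_poly :: "(nat multiset \<Rightarrow> 'b::comm_ring_1) list \<Rightarrow> nat multiset \<Rightarrow> 'b" where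
  "gate_poly g = foldr mmult g mone"

definition form_poly :: "(nat multiset \<Rightarrow> 'b::comm_ring_1) list list \<Rightarrow> nat multiset \<Rightarrow> 'b" where
  "form_poly \<Phi> m = sum_list (map (\<lambda>g. gate_poly g m) \<Phi>)"

definition mvars :: "(nat multiset \<Rightarrow> 'b::comm_ring_1) \<Rightarrow> nat set" where
  "mvars P = (\<Union>m\<in>msupp P. set_mset m)"

lemma finite_msupp_gate_poly:
  "(\<And>l. l \<in> set g \<Longrightarrow> finite (msupp l)) \<Longrightarrow> finite (msupp (gate_poly g))"
  by (induction g) (auto simp: gate_poly_def msupp_mone finite_msupp_mmult)

lemma finite_msupp_form_poly:
  assumes "\<And>g l. g \<in> set \<Phi> \<Longrightarrow> l \<in> set g \<Longrightarrow> finite (msupp l)"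
  shows "finite (msupp (form_poly \<Phi>))"
proof (rule finite_subset)
  show "msupp (form_poly \<Phi>) \<subseteq> (\<Union>g\<in>set \<Phi>. msupp (gate_poly g))"
  proof
    fix m assume "m \<in> msupp (form_poly \<Phi>)"
    then have "sum_list (map (\<lambda>g. gate_poly g m) \<Phi>) \<noteq> 0" by (simp add: msupp_def form_poly_def)
    then have "\<exists>g\<in>set \<Phi>. gate_poly g m \<noteq> 0" by (induction \<Phi>) auto
    then show "m \<in> (\<Union>g\<in>set \<Phi>. msupp (gate_poly g))" by (auto simp: msupp_def)
  qed
  show "finite (\<Union>g\<in>set \<Phi>. msupp (gate_poly g))"
    using assms finite_msupp_gate_poly by (intro finite_UN_I) blast+
qed

lemma mval_gate_poly:
  "(\<And>l. l \<in> set g \<Longrightarrow> finite (msupp l)) \<Longrightarrow> mval (gate_poly g) x = prod_list (map (\<lambda>l. mval l x) g)"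
proof (induction g)
  case (Cons l g)
  have "finite (msupp (foldr mmult g mone))"
    using finite_msupp_gate_poly[of g] Cons.prems by (simp add: gate_poly_def)
  then show ?case using Cons by (simp add: gate_poly_def mval_mmult)
qed (simp add: gate_poly_def mval_mone)

lemma mval_form_poly:
  assumes "\<And>g l. g \<in> set \<Phi> \<Longrightarrow> l \<in> set g \<Longrightarrow> finite (msupp l)"
  shows "mval (form_poly \<Phi>) x = sum_list (map (\<lambda>g. prod_list (map (\<lambda>l. mval l x) g)) \<Phi>)"
  using assms
proof (induction \<Phi>)
  case Nil
  then show ?case by (simp add: form_poly_def[abs_def] mval_def msupp_def)
next
  case (Cons g \<Phi>)
  have "form_poly (g # \<Phi>) = (\<lambda>m. gate_poly g m + form_poly \<Phi> m)" by (simp add: form_poly_def fun_eq_iff)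
  then have "mval (form_poly (g # \<Phi>)) x = mval (gate_poly g) x + mval (form_poly \<Phi>) x"
    using finite_msupp_gate_poly[of g] finite_msupp_form_poly[of \<Phi>] Cons.prems
    by (auto intro!: mval_add)
  moreover have "mval (gate_poly g) x = prod_list (map (\<lambda>l. mval l x) g)"
    using Cons.prems by (intro mval_gate_poly) auto
  moreover have "mval (form_poly \<Phi>) x = sum_list (map (\<lambda>g. prod_list (map (\<lambda>l. mval l x) g)) \<Phi>)"
    using Cons.prems by (intro Cons.IH) auto
  ultimately show ?case by simp
qed

definition squarefree_in :: "nat set \<Rightarrow> nat multiset \<Rightarrow> bool" where
  "squarefree_in V m \<longleftrightarrow> set_mset m \<subseteq> V \<and> (\<forall>i. count m i \<le> 1)"

text \<open>A monomial of the product takes at most one variable from each factor, and the factors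
  share none.\<close>

lemma gate_poly_squarefree:
  assumes "sorted_wrt (\<lambda>l l'. mvars l \<inter> mvars l' = {}) g"
    and "\<And>l m. l \<in> set g \<Longrightarrow> m \<in> msupp l \<Longrightarrow> size m \<le> 1"
    and "m \<in> msupp (gate_poly g)"
  shows "squarefree_in (\<Union>l\<in>set g. mvars l) m"
  using assms
proof (induction g arbitrary: m)
  case Nil
  then show ?case by (simp add: gate_poly_def msupp_mone squarefree_in_def)
next
  case (Cons l g)
  have "m \<in> msupp (mmult l (gate_poly g))" using Cons.prems(3) by (simp add: gate_poly_def)
  then obtain a b where ab: "m = a + b" "a \<in> msupp l" "b \<in> msupp (gate_poly g)"
    by (rule msupp_mmultE)
  have b: "squarefree_in (\<Union>l\<in>set g. mvars l) b"
    using Cons.prems(1,2) ab(3) by (intro Cons.IH) auto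
  have "size a \<le> 1" using ab(2) by (intro Cons.prems(2)[of l]) auto
  then have "count a i \<le> 1" for i using count_le_size[of a i] by simp
  moreover have "set_mset a \<subseteq> mvars l" using ab(2) by (auto simp: mvars_def)
  moreover have "set_mset a \<inter> set_mset b = {}"
    using Cons.prems(1) b calculation(2) by (fastforce simp: squarefree_in_def)
  ultimately have "count a i + count b i \<le> 1" for i
    using b by (cases "i \<in># a") (auto simp: squarefree_in_def not_in_iff disjoint_iff)
  then show ?case using b \<open>set_mset a \<subseteq> mvars l\<close> by (auto simp: squarefree_in_def ab(1))
qed

lemma squarefree_subset:
  assumes "squarefree_in V m" "squarefree_in V m'" "set_mset m' \<subseteq> set_mset m" "m' \<noteq> m"
  shows "size m' < size m"
proof -
  have c: "count k i = of_bool (i \<in># k)" if "squarefree_in V k" for k i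
    using that by (cases "i \<in># k") (auto simp: squarefree_in_def not_in_iff le_antisym Suc_le_eq)
  have "m' \<subseteq># m" using assms(3) by (auto simp: subseteq_mset_def c[OF assms(1)] c[OF assms(2)])
  then show ?thesis using assms(4) by (simp add: mset_subset_size subset_mset.less_le)
qed

text \<open>Take a monomial of least degree with coefficient outside \<open>Z\<close> and evaluate
  at the indicator of its variables. Besides it only monomials on proper subsets of these survive;
  being squarefree they have smaller degree, hence coefficients in \<open>Z\<close>. This is where a
  nonzero polynomial becomes a nonzero function, over fields of any size.\<close>

lemma (in prime_zero) squarefree_nonzero_value:
  assumes "finite (msupp P)" "\<And>m. m \<in> msupp P \<Longrightarrow> squarefree_in V m" "\<not> Z (P m0)"
  shows "\<exists>Y. \<not> Z (mval P (\<lambda>i. of_bool (i \<in> Y)))"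
proof -
  define N where "N = {m. \<not> Z (P m)}"
  have "N \<subseteq> msupp P" using Z_0 by (auto simp: N_def msupp_def)
  then have N: "finite N" "N \<noteq> {}" using assms(1,3) finite_subset by (auto simp: N_def)
  define m where "m = arg_min_on size N"
  have m: "m \<in> N" "\<And>k. k \<in> N \<Longrightarrow> size m \<le> size k"
    using arg_min_if_finite[OF N, of size] by (auto simp: m_def not_less)
  define x :: "nat \<Rightarrow> 'b" where "x i = of_bool (i \<in># m)" for i
  have x: "x = (\<lambda>i. of_bool (i \<in> set_mset m))" by (simp add: x_def fun_eq_iff)
  have mon: "mmon x k = of_bool (set_mset k \<subseteq> set_mset m)" for k
    unfolding mmon_def by (induction k) (auto simp: x_def)
  have "Z (P k * mmon x k)" if k: "k \<in> msupp P - {m}" for k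
  proof (cases "set_mset k \<subseteq> set_mset m")
    case True
    then have "size k < size m"
      using squarefree_subset[of V m k] assms(2) k m(1) \<open>N \<subseteq> msupp P\<close> by auto
    then have "k \<notin> N" using m(2)[of k] by auto
    then show ?thesis by (auto simp: N_def Z_mult_iff)
  next
    case False
    then show ?thesis by (simp add: mon Z_0)
  qed
  then have "Z (\<Sum>k\<in>msupp P - {m}. P k * mmon x k)" by (rule Z_sum)
  moreover have "mval P x = P m * mmon x m + (\<Sum>k\<in>msupp P - {m}. P k * mmon x k)"
    unfolding mval_def using assms(1) m(1) \<open>N \<subseteq> msupp P\<close> by (intro sum.remove) auto
  moreover have "\<not> Z (P m * mmon x m)" using m(1) by (simp add: mon N_def)
  ultimately have "\<not> Z (mval P x)" using Z_add_cancel by simp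
  then show ?thesis unfolding x by blast
qed

definition lift_aff :: "'a ring \<Rightarrow> (nat multiset \<Rightarrow> 'a) \<Rightarrow> 'a total aff" where
  "lift_aff E l = (emb E (l {#}), \<lambda>i. emb E (l {#i#}))"

context
  fixes E :: "'a ring" and K :: "'a set"
  assumes E: "field E" and K: "subfield K E"
begin

interpretation field E by (rule E)

lemma affine_linear_closed:
  assumes "l \<in> affine_linear K n"
  shows "l m \<in> carrier E"
proof -
  have "K \<subseteq> carrier E" using subfieldE(3)[OF K] .
  moreover have "l \<in> indexed_pset {..<n} K" using assms by (simp add: affine_linear_def)
  ultimately show ?thesis using indexed_pset_in_carrier carrier_coeffE by blast
qed

lemma indexed_pset_vars: "P \<in> indexed_pset I K \<Longrightarrow> P m \<noteq> \<zero>\<^bsub>E\<^esub> \<Longrightarrow> set_mset m \<subseteq> I"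
proof (induction arbitrary: m rule: indexed_pset.induct)
  case (indexed_const k)
  then show ?case by (auto simp: indexed_const_def split: if_splits)
next
  case (indexed_padd P Q)
  have "P m \<noteq> \<zero>\<^bsub>E\<^esub> \<or> Q m \<noteq> \<zero>\<^bsub>E\<^esub>" using indexed_padd.prems by (auto simp: indexed_padd_def)
  then show ?case using indexed_padd.IH by blast
next
  case (indexed_pmult P i)
  have "i \<in># m" "P (m - {#i#}) \<noteq> \<zero>\<^bsub>E\<^esub>"
    using indexed_pmult.prems by (auto simp: indexed_pmult_def split: if_splits)
  then have "set_mset (m - {#i#}) \<subseteq> I" using indexed_pmult.IH by blast
  moreover have "set_mset m \<subseteq> insert i (set_mset (m - {#i#}))"
    using \<open>i \<in># m\<close> by (metis insert_DiffM order_refl set_mset_add_mset_insert)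
  ultimately show ?case using indexed_pmult.hyps by blast
qed

lemma msupp_affine:
  assumes "l \<in> affine_linear K n"
  shows "msupp (\<lambda>m. emb E (l m)) \<subseteq> insert {#} ((\<lambda>i. {#i#}) ` {..<n})"
proof
  fix m assume "m \<in> msupp (\<lambda>m. emb E (l m))"
  then have "l m \<noteq> \<zero>\<^bsub>E\<^esub>" using emb_zero[OF E] by (auto simp: msupp_def)
  then have "size m \<le> 1" "set_mset m \<subseteq> {..<n}"
    using assms indexed_pset_vars[of l "{..<n}" m] by (auto simp: affine_linear_def)
  moreover from this have "m = {#} \<or> (\<exists>i. m = {#i#})"
    using size_1_singleton_mset[of m] by (cases "size m = 0") auto
  ultimately show "m \<in> insert {#} ((\<lambda>i. {#i#}) ` {..<n})" by auto
qed

lemma finite_msupp_affine: "l \<in> affine_linear K n \<Longrightarrow> finite (msupp (\<lambda>m. emb E (l m)))"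
  by (rule finite_subset[OF msupp_affine]) auto

lemma mval_affine:
  assumes "l \<in> affine_linear K n"
  shows "mval (\<lambda>m. emb E (l m)) x = aff_val n (lift_aff E l) x"
proof -
  have "mval (\<lambda>m. emb E (l m)) x = (\<Sum>m\<in>insert {#} ((\<lambda>i. {#i#}) ` {..<n}). emb E (l m) * mmon x m)"
    by (rule mval_superset[OF _ msupp_affine[OF assms]]) auto
  also have "\<dots> = emb E (l {#}) + (\<Sum>m\<in>(\<lambda>i. {#i#}) ` {..<n}. emb E (l m) * mmon x m)"
    by (subst sum.insert) (auto simp: mmon_def)
  also have "(\<Sum>m\<in>(\<lambda>i. {#i#}) ` {..<n}. emb E (l m) * mmon x m) = (\<Sum>i<n. emb E (l {#i#}) * x i)"
    by (subst sum.reindex) (auto simp: inj_on_def mmon_def)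
  finally show ?thesis by (simp add: aff_val_def lift_aff_def)
qed

lemma mvars_affine: "mvars (\<lambda>m. emb E (l m)) \<subseteq> {i. \<not> index_free l i}"
  using emb_zero[OF E] by (auto simp: mvars_def msupp_def index_free_def)

lemma supp_lift_aff: "supp n (lift_aff E l) \<subseteq> {i. \<not> index_free l i}"
proof
  fix i assume "i \<in> supp n (lift_aff E l)"
  then have "l {#i#} \<noteq> \<zero>\<^bsub>E\<^esub>" using emb_zero[OF E] by (auto simp: supp_def lift_aff_def)
  then show "i \<in> {i. \<not> index_free l i}" by (auto simp: index_free_def intro!: exI[of _ "{#i#}"])
qed

lemma proj_mmult:
  assumes "\<And>m. P m = proj E (P' m)" "\<And>m. Q m = proj E (Q' m)"
  shows "indexed_mult P Q m = proj E (mmult P' Q' m)"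
  using E assms by (simp add: indexed_mult_def mmult_def proj_sum)

lemma proj_gate_poly:
  assumes "set g \<subseteq> affine_linear K n"
  shows "foldr indexed_mult g (indexed_const \<one>\<^bsub>E\<^esub>) m = proj E (gate_poly (map (\<lambda>l m. emb E (l m)) g) m)"
  using assms
proof (induction g arbitrary: m)
  case Nil
  then show ?case using E by (simp add: gate_poly_def mone_def indexed_const_def)
next
  case (Cons l g)
  have "indexed_mult l (foldr indexed_mult g (indexed_const \<one>\<^bsub>E\<^esub>)) m =
      proj E (mmult (\<lambda>m. emb E (l m)) (gate_poly (map (\<lambda>l m. emb E (l m)) g)) m)"
    using Cons affine_linear_closed[of l n] proj_emb[OF E] by (intro proj_mmult) auto
  then show ?case by (simp add: gate_poly_def)
qed

lemma proj_form_poly: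
  assumes "depth3_formula K n \<Phi>"
  shows "formula_poly \<Phi> m = proj E (form_poly (map (map (\<lambda>l m. emb E (l m))) \<Phi>) m)"
proof -
  have "foldr (\<lambda>g P. indexed_padd (foldr indexed_mult g (indexed_const \<one>\<^bsub>E\<^esub>)) P) \<Phi> (indexed_const \<zero>\<^bsub>E\<^esub>) m
     = proj E (form_poly (map (map (\<lambda>l m. emb E (l m))) \<Phi>) m)"
    using assms
  proof (induction \<Phi>)
    case Nil
    then show ?case using E by (simp add: form_poly_def indexed_const_def)
  next
    case (Cons g \<Phi>)
    then have "set g \<subseteq> affine_linear K n" by (simp add: depth3_formula_def)
    moreover have "depth3_formula K n \<Phi>" using Cons.prems by (simp add: depth3_formula_def)
    ultimately show ?case
      using Cons.IH E proj_gate_poly by (simp add: form_poly_def indexed_padd_def)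
  qed
  then show ?thesis by (simp add: formula_poly_def)
qed

lemma proj_mmon:
  assumes "set_mset m \<subseteq> {..<n}"
  shows "proj E (mmon x m) =
    (\<Otimes>\<^bsub>E\<^esub>i\<in>set_mset m. (map (\<lambda>i. proj E (x i)) [0..<n] ! i) [^]\<^bsub>E\<^esub> count m i)"
proof -
  have "mmon x m = (\<Prod>i\<in>set_mset m. x i ^ count m i)"
    by (simp add: mmon_def image_prod_mset_multiplicity)
  then show ?thesis
    using E assms by (auto simp: proj_prod subset_iff intro!: finprod_cong')
qed

lemma proj_mval:
  assumes "\<And>m. P m = proj E (P' m)" "finite (msupp P')" "\<And>m. m \<in> msupp P' \<Longrightarrow> set_mset m \<subseteq> {..<n}"
  shows "indexed_value P (map (\<lambda>i. proj E (x i)) [0..<n]) = proj E (mval P' x)"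
proof -
  have sub: "{m. P m \<noteq> \<zero>\<^bsub>E\<^esub>} \<subseteq> msupp P'" using assms(1) E by (auto simp: msupp_def)
  have "proj E (mval P' x) = (\<Oplus>\<^bsub>E\<^esub>m\<in>msupp P'. proj E (P' m) \<otimes>\<^bsub>E\<^esub> proj E (mmon x m))"
    using E by (simp add: mval_def proj_sum)
  also have "\<dots> = (\<Oplus>\<^bsub>E\<^esub>m\<in>{m. P m \<noteq> \<zero>\<^bsub>E\<^esub>}. P m \<otimes>\<^bsub>E\<^esub> proj E (mmon x m))"
    using sub assms(1,2) E
    by (intro add.finprod_mono_neutral_cong_right) (auto simp: proj_closed[OF E])
  also have "\<dots> = indexed_value P (map (\<lambda>i. proj E (x i)) [0..<n])"
    unfolding indexed_value_def
  proof (rule add.finprod_cong')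
    have eq: "(\<Otimes>\<^bsub>E\<^esub>i\<in>set_mset m. (map (\<lambda>i. proj E (x i)) [0..<n] ! i) [^]\<^bsub>E\<^esub> count m i) = proj E (mmon x m)"
      if "m \<in> {m. P m \<noteq> \<zero>\<^bsub>E\<^esub>}" for m
      using sub that by (intro proj_mmon[symmetric] assms(3)) blast
    show "P m \<otimes>\<^bsub>E\<^esub> proj E (mmon x m) = P m \<otimes>\<^bsub>E\<^esub>
      (\<Otimes>\<^bsub>E\<^esub>i\<in>set_mset m. (map (\<lambda>i. proj E (x i)) [0..<n] ! i) [^]\<^bsub>E\<^esub> count m i)"
      if "m \<in> {m. P m \<noteq> \<zero>\<^bsub>E\<^esub>}" for m
      unfolding eq[OF that] ..
    show "(\<lambda>m. P m \<otimes>\<^bsub>E\<^esub> (\<Otimes>\<^bsub>E\<^esub>i\<in>set_mset m. (map (\<lambda>i. proj E (x i)) [0..<n] ! i) [^]\<^bsub>E\<^esub> count m i))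
       \<in> {m. P m \<noteq> \<zero>\<^bsub>E\<^esub>} \<rightarrow> carrier E"
      using assms(1) eq proj_closed[OF E] by (intro funcsetI) simp
  qed simp
  finally show ?thesis ..
qed

text \<open>Leaves the polynomial representation behind: from here on only values of
  \<open>form_val\<close> under \<open>proj E\<close> matter. The last property supplies the nonzero
  point from which the substitutions start, already on the Boolean cube.\<close>

lemma multilinear_depth3_class_lift:
  assumes "P \<in> multilinear_depth3_class K n s"
  obtains \<Phi> :: "'a total aff list list" where
    "\<forall>g\<in>set \<Phi>. disj_gate n g"
    "real (1 + length \<Phi> + length (concat \<Phi>)) \<le> s"
    "\<And>x. indexed_value P (map (\<lambda>i. proj E (x i)) [0..<n]) = proj E (form_val n \<Phi> x)"
    "P \<noteq> indexed_const \<zero>\<^bsub>E\<^esub> \<Longrightarrow> \<exists>Y. proj E (form_val n \<Phi> (\<lambda>i. of_bool (i \<in> Y))) \<noteq> \<zero>\<^bsub>E\<^esub>"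
proof -
  obtain F where F: "P = formula_poly F" "depth3_formula K n F" "multilinear F" "real (formula_size F) \<le> s"
    using assms by (auto simp: multilinear_depth3_class_def)
  define \<Phi> where "\<Phi> = map (map (lift_aff E)) F"
  define M where "M = map (map (\<lambda>l m. emb E (l m))) F"
  have aff: "l \<in> affine_linear K n" if "g \<in> set F" "l \<in> set g" for g l
    using F(2) that by (auto simp: depth3_formula_def)
  have fin: "finite (msupp l)" if "g \<in> set M" "l \<in> set g" for g l
    using that aff finite_msupp_affine[of _ n] by (auto simp: M_def)
  have val: "mval (form_poly M) x = form_val n \<Phi> x" for x
  proof -
    have "prod_list (map (\<lambda>l. mval l x) (map (\<lambda>l m. emb E (l m)) g)) = gate_val n (map (lift_aff E) g) x"
      if "g \<in> set F" for g
      using aff[OF that] mval_affine by (auto simp: gate_val_def intro!: arg_cong[of _ _ prod_list])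
    then have "map (\<lambda>g. prod_list (map (\<lambda>l. mval l x) g)) M = map (\<lambda>g. gate_val n g x) \<Phi>"
      by (simp add: M_def \<Phi>_def)
    then show ?thesis using fin by (simp add: mval_form_poly form_val_def)
  qed
  have pairs: "sorted_wrt (\<lambda>l l'. {i. \<not> index_free l i} \<inter> {i. \<not> index_free l' i} = {}) g"
    if "g \<in> set F" for g
    using F(3) that by (auto simp: multilinear_def sorted_wrt_iff_nth_less)
  have disj: "\<forall>g\<in>set \<Phi>. disj_gate n g"
  proof
    fix g assume "g \<in> set \<Phi>"
    then obtain g0 where g0: "g0 \<in> set F" "g = map (lift_aff E) g0" by (auto simp: \<Phi>_def)
    show "disj_gate n g"
      unfolding disj_gate_def g0(2) sorted_wrt_map
    proof (rule sorted_wrt_mono_rel[OF _ pairs[OF g0(1)]])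
      show "supp n (lift_aff E l) \<inter> supp n (lift_aff E l') = {}"
        if "{i. \<not> index_free l i} \<inter> {i. \<not> index_free l' i} = {}" for l l'
        using that supp_lift_aff[of n l] supp_lift_aff[of n l'] by blast
    qed
  qed
  have sqf: "squarefree_in {..<n} m" if "m \<in> msupp (form_poly M)" for m
  proof -
    have "sum_list (map (\<lambda>g. gate_poly g m) M) \<noteq> 0" using that by (simp add: msupp_def form_poly_def)
    then have "\<exists>g\<in>set M. gate_poly g m \<noteq> 0" by (induction M) auto
    then obtain g where g: "g \<in> set F" "m \<in> msupp (gate_poly (map (\<lambda>l m. emb E (l m)) g))"
      by (auto simp: M_def msupp_def)
    have "squarefree_in (\<Union>l\<in>set (map (\<lambda>l m. emb E (l m)) g). mvars l) m"
    proof (rule gate_poly_squarefree[OF _ _ g(2)])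
      show "sorted_wrt (\<lambda>l l'. mvars l \<inter> mvars l' = {}) (map (\<lambda>l m. emb E (l m)) g)"
        unfolding sorted_wrt_map
      proof (rule sorted_wrt_mono_rel[OF _ pairs[OF g(1)]])
        show "mvars (\<lambda>m. emb E (l m)) \<inter> mvars (\<lambda>m. emb E (l' m)) = {}"
          if "{i. \<not> index_free l i} \<inter> {i. \<not> index_free l' i} = {}" for l l'
          using that mvars_affine[of l] mvars_affine[of l'] by blast
      qed
      show "size m \<le> 1" if l: "l \<in> set (map (\<lambda>l m. emb E (l m)) g)" "m \<in> msupp l" for l m
        using l aff[OF g(1)] msupp_affine by fastforce
    qed
    moreover have "(\<Union>l\<in>set (map (\<lambda>l m. emb E (l m)) g). mvars l) \<subseteq> {..<n}"
      using aff[OF g(1)] msupp_affine by (fastforce simp: mvars_def)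
    ultimately show ?thesis unfolding squarefree_in_def by blast
  qed
  have finM: "finite (msupp (form_poly M))" using fin by (rule finite_msupp_form_poly)
  have P: "P m = proj E (form_poly M m)" for m
    unfolding M_def F(1) by (rule proj_form_poly[OF F(2)])
  show thesis
  proof
    show "\<forall>g\<in>set \<Phi>. disj_gate n g" by (rule disj)
    have "sum_list (map length F) = length (concat \<Phi>)"
      by (simp add: \<Phi>_def length_concat comp_def)
    then show "real (1 + length \<Phi> + length (concat \<Phi>)) \<le> s"
      using F(4) by (simp add: formula_size_def \<Phi>_def)
    show "indexed_value P (map (\<lambda>i. proj E (x i)) [0..<n]) = proj E (form_val n \<Phi> x)" for x
      unfolding val[symmetric] using P finM sqf by (intro proj_mval) (auto simp: squarefree_in_def)
    assume "P \<noteq> indexed_const \<zero>\<^bsub>E\<^esub>"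
    then obtain m where "P m \<noteq> \<zero>\<^bsub>E\<^esub>" by (auto simp: indexed_const_def fun_eq_iff split: if_splits)
    then show "\<exists>Y. proj E (form_val n \<Phi> (\<lambda>i. of_bool (i \<in> Y))) \<noteq> \<zero>\<^bsub>E\<^esub>"
      using prime_zero.squarefree_nonzero_value[OF prime_zero_proj[OF E] finM sqf, of m] P
      by (simp add: val)
  qed
qed

end

section \<open>Running programs\<close>

text \<open>Total correctness with a bound on the time. The exact step count stays existential, so
  bounds compose along branches and loops.\<close>

definition runs :: "('a, 'b) ring_scheme \<Rightarrow> (nat \<Rightarrow> 'a) \<Rightarrow> com \<Rightarrow> 'a machine \<Rightarrow> nat \<Rightarrow> ('a machine \<Rightarrow> bool) \<Rightarrow> bool" where
  "runs R e p s T Q \<longleftrightarrow> (\<exists>t s'. exec R e p s t s' \<and> t \<le> T \<and> Q s')"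

lemma runs_mono:
  assumes "runs R e p s T Q" "\<And>s'. Q s' \<Longrightarrow> Q' s'" "T \<le> T'"
  shows "runs R e p s T' Q'"
  using assms unfolding runs_def by (meson order_trans)

lemma runs_time: "runs R e p s T Q \<Longrightarrow> T \<le> T' \<Longrightarrow> runs R e p s T' Q"
  by (rule runs_mono)

lemma runs_Seq:
  assumes "runs R e p s T1 Q1" "\<And>s'. Q1 s' \<Longrightarrow> runs R e q s' T2 Q"
  shows "runs R e (Seq p q) s (T1 + T2) Q"
proof -
  obtain t s' where 1: "exec R e p s t s'" "t \<le> T1" "Q1 s'" using assms(1) by (auto simp: runs_def)
  obtain t' s'' where 2: "exec R e q s' t' s''" "t' \<le> T2" "Q s''"
    using assms(2)[OF 1(3)] by (auto simp: runs_def)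
  have "exec R e (Seq p q) s (t + t') s''" using 1(1) 2(1) by (rule exec.intros)
  then show ?thesis using 1(2) 2(2,3) unfolding runs_def by (intro exI[of _ "t + t'"] exI[of _ s'']) auto
qed

lemma runs_atomic:
  "Q (s\<lparr>nmem := (nmem s)(x := k)\<rparr>) \<Longrightarrow> runs R e (NConst x k) s 1 Q"
  "Q (s\<lparr>nmem := (nmem s)(x := nmem s y + nmem s z)\<rparr>) \<Longrightarrow> runs R e (NAdd x y z) s 1 Q"
  "Q (s\<lparr>nmem := (nmem s)(x := nmem s (nmem s y))\<rparr>) \<Longrightarrow> runs R e (NLoad x y) s 1 Q"
  "Q (s\<lparr>nmem := (nmem s)(nmem s x := nmem s y)\<rparr>) \<Longrightarrow> runs R e (NStore x y) s 1 Q"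
  "Q (s\<lparr>fmem := (fmem s)(x := \<zero>\<^bsub>R\<^esub>)\<rparr>) \<Longrightarrow> runs R e (FZero x) s 1 Q"
  "Q (s\<lparr>fmem := (fmem s)(x := \<one>\<^bsub>R\<^esub>)\<rparr>) \<Longrightarrow> runs R e (FOne x) s 1 Q"
  "Q (s\<lparr>fmem := (fmem s)(x := e (nmem s y))\<rparr>) \<Longrightarrow> runs R e (FElem x y) s 1 Q"
  "Q (s\<lparr>fmem := (fmem s)(x := fmem s y \<otimes>\<^bsub>R\<^esub> fmem s z)\<rparr>) \<Longrightarrow> runs R e (FMult x y z) s 1 Q"
  "Q (s\<lparr>fmem := (fmem s)(x := fmem s (nmem s y))\<rparr>) \<Longrightarrow> runs R e (FLoad x y) s 1 Q"
  "Q (s\<lparr>fmem := (fmem s)(nmem s x := fmem s y)\<rparr>) \<Longrightarrow> runs R e (FStore x y) s 1 Q"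
  "Q (s\<lparr>outp := outp s @ [fmem s x]\<rparr>) \<Longrightarrow> runs R e (Emit x) s 1 Q"
  unfolding runs_def by (blast intro: exec.intros order_refl)+

text \<open>As introduction rules these execute straight-line code symbolically on the
  state.\<close>

lemma runs_seq_atomic:
  "runs R e q (s\<lparr>nmem := (nmem s)(x := k)\<rparr>) T Q \<Longrightarrow> runs R e (Seq (NConst x k) q) s (1 + T) Q"
  "runs R e q (s\<lparr>nmem := (nmem s)(x := nmem s y + nmem s z)\<rparr>) T Q \<Longrightarrow> runs R e (Seq (NAdd x y z) q) s (1 + T) Q"
  "runs R e q (s\<lparr>nmem := (nmem s)(x := nmem s (nmem s y))\<rparr>) T Q \<Longrightarrow> runs R e (Seq (NLoad x y) q) s (1 + T) Q"
  "runs R e q (s\<lparr>nmem := (nmem s)(nmem s x := nmem s y)\<rparr>) T Q \<Longrightarrow> runs R e (Seq (NStore x y) q) s (1 + T) Q"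
  "runs R e q (s\<lparr>fmem := (fmem s)(x := \<zero>\<^bsub>R\<^esub>)\<rparr>) T Q \<Longrightarrow> runs R e (Seq (FZero x) q) s (1 + T) Q"
  "runs R e q (s\<lparr>fmem := (fmem s)(x := \<one>\<^bsub>R\<^esub>)\<rparr>) T Q \<Longrightarrow> runs R e (Seq (FOne x) q) s (1 + T) Q"
  "runs R e q (s\<lparr>fmem := (fmem s)(x := e (nmem s y))\<rparr>) T Q \<Longrightarrow> runs R e (Seq (FElem x y) q) s (1 + T) Q"
  "runs R e q (s\<lparr>fmem := (fmem s)(x := fmem s y \<otimes>\<^bsub>R\<^esub> fmem s z)\<rparr>) T Q \<Longrightarrow> runs R e (Seq (FMult x y z) q) s (1 + T) Q"
  "runs R e q (s\<lparr>fmem := (fmem s)(x := fmem s (nmem s y))\<rparr>) T Q \<Longrightarrow> runs R e (Seq (FLoad x y) q) s (1 + T) Q"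
  "runs R e q (s\<lparr>fmem := (fmem s)(nmem s x := fmem s y)\<rparr>) T Q \<Longrightarrow> runs R e (Seq (FStore x y) q) s (1 + T) Q"
  "runs R e q (s\<lparr>outp := outp s @ [fmem s x]\<rparr>) T Q \<Longrightarrow> runs R e (Seq (Emit x) q) s (1 + T) Q"
  by (rule runs_Seq[rotated], assumption, rule runs_atomic, simp)+

lemma runs_IfLess:
  assumes "nmem s x < nmem s y \<Longrightarrow> runs R e p s T Q" "\<not> nmem s x < nmem s y \<Longrightarrow> runs R e q s T Q"
  shows "runs R e (IfLess x y p q) s (T + 1) Q"
proof (cases "nmem s x < nmem s y")
  case True
  then show ?thesis using assms(1) unfolding runs_def by (meson exec.intros(17) add_le_mono1)
next
  case False
  then show ?thesis using assms(2) unfolding runs_def by (meson exec.intros(18) add_le_mono1)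
qed

text \<open>The invariant is indexed by the number of completed rounds. The total number
  \<open>k\<close> of rounds is known in advance for every loop here, which gives the running
  time.\<close>

lemma runs_WhileLess:
  assumes "I 0 s"
    and cond: "\<And>i s. i < k \<Longrightarrow> I i s \<Longrightarrow> nmem s x < nmem s y"
    and step: "\<And>i s. i < k \<Longrightarrow> I i s \<Longrightarrow> runs R e p s T (I (Suc i))"
    and stop: "\<And>s. I k s \<Longrightarrow> \<not> nmem s x < nmem s y"
  shows "runs R e (WhileLess x y p) s (k * (T + 1) + 1) (I k)"
proof -
  have "runs R e (WhileLess x y p) s ((k - i) * (T + 1) + 1) (I k)" if "i \<le> k" "I i s" for i s
    using that
  proof (induction "k - i" arbitrary: i s)
    case 0
    then have "i = k" by simp
    then have "\<not> nmem s x < nmem s y" using 0 stop by simp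
    then have "exec R e (WhileLess x y p) s 1 s" by (rule exec.intros)
    then show ?case using 0 \<open>i = k\<close> unfolding runs_def by (intro exI[of _ 1] exI[of _ s]) simp
  next
    case (Suc d)
    then have "i < k" by simp
    from cond[OF this Suc.prems(2)] step[OF this Suc.prems(2)] obtain t s' where
      1: "nmem s x < nmem s y" "exec R e p s t s'" "t \<le> T" "I (Suc i) s'"
      by (auto simp: runs_def)
    have "runs R e (WhileLess x y p) s' ((k - Suc i) * (T + 1) + 1) (I k)"
      using Suc.hyps 1(4) \<open>i < k\<close> by (intro Suc.hyps(1)) auto
    then obtain t' s'' where 2: "exec R e (WhileLess x y p) s' t' s''"
      "t' \<le> (k - Suc i) * (T + 1) + 1" "I k s''" by (auto simp: runs_def)
    have "exec R e (WhileLess x y p) s (t + t' + 1) s''"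
      using 1(1,2) 2(1) by (rule exec.intros)
    moreover have "k - i = Suc (k - Suc i)" using \<open>i < k\<close> by simp
    then have "t + t' + 1 \<le> (k - i) * (T + 1) + 1" using 1(3) 2(2) by simp
    ultimately show ?case using 2(3) unfolding runs_def by blast
  qed
  from this[of 0 s] show ?thesis using assms(1) by simp
qed

fun seqs :: "com list \<Rightarrow> com" where
  "seqs [] = NConst 99 0"
| "seqs [p] = p"
| "seqs (p # ps) = Seq p (seqs ps)"

text \<open>Binary value of the \<open>w\<close> cells from \<open>p\<close> on, leading digit
  first, as it arises by doubling while reading.\<close>

primrec num :: "(nat \<Rightarrow> nat) \<Rightarrow> nat \<Rightarrow> nat \<Rightarrow> nat" where
  "num \<tau> p 0 = 0"
| "num \<tau> p (Suc w) = 2 * num \<tau> p w + \<tau> (p + w)"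

text \<open>Registers below 20 hold the parameters and cells from 100 on hold the seed, both of which
  \<open>c\<close> describes. Registers from 20 to 99 are scratch space.\<close>

definition env :: "(nat \<Rightarrow> nat) \<Rightarrow> 'a machine \<Rightarrow> bool" where
  "env c s \<longleftrightarrow> (\<forall>r. r < 20 \<or> 100 \<le> r \<longrightarrow> nmem s r = c r) \<and> c 10 = 1 \<and> c 11 = 0"

lemma env_low: "env c s \<Longrightarrow> r < 20 \<Longrightarrow> nmem s r = c r"
  and env_high: "env c s \<Longrightarrow> 100 \<le> r \<Longrightarrow> nmem s r = c r"
  and env_10: "env c s \<Longrightarrow> nmem s 10 = 1"
  and env_11: "env c s \<Longrightarrow> nmem s 11 = 0"
  and env_const: "env c s \<Longrightarrow> c 10 = 1" "env c s \<Longrightarrow> c 11 = 0"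
  by (auto simp: env_def)

lemma env_update_other:
  "env c (s\<lparr>fmem := f\<rparr>) \<longleftrightarrow> env c s" "env c (s\<lparr>outp := out\<rparr>) \<longleftrightarrow> env c s"
  by (auto simp: env_def)

lemma env_update_scratch:
  "20 \<le> r \<Longrightarrow> r < 100 \<Longrightarrow> env c (s\<lparr>nmem := f(r := k)\<rparr>) \<longleftrightarrow> env c (s\<lparr>nmem := f\<rparr>)"
  by (auto simp: env_def)

lemma env_same: "env c (s\<lparr>nmem := nmem s\<rparr>) \<longleftrightarrow> env c s"
  by (auto simp: env_def)

lemmas env_simps = env_10 env_11 env_const env_update_other env_update_scratch env_same

text \<open>Register 20 is the position in the seed and advances past the digits read; register 21
  receives the number.\<close>

definition read_bits :: "nat \<Rightarrow> com" where
  "read_bits w = seqs [NConst 21 0, NConst 22 0, WhileLess 22 w (seqs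
     [NAdd 21 21 21, NLoad 23 20, NAdd 21 21 23, NAdd 20 20 10, NAdd 22 22 10])]"

lemma runs_read_bits:
  assumes "env c s" "w < 20" "100 \<le> nmem s 20"
  shows "runs R e (read_bits w) s (6 * c w + 3) (\<lambda>s'. env c s' \<and> nmem s' 20 = nmem s 20 + c w \<and>
     nmem s' 21 = num c (nmem s 20) (c w) \<and> fmem s' = fmem s \<and> outp s' = outp s \<and>
     (\<forall>r\<ge>24. nmem s' r = nmem s r))"
proof -
  define p where "p = nmem s 20"
  define I where "I i s' \<longleftrightarrow> env c s' \<and> nmem s' 20 = p + i \<and> nmem s' 22 = i \<and>
     nmem s' 21 = num c p i \<and> fmem s' = fmem s \<and> outp s' = outp s \<and>
     (\<forall>r\<ge>24. nmem s' r = nmem s r)" for i s'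
  have loop: "runs R e (WhileLess 22 w (seqs
     [NAdd 21 21 21, NLoad 23 20, NAdd 21 21 23, NAdd 20 20 10, NAdd 22 22 10])) s' (c w * (5 + 1) + 1) (I (c w))"
    if "I 0 s'" for s'
  proof (rule runs_WhileLess[where I = I, OF that])
    fix i s1 assume i: "i < c w" "I i s1"
    show "nmem s1 22 < nmem s1 w" using i assms(2) by (simp add: I_def env_low[of c])
    show "runs R e (seqs [NAdd 21 21 21, NLoad 23 20, NAdd 21 21 23, NAdd 20 20 10, NAdd 22 22 10]) s1 5 (I (Suc i))"
      unfolding seqs.simps
      apply (rule runs_time)
       apply (rule runs_seq_atomic runs_atomic)+
      using i assms by (auto simp: I_def env_simps env_low[of c] env_high[of c] p_def)
  qed (use assms(2) in \<open>simp add: I_def env_low[of c]\<close>)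
  have "runs R e (read_bits w) s (1 + (1 + (c w * (5 + 1) + 1))) (I (c w))"
    unfolding read_bits_def seqs.simps
    apply (rule runs_seq_atomic loop[unfolded seqs.simps])+
    using assms by (simp add: I_def env_simps p_def)
  then show ?thesis
    by (rule runs_mono) (auto simp: I_def p_def)
qed

text \<open>Plain iteration suffices: exponents are multipliers with \<open>mul_bits\<close> digits,
  so their values are bounded by the number of points.\<close>

definition power_loop :: com where
  "power_loop = seqs [FOne 0, NConst 22 0, WhileLess 22 21 (seqs [FMult 0 0 1, NAdd 22 22 10])]"

lemma (in field) runs_power_loop:
  assumes "env c s" "fmem s 1 \<in> carrier R"
  shows "runs R e power_loop s (3 * nmem s 21 + 3) (\<lambda>s'. env c s' \<and>
     fmem s' = (fmem s)(0 := fmem s 1 [^] nmem s 21) \<and> outp s' = outp s \<and>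
     (\<forall>r. r \<noteq> 22 \<longrightarrow> nmem s' r = nmem s r))"
proof -
  define I where "I i s' \<longleftrightarrow> env c s' \<and> nmem s' 22 = i \<and>
     fmem s' = (fmem s)(0 := fmem s 1 [^] i) \<and> outp s' = outp s \<and>
     (\<forall>r. r \<noteq> 22 \<longrightarrow> nmem s' r = nmem s r)" for i s'
  have loop: "runs R e (WhileLess 22 21 (seqs [FMult 0 0 1, NAdd 22 22 10])) s'
      (nmem s 21 * (2 + 1) + 1) (I (nmem s 21))" if "I 0 s'" for s'
  proof (rule runs_WhileLess[where I = I, OF that])
    fix i s1 assume i: "i < nmem s 21" "I i s1"
    show "nmem s1 22 < nmem s1 21" using i by (simp add: I_def)
    show "runs R e (seqs [FMult 0 0 1, NAdd 22 22 10]) s1 2 (I (Suc i))"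
      unfolding seqs.simps
      apply (rule runs_time)
       apply (rule runs_seq_atomic runs_atomic)+
      using i(2) assms by (auto simp: I_def env_simps)
  qed (simp add: I_def)
  have "runs R e power_loop s (1 + (1 + (nmem s 21 * (2 + 1) + 1))) (I (nmem s 21))"
    unfolding power_loop_def seqs.simps
    apply (rule runs_seq_atomic loop[unfolded seqs.simps])+
    using assms by (simp add: I_def env_simps)
  then show ?thesis
    by (rule runs_mono) (auto simp: I_def)
qed

section \<open>Tables of powers for the blocks\<close>

definition fclosed :: "('a, 'b) ring_scheme \<Rightarrow> 'a machine \<Rightarrow> bool" where
  "fclosed R s \<longleftrightarrow> (\<forall>x. fmem s x \<in> carrier R)"

definition bits :: "(nat \<Rightarrow> nat) \<Rightarrow> bool" where
  "bits c \<longleftrightarrow> (\<forall>r\<ge>100. c r \<le> 1)"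

lemma num_less:
  assumes "bits c" "100 \<le> p"
  shows "num c p w < 2 ^ w"
proof (induction w)
  case (Suc w)
  have "c (p + w) \<le> 1" using assms by (simp add: bits_def)
  then show ?case using Suc by simp
qed simp

text \<open>Doubles the table by appending a power of each entry. This follows the recursion of
  \<open>weights\<close>, since \<open>t ^ (a * w) = (t ^ w) ^ a\<close>; the weights themselves,
  which may be far larger than the multipliers, are never computed.\<close>

definition copy_loop :: com where
  "copy_loop = WhileLess 28 25 (seqs [FLoad 1 27, power_loop, FStore 30 0,
     NAdd 30 30 10, NAdd 27 27 10, NAdd 28 28 10])"

definition level :: com where
  "level = seqs [read_bits 6, NAdd 27 24 11, NConst 28 0, copy_loop, NAdd 25 25 25, NAdd 26 26 10]"

definition build_table :: com where
  "build_table = seqs [read_bits 7, FElem 0 21, FStore 24 0, NConst 25 1, NAdd 30 24 10, NConst 26 0,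
     WhileLess 26 4 level, NAdd 24 24 5, NAdd 29 29 10]"

definition build_tables :: com where
  "build_tables = seqs [NAdd 24 14 11, NConst 29 0, WhileLess 29 15 build_table]"

definition table_time :: "nat \<Rightarrow> nat \<Rightarrow> nat \<Rightarrow> nat" where
  "table_time L q \<beta> = 6 * \<beta> + 12 + L * (6 * q + 9 + 2 ^ L * (3 * 2 ^ q + 9))"

context field
begin

lemma runs_copy_loop:
  assumes "env c s" "fclosed R s" "nmem s 27 = A" "nmem s 28 = 0" "nmem s 25 = len" "nmem s 30 = A + len"
    and "nmem s 21 = a" "2 \<le> A"
  shows "runs R e copy_loop s (len * (3 * a + 9) + 1) (\<lambda>s'. env c s' \<and> fclosed R s' \<and>
     nmem s' 30 = A + 2 * len \<and>
     (\<forall>x\<ge>2. fmem s' x = (if A + len \<le> x \<and> x < A + 2 * len then fmem s (x - len) [^] a else fmem s x)) \<and>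
     outp s' = outp s \<and> (\<forall>r. r \<notin> {22, 27, 28, 30} \<longrightarrow> nmem s' r = nmem s r))"
proof -
  define I where "I i s' \<longleftrightarrow> env c s' \<and> fclosed R s' \<and> nmem s' 27 = A + i \<and> nmem s' 28 = i \<and>
     nmem s' 30 = A + len + i \<and>
     (\<forall>x\<ge>2. fmem s' x = (if A + len \<le> x \<and> x < A + len + i then fmem s (x - len) [^] a else fmem s x)) \<and>
     outp s' = outp s \<and> (\<forall>r. r \<notin> {22, 27, 28, 30} \<longrightarrow> nmem s' r = nmem s r)" for i s'
  have "runs R e copy_loop s (len * ((3 * a + 8) + 1) + 1) (I len)"
    unfolding copy_loop_def
  proof (rule runs_WhileLess[where I = I])
    show "I 0 s" using assms by (auto simp: I_def)
    fix i s1 assume i: "i < len" "I i s1"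
    then show "nmem s1 28 < nmem s1 25" using assms by (simp add: I_def)
    have e1: "env c s1" and f1: "fclosed R s1" and n1: "nmem s1 27 = A + i" "nmem s1 28 = i"
      "nmem s1 30 = A + len + i" "nmem s1 21 = a" "outp s1 = outp s"
      and fr: "\<And>r. r \<notin> {22, 27, 28, 30} \<Longrightarrow> nmem s1 r = nmem s r"
      and fm: "\<And>x. x \<ge> 2 \<Longrightarrow> fmem s1 x = (if A + len \<le> x \<and> x < A + len + i then fmem s (x - len) [^] a else fmem s x)"
      using i assms by (auto simp: I_def)
    \<comment> \<open>The source lies among the first \<open>len\<close> cells, below everything
      written so far.\<close>
    have src: "fmem s1 (A + i) = fmem s (A + i)" using fm[of "A + i"] i(1) assms(8) by simp
    have closed: "fmem s x \<in> carrier R" for x using assms(2) by (simp add: fclosed_def)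
    have closed1: "fmem s1 x \<in> carrier R" for x using f1 by (simp add: fclosed_def)
    define s2 where "s2 = s1\<lparr>fmem := (fmem s1)(1 := fmem s1 (nmem s1 27))\<rparr>"
    have s2: "env c s2" "fmem s2 1 = fmem s (A + i)" "nmem s2 = nmem s1" "outp s2 = outp s"
      using e1 n1 src by (simp_all add: s2_def env_simps)
    have pw: "runs R e power_loop s2 (3 * a + 3) (\<lambda>s'. env c s' \<and>
       fmem s' = (fmem s2)(0 := fmem s (A + i) [^] a) \<and> outp s' = outp s \<and>
       (\<forall>r. r \<noteq> 22 \<longrightarrow> nmem s' r = nmem s1 r))"
      using runs_power_loop[OF s2(1), of e] s2 n1 closed by simp
    show "runs R e (seqs [FLoad 1 27, power_loop, FStore 30 0, NAdd 30 30 10, NAdd 27 27 10, NAdd 28 28 10])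
       s1 (3 * a + 8) (I (Suc i))"
      unfolding seqs.simps
      apply (rule runs_time)
       apply (rule runs_seq_atomic)
       apply (fold s2_def)
       apply (rule runs_Seq[OF pw])
       apply (rule runs_seq_atomic runs_atomic)+
      using n1 fr fm assms closed closed1
      by (auto simp: I_def env_simps fclosed_def s2_def)
  next
    fix s1 assume "I len s1"
    then show "\<not> nmem s1 28 < nmem s1 25" using assms by (simp add: I_def)
  qed
  then show ?thesis
    by (rule runs_mono) (auto simp: I_def mult_2)
qed

lemma runs_level:
  assumes "env c s" "fclosed R s" "bits c" "100 \<le> nmem s 20" "nmem s 24 = A" "nmem s 25 = len"
    and "nmem s 30 = A + len" "2 \<le> A" "len \<le> N"
  shows "runs R e level s (6 * c 6 + 8 + N * (3 * 2 ^ c 6 + 9)) (\<lambda>s'. env c s' \<and> fclosed R s' \<and>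
     nmem s' 20 = nmem s 20 + c 6 \<and> nmem s' 24 = A \<and> nmem s' 25 = 2 * len \<and> nmem s' 30 = A + 2 * len \<and>
     nmem s' 26 = nmem s 26 + 1 \<and>
     (\<forall>x\<ge>2. fmem s' x = (if A + len \<le> x \<and> x < A + 2 * len
        then fmem s (x - len) [^] num c (nmem s 20) (c 6) else fmem s x)) \<and>
     outp s' = outp s \<and> nmem s' 29 = nmem s 29 \<and> nmem s' 31 = nmem s 31)"
proof -
  define a where "a = num c (nmem s 20) (c 6)"
  have a: "a < 2 ^ c 6" unfolding a_def using assms(3,4) by (rule num_less)
  have "len * (3 * a + 9) \<le> N * (3 * 2 ^ c 6 + 9)"
    using a assms(9) by (intro mult_le_mono) auto
  moreover have "runs R e level s (6 * c 6 + 3 + (1 + (1 + (len * (3 * a + 9) + 1 + (1 + 1))))) (\<lambda>s'. env c s' \<and> fclosed R s' \<and>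
     nmem s' 20 = nmem s 20 + c 6 \<and> nmem s' 24 = A \<and> nmem s' 25 = 2 * len \<and> nmem s' 30 = A + 2 * len \<and>
     nmem s' 26 = nmem s 26 + 1 \<and>
     (\<forall>x\<ge>2. fmem s' x = (if A + len \<le> x \<and> x < A + 2 * len then fmem s (x - len) [^] a else fmem s x)) \<and>
     outp s' = outp s \<and> nmem s' 29 = nmem s 29 \<and> nmem s' 31 = nmem s 31)"
    unfolding level_def seqs.simps
  proof (rule runs_Seq[OF runs_read_bits[OF assms(1) _ assms(4)]], simp, elim conjE, rule runs_seq_atomic, rule runs_seq_atomic)
    fix s1 assume s1: "env c s1" "nmem s1 20 = nmem s 20 + c 6" "nmem s1 21 = num c (nmem s 20) (c 6)"
      "fmem s1 = fmem s" "outp s1 = outp s" "\<forall>r\<ge>24. nmem s1 r = nmem s r"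
    define s2 where "s2 = s1\<lparr>nmem := (nmem s1)(27 := nmem s1 24 + nmem s1 11)\<rparr>"
    define s3 where "s3 = s2\<lparr>nmem := (nmem s2)(28 := 0)\<rparr>"
    have s3: "env c s3" "fclosed R s3" "nmem s3 27 = A" "nmem s3 28 = 0" "nmem s3 25 = len" "nmem s3 30 = A + len"
      "nmem s3 21 = a" "nmem s3 20 = nmem s 20 + c 6" "nmem s3 24 = A" "nmem s3 26 = nmem s 26"
      "nmem s3 29 = nmem s 29" "nmem s3 31 = nmem s 31" "fmem s3 = fmem s" "outp s3 = outp s"
      using s1 assms by (simp_all add: s3_def s2_def env_simps a_def fclosed_def)
    show "runs R e (Seq copy_loop (Seq (NAdd 25 25 25) (NAdd 26 26 10))) s3
      (len * (3 * a + 9) + 1 + (1 + 1)) (\<lambda>s'. env c s' \<and> fclosed R s' \<and>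
     nmem s' 20 = nmem s 20 + c 6 \<and> nmem s' 24 = A \<and> nmem s' 25 = 2 * len \<and> nmem s' 30 = A + 2 * len \<and>
     nmem s' 26 = nmem s 26 + 1 \<and>
     (\<forall>x\<ge>2. fmem s' x = (if A + len \<le> x \<and> x < A + 2 * len then fmem s (x - len) [^] a else fmem s x)) \<and>
     outp s' = outp s \<and> nmem s' 29 = nmem s 29 \<and> nmem s' 31 = nmem s 31)"
      apply (rule runs_Seq[OF runs_copy_loop[OF s3(1-7) assms(8)]])
      apply (elim conjE)
      apply (rule runs_seq_atomic runs_atomic)+
      using s3 by (simp add: env_simps fclosed_def)
  qed
  ultimately show ?thesis
    unfolding a_def[symmetric] by (elim runs_time) simp
qed

lemma runs_build_table:
  assumes "env c s" "fclosed R s" "bits c" "100 \<le> p" "nmem s 20 = p" "nmem s 24 = A" "2 \<le> A"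
    and "c 5 = 2 ^ c 4" "range e \<subseteq> carrier R"
  shows "runs R e build_table s (table_time (c 4) (c 6) (c 7)) (\<lambda>s'. env c s' \<and> fclosed R s' \<and>
     nmem s' 20 = p + (c 7 + c 4 * c 6) \<and> nmem s' 24 = A + 2 ^ c 4 \<and>
     (\<forall>i<2 ^ c 4. fmem s' (A + i) =
        e (num c p (c 7)) [^] (weights (\<lambda>j. num c (p + c 7 + j * c 6) (c 6)) (c 4) ! i)) \<and>
     (\<forall>x\<ge>2. \<not> (A \<le> x \<and> x < A + 2 ^ c 4) \<longrightarrow> fmem s' x = fmem s x) \<and>
     outp s' = outp s \<and> nmem s' 29 = nmem s 29 + 1 \<and> nmem s' 31 = nmem s 31)"
proof -
  define \<alpha> where "\<alpha> j = num c (p + c 7 + j * c 6) (c 6)" for j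
  define t where "t = e (num c p (c 7))"
  have tc: "t \<in> carrier R" using assms(9) by (auto simp: t_def)
  define TL where "TL = 6 * c 6 + 8 + 2 ^ c 4 * (3 * 2 ^ c 6 + 9)"
  \<comment> \<open>After \<open>j\<close> levels the table holds the powers of \<open>t\<close>
    with exponents \<open>weights \<alpha> j\<close>.\<close>
  define I where "I j s' \<longleftrightarrow> env c s' \<and> fclosed R s' \<and> nmem s' 20 = p + c 7 + j * c 6 \<and>
     nmem s' 24 = A \<and> nmem s' 25 = 2 ^ j \<and> nmem s' 30 = A + 2 ^ j \<and> nmem s' 26 = j \<and>
     (\<forall>i<2 ^ j. fmem s' (A + i) = t [^] (weights \<alpha> j ! i)) \<and>
     (\<forall>x\<ge>2. \<not> (A \<le> x \<and> x < A + 2 ^ j) \<longrightarrow> fmem s' x = fmem s x) \<and>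
     outp s' = outp s \<and> nmem s' 29 = nmem s 29 \<and> nmem s' 31 = nmem s 31" for j s'
  have loop: "runs R e (WhileLess 26 4 level) s' (c 4 * (TL + 1) + 1) (I (c 4))" if "I 0 s'" for s'
  proof (rule runs_WhileLess[where I = I, OF that])
    fix j s1 assume j: "j < c 4" and I1: "I j s1"
    then have e1: "env c s1" "fclosed R s1" "100 \<le> nmem s1 20" "nmem s1 24 = A" "nmem s1 25 = 2 ^ j"
      "nmem s1 30 = A + 2 ^ j" using assms(4) by (auto simp: I_def)
    show "nmem s1 26 < nmem s1 4" using j I1 by (simp add: I_def env_low[of c])
    have le: "(2::nat) ^ j \<le> 2 ^ c 4" using j by (intro power_increasing) auto
    show "runs R e level s1 TL (I (Suc j))"
      unfolding TL_def
    proof (rule runs_mono[OF runs_level[OF e1(1,2) assms(3) e1(3-6) assms(7) le] _ order_refl], elim conjE)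
      fix s2
      assume s2: "env c s2" "fclosed R s2" "nmem s2 20 = nmem s1 20 + c 6" "nmem s2 24 = A"
        "nmem s2 25 = 2 * 2 ^ j" "nmem s2 30 = A + 2 * 2 ^ j" "nmem s2 26 = nmem s1 26 + 1"
        "\<forall>x\<ge>2. fmem s2 x = (if A + 2 ^ j \<le> x \<and> x < A + 2 * 2 ^ j
          then fmem s1 (x - 2 ^ j) [^] num c (nmem s1 20) (c 6) else fmem s1 x)"
        "outp s2 = outp s1" "nmem s2 29 = nmem s1 29" "nmem s2 31 = nmem s1 31"
      have a: "num c (nmem s1 20) (c 6) = \<alpha> j" using I1 by (simp add: I_def \<alpha>_def)
      have tab: "\<And>i. i < 2 ^ j \<Longrightarrow> fmem s1 (A + i) = t [^] (weights \<alpha> j ! i)"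
        and oth: "\<And>x. 2 \<le> x \<Longrightarrow> \<not> (A \<le> x \<and> x < A + 2 ^ j) \<Longrightarrow> fmem s1 x = fmem s x"
        using I1 by (auto simp: I_def)
      have "fmem s2 (A + i) = t [^] (weights \<alpha> (Suc j) ! i)" if i: "i < 2 ^ Suc j" for i
      proof (cases "i < 2 ^ j")
        case True
        then show ?thesis using s2(8) tab[OF True] assms(7) by (simp add: nth_append)
      next
        case False
        define i' where "i' = i - 2 ^ j"
        have i': "i' < 2 ^ j" "i = 2 ^ j + i'" using False i by (auto simp: i'_def)
        have "fmem s2 (A + i) = fmem s1 (A + i') [^] \<alpha> j"
          using s2(8) assms(7) i' a by simp
        also have "\<dots> = t [^] (weights \<alpha> j ! i' * \<alpha> j)"
          using tab[OF i'(1)] tc by (simp add: nat_pow_pow)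
        finally show ?thesis using i' by (simp add: nth_append mult.commute)
      qed
      moreover have "fmem s2 x = fmem s x" if "2 \<le> x" "\<not> (A \<le> x \<and> x < A + 2 ^ Suc j)" for x
        using s2(8) oth[of x] that by auto
      ultimately show "I (Suc j) s2"
        using s2 I1 by (simp add: I_def)
    qed
  next
    fix s1 assume "I (c 4) s1"
    then show "\<not> nmem s1 26 < nmem s1 4" by (simp add: I_def env_low[of c])
  qed
  have "runs R e build_table s (6 * c 7 + 3 + (1 + (1 + (1 + (1 + (1 + (c 4 * (TL + 1) + 1 + (1 + 1))))))))
    (\<lambda>s'. env c s' \<and> fclosed R s' \<and> nmem s' 20 = p + (c 7 + c 4 * c 6) \<and> nmem s' 24 = A + 2 ^ c 4 \<and>
     (\<forall>i<2 ^ c 4. fmem s' (A + i) = t [^] (weights \<alpha> (c 4) ! i)) \<and>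
     (\<forall>x\<ge>2. \<not> (A \<le> x \<and> x < A + 2 ^ c 4) \<longrightarrow> fmem s' x = fmem s x) \<and>
     outp s' = outp s \<and> nmem s' 29 = nmem s 29 + 1 \<and> nmem s' 31 = nmem s 31)"
    unfolding build_table_def seqs.simps
  proof (rule runs_Seq[OF runs_read_bits[OF assms(1)]], simp, use assms(4,5) in simp, elim conjE, (rule runs_seq_atomic)+)
    fix s1 assume s1: "env c s1" "nmem s1 20 = nmem s 20 + c 7" "nmem s1 21 = num c (nmem s 20) (c 7)"
      "fmem s1 = fmem s" "outp s1 = outp s" "\<forall>r\<ge>24. nmem s1 r = nmem s r"
    define s2 where "s2 = s1\<lparr>fmem := (fmem s1)(0 := e (nmem s1 21))\<rparr>"
    define s3 where "s3 = s2\<lparr>fmem := (fmem s2)(nmem s2 24 := fmem s2 0)\<rparr>"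
    define s4 where "s4 = s3\<lparr>nmem := (nmem s3)(25 := 1)\<rparr>"
    define s5 where "s5 = s4\<lparr>nmem := (nmem s4)(30 := nmem s4 24 + nmem s4 10)\<rparr>"
    define s6 where "s6 = s5\<lparr>nmem := (nmem s5)(26 := 0)\<rparr>"
    have "I 0 s6"
      using s1 assms tc by (auto simp: I_def s6_def s5_def s4_def s3_def s2_def env_simps fclosed_def t_def)
    show "runs R e (Seq (WhileLess 26 4 level) (Seq (NAdd 24 24 5) (NAdd 29 29 10))) s6
      (c 4 * (TL + 1) + 1 + (1 + 1))
    (\<lambda>s'. env c s' \<and> fclosed R s' \<and> nmem s' 20 = p + (c 7 + c 4 * c 6) \<and> nmem s' 24 = A + 2 ^ c 4 \<and>
     (\<forall>i<2 ^ c 4. fmem s' (A + i) = t [^] (weights \<alpha> (c 4) ! i)) \<and>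
     (\<forall>x\<ge>2. \<not> (A \<le> x \<and> x < A + 2 ^ c 4) \<longrightarrow> fmem s' x = fmem s x) \<and>
     outp s' = outp s \<and> nmem s' 29 = nmem s 29 + 1 \<and> nmem s' 31 = nmem s 31)"
      apply (rule runs_Seq[OF loop[OF \<open>I 0 s6\<close>]])
      apply (rule runs_seq_atomic runs_atomic)+
      using assms(8) env_const[OF assms(1)] by (simp add: I_def env_simps env_low[of c] fclosed_def)
  qed
  then show ?thesis
    unfolding t_def[symmetric] \<alpha>_def[symmetric, abs_def]
    by (rule runs_time) (simp add: table_time_def TL_def algebra_simps)
qed

lemma runs_build_tables:
  assumes "env c s" "fclosed R s" "bits c" "100 \<le> p" "nmem s 20 = p"
    and "c 5 = 2 ^ c 4" "c 14 = 10" "range e \<subseteq> carrier R"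
  defines "S \<equiv> c 7 + c 4 * c 6"
  shows "runs R e build_tables s (3 + c 15 * (table_time (c 4) (c 6) (c 7) + 1)) (\<lambda>s'. env c s' \<and> fclosed R s' \<and>
     nmem s' 20 = p + c 15 * S \<and>
     (\<forall>b<c 15. \<forall>i<2 ^ c 4. fmem s' (10 + b * 2 ^ c 4 + i) = e (num c (p + b * S) (c 7)) [^]
        (weights (\<lambda>j. num c (p + b * S + c 7 + j * c 6) (c 6)) (c 4) ! i)) \<and>
     outp s' = outp s \<and> nmem s' 31 = nmem s 31)"
proof -
  define I where "I b s' \<longleftrightarrow> env c s' \<and> fclosed R s' \<and> nmem s' 20 = p + b * S \<and> nmem s' 29 = b \<and>
     nmem s' 24 = 10 + b * 2 ^ c 4 \<and>
     (\<forall>b'<b. \<forall>i<2 ^ c 4. fmem s' (10 + b' * 2 ^ c 4 + i) = e (num c (p + b' * S) (c 7)) [^]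
        (weights (\<lambda>j. num c (p + b' * S + c 7 + j * c 6) (c 6)) (c 4) ! i)) \<and>
     outp s' = outp s \<and> nmem s' 31 = nmem s 31" for b s'
  have loop: "runs R e (WhileLess 29 15 build_table) s' (c 15 * (table_time (c 4) (c 6) (c 7) + 1) + 1) (I (c 15))"
    if "I 0 s'" for s'
  proof (rule runs_WhileLess[where I = I, OF that])
    fix b s1 assume b: "b < c 15" and I1: "I b s1"
    show "nmem s1 29 < nmem s1 15" using b I1 by (simp add: I_def env_low[of c])
    have h: "env c s1" "fclosed R s1" "100 \<le> p + b * S" "nmem s1 20 = p + b * S" "nmem s1 24 = 10 + b * 2 ^ c 4"
      "2 \<le> 10 + b * 2 ^ c 4" using I1 assms(4) by (auto simp: I_def)
    show "runs R e build_table s1 (table_time (c 4) (c 6) (c 7)) (I (Suc b))"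
    proof (rule runs_mono[OF runs_build_table[OF h(1,2) assms(3) h(3-6) assms(6,8)] _ order_refl], elim conjE)
      fix s2
      assume s2: "env c s2" "fclosed R s2" "nmem s2 20 = p + b * S + (c 7 + c 4 * c 6)"
        "nmem s2 24 = 10 + b * 2 ^ c 4 + 2 ^ c 4"
        "\<forall>i<2 ^ c 4. fmem s2 (10 + b * 2 ^ c 4 + i) = e (num c (p + b * S) (c 7)) [^]
          (weights (\<lambda>j. num c (p + b * S + c 7 + j * c 6) (c 6)) (c 4) ! i)"
        "\<forall>x\<ge>2. \<not> (10 + b * 2 ^ c 4 \<le> x \<and> x < 10 + b * 2 ^ c 4 + 2 ^ c 4) \<longrightarrow> fmem s2 x = fmem s1 x"
        "outp s2 = outp s1" "nmem s2 29 = nmem s1 29 + 1" "nmem s2 31 = nmem s1 31"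
      have "fmem s2 (10 + b' * 2 ^ c 4 + i) = e (num c (p + b' * S) (c 7)) [^]
          (weights (\<lambda>j. num c (p + b' * S + c 7 + j * c 6) (c 6)) (c 4) ! i)"
        if "b' < Suc b" "i < 2 ^ c 4" for b' i
      proof (cases "b' = b")
        case False
        then have "Suc b' * 2 ^ c 4 \<le> b * 2 ^ c 4" using that by (intro mult_le_mono1) simp
        then have "fmem s2 (10 + b' * 2 ^ c 4 + i) = fmem s1 (10 + b' * 2 ^ c 4 + i)"
          using s2(6) that by auto
        then show ?thesis using I1 that False by (simp add: I_def)
      qed (use s2(5) that in simp)
      then show "I (Suc b) s2"
        using s2 I1 by (simp add: I_def S_def)
    qed
  next
    fix s1 assume "I (c 15) s1"
    then show "\<not> nmem s1 29 < nmem s1 15" by (simp add: I_def env_low[of c])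
  qed
  have "runs R e build_tables s (1 + (1 + (c 15 * (table_time (c 4) (c 6) (c 7) + 1) + 1))) (I (c 15))"
    unfolding build_tables_def seqs.simps
    apply (rule runs_seq_atomic loop)+
    using assms by (auto simp: I_def env_simps env_low[of c] fclosed_def)
  then show ?thesis
    by (rule runs_mono) (auto simp: I_def)
qed

end

section \<open>Writing the point of a seed\<close>

definition fill_row :: com where
  "fill_row = seqs [read_bits 4, NAdd 24 14 26, NConst 22 0,
     WhileLess 22 21 (seqs [NAdd 24 24 5, NAdd 22 22 10]),
     NConst 28 0,
     WhileLess 28 3 (seqs [FLoad 0 24, FStore 30 0, NAdd 24 24 5, NAdd 30 30 10, NAdd 28 28 10]),
     NAdd 26 26 10]"

text \<open>Comparing the write position with the end of the point yields the rounded-up number of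
  rows without a division. The last row may run past the end; the cells there are not
  emitted.\<close>

definition fill_point :: com where
  "fill_point = seqs [NAdd 30 12 11, NConst 26 0, WhileLess 30 13 fill_row]"

definition override_point :: com where
  "override_point = seqs [NConst 26 0, WhileLess 26 9 (seqs [read_bits 4, NAdd 24 12 21, NLoad 23 20,
     IfLess 11 23 (FOne 0) (FZero 0), FStore 24 0, NAdd 20 20 10, NAdd 26 26 10])]"

definition emit_point :: com where
  "emit_point = seqs [NAdd 24 12 11, WhileLess 24 13 (seqs [FLoad 0 24, Emit 0, NAdd 24 24 10])]"

text \<open>Binary increment: clear the trailing ones and set the first zero. The seed itself is the
  counter of the enumeration.\<close>

definition next_seed :: com where
  "next_seed = seqs [NAdd 24 16 11, NLoad 23 24,
     WhileLess 11 23 (seqs [NStore 24 11, NAdd 24 24 10, NLoad 23 24]), NStore 24 10]"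

primrec overrides :: "('a, 'b) ring_scheme \<Rightarrow> (nat \<Rightarrow> 'a) \<Rightarrow> (nat \<Rightarrow> nat) \<Rightarrow> (nat \<Rightarrow> nat) \<Rightarrow> nat \<Rightarrow> nat \<Rightarrow> 'a" where
  "overrides R x vs ys 0 = x"
| "overrides R x vs ys (Suc d) = (overrides R x vs ys d)(vs d := if 0 < ys d then \<one>\<^bsub>R\<^esub> else \<zero>\<^bsub>R\<^esub>)"

text \<open>The seed with number \<open>V\<close> is the binary expansion of \<open>V\<close>, with
  the lowest digit in cell 100.\<close>

definition seed_env :: "(nat \<Rightarrow> nat) \<Rightarrow> nat \<Rightarrow> nat \<Rightarrow> nat" where
  "seed_env c V r = (if r < 20 then c r else of_bool (bit V (r - 100)))"

lemma trailing_ones: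
  "\<exists>z\<le>V. (\<forall>i<z. bit V i) \<and> \<not> bit V z \<and> (\<forall>i. bit (Suc V) i \<longleftrightarrow> i = z \<or> z < i \<and> bit V i)"
proof (induction V rule: less_induct)
  case (less V)
  show ?case
  proof (cases "even V")
    case True
    have "bit (Suc V) i \<longleftrightarrow> i = 0 \<or> 0 < i \<and> bit V i" for i
      using True by (cases i) (auto simp: bit_0 bit_Suc)
    then show ?thesis using True by (intro exI[of _ 0]) (auto simp: bit_0)
  next
    case False
    then have "V div 2 < V" by (cases V) auto
    from less[OF this] obtain z where z: "z \<le> V div 2" "\<forall>i<z. bit (V div 2) i" "\<not> bit (V div 2) z"
      "\<forall>i. bit (Suc (V div 2)) i \<longleftrightarrow> i = z \<or> z < i \<and> bit (V div 2) i" by blast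
    have S: "Suc V div 2 = Suc (V div 2)" using False by presburger
    have "bit (Suc V) i \<longleftrightarrow> i = Suc z \<or> Suc z < i \<and> bit V i" for i
      using False z(4) by (cases i) (auto simp: bit_0 bit_Suc S)
    moreover have "bit V i" if "i < Suc z" for i
      using that z(2) False by (cases i) (auto simp: bit_0 bit_Suc)
    moreover have "\<not> bit V (Suc z)" using z(3) by (simp add: bit_Suc)
    moreover have "Suc z \<le> V" using z(1) \<open>V div 2 < V\<close> by linarith
    ultimately show ?thesis by blast
  qed
qed

text \<open>The crude bound \<open>4 * V + 4\<close> comes from at most \<open>V\<close> trailing
  ones; it is harmless since \<open>V\<close> is below the number of seeds.\<close>

lemma runs_next_seed:
  fixes s :: "'a machine"
  assumes "env (seed_env c V) s" "c 16 = 100"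
  shows "runs R e next_seed s (4 * V + 4) (\<lambda>s'. env (seed_env c (Suc V)) s' \<and> fmem s' = fmem s \<and>
     outp s' = outp s \<and> nmem s' 31 = nmem s 31)"
proof -
  obtain z where z: "z \<le> V" "\<And>i. i < z \<Longrightarrow> bit V i" "\<not> bit V z"
    "\<And>i. bit (Suc V) i \<longleftrightarrow> i = z \<or> z < i \<and> bit V i" using trailing_ones[of V] by blast
  have c: "c 10 = 1" "c 11 = 0" using assms(1) by (auto simp: env_def seed_env_def)
  define I where "I i s' \<longleftrightarrow> (\<forall>r<20. nmem s' r = c r) \<and>
     (\<forall>r\<ge>100. nmem s' r = (if r < 100 + i then 0 else of_bool (bit V (r - 100)))) \<and>
     nmem s' 24 = 100 + i \<and> nmem s' 23 = of_bool (bit V i) \<and> fmem s' = fmem s \<and>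
     outp s' = outp s \<and> nmem s' 31 = nmem s 31" for i and s' :: "'a machine"
  have loop: "runs R e (WhileLess 11 23 (seqs [NStore 24 11, NAdd 24 24 10, NLoad 23 24])) s' (z * (3 + 1) + 1) (I z)"
    if "I 0 s'" for s'
  proof (rule runs_WhileLess[where I = I, OF that])
    fix i s1 assume i: "i < z" and I1: "I i s1"
    show "nmem s1 11 < nmem s1 23" using I1 z(2)[OF i] c by (simp add: I_def)
    show "runs R e (seqs [NStore 24 11, NAdd 24 24 10, NLoad 23 24]) s1 3 (I (Suc i))"
      unfolding seqs.simps
      apply (rule runs_time)
       apply (rule runs_seq_atomic runs_atomic)+
      using I1 c by (auto simp: I_def)
  next
    fix s1 assume "I z s1"
    then show "\<not> nmem s1 11 < nmem s1 23" using z(3) c by (simp add: I_def)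
  qed
  have "runs R e next_seed s (1 + (1 + (z * (3 + 1) + 1 + 1))) (\<lambda>s'. env (seed_env c (Suc V)) s' \<and> fmem s' = fmem s \<and>
     outp s' = outp s \<and> nmem s' 31 = nmem s 31)"
    unfolding next_seed_def seqs.simps
    apply (rule runs_seq_atomic)
    apply (rule runs_seq_atomic)
    apply (rule runs_Seq[OF loop[unfolded seqs.simps]])
    subgoal using assms c by (simp add: I_def env_def seed_env_def)
    apply (rule runs_atomic)
    using c z(2,4) by (auto simp: I_def env_def seed_env_def)
  then show ?thesis using z(1) by (elim runs_time) simp
qed

context field
begin

text \<open>With shift \<open>\<sigma>\<close>, column \<open>j\<close> of row \<open>i\<close> lies
  in block \<open>\<sigma> + j\<close>, so successive variables of a row are read one table length
  \<open>N\<close> apart. A number read from the seed may be too large for a shift and lead past the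
  tables; the contents are therefore claimed only for shifts below \<open>c 3\<close>, closure in
  the field always.\<close>

lemma runs_fill_row:
  assumes "env c s" "fclosed R s" "bits c" "100 \<le> p" "nmem s 20 = p" "nmem s 26 = i"
    and "nmem s 30 = c 12 + i * c 3" "c 12 = 10 + 2 * c 3 * N" "c 5 = N" "c 14 = 10"
  shows "runs R e fill_row s (6 * c 4 + 8 + 3 * 2 ^ c 4 + 6 * c 3) (\<lambda>s'. env c s' \<and> fclosed R s' \<and>
     nmem s' 20 = p + c 4 \<and> nmem s' 26 = i + 1 \<and> nmem s' 30 = c 12 + (i + 1) * c 3 \<and>
     (\<forall>x. 2 \<le> x \<and> x < c 12 + i * c 3 \<longrightarrow> fmem s' x = fmem s x) \<and>
     (\<forall>j<c 3. num c p (c 4) < c 3 \<longrightarrow> i < N \<longrightarrow>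
        fmem s' (c 12 + i * c 3 + j) = fmem s (10 + (num c p (c 4) + j) * N + i)) \<and>
     outp s' = outp s \<and> nmem s' 31 = nmem s 31)"
proof -
  define \<sigma> where "\<sigma> = num c p (c 4)"
  have \<sigma>: "\<sigma> < 2 ^ c 4" unfolding \<sigma>_def using assms(3,4) by (rule num_less)
  have closed: "fmem s x \<in> carrier R" for x using assms(2) by (simp add: fclosed_def)
  define I where "I k s' \<longleftrightarrow> env c s' \<and> fmem s' = fmem s \<and> nmem s' 20 = p + c 4 \<and> nmem s' 26 = i \<and>
     nmem s' 30 = c 12 + i * c 3 \<and> nmem s' 22 = k \<and> nmem s' 21 = \<sigma> \<and> nmem s' 24 = 10 + i + k * N \<and>
     outp s' = outp s \<and> nmem s' 31 = nmem s 31" for k s'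
  have loop1: "runs R e (WhileLess 22 21 (seqs [NAdd 24 24 5, NAdd 22 22 10])) s' (\<sigma> * (2 + 1) + 1) (I \<sigma>)"
    if "I 0 s'" for s'
  proof (rule runs_WhileLess[where I = I, OF that])
    fix k s1 assume k: "k < \<sigma>" and I1: "I k s1"
    show "nmem s1 22 < nmem s1 21" using k I1 by (simp add: I_def)
    show "runs R e (seqs [NAdd 24 24 5, NAdd 22 22 10]) s1 2 (I (Suc k))"
      unfolding seqs.simps
      apply (rule runs_time)
       apply (rule runs_seq_atomic runs_atomic)+
      using I1 assms by (auto simp: I_def env_simps env_low[of c])
  qed (simp add: I_def)
  define J where "J j s' \<longleftrightarrow> env c s' \<and> fclosed R s' \<and> nmem s' 20 = p + c 4 \<and> nmem s' 26 = i \<and>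
     nmem s' 30 = c 12 + i * c 3 + j \<and> nmem s' 28 = j \<and> nmem s' 24 = 10 + i + (\<sigma> + j) * N \<and>
     (\<forall>x. 2 \<le> x \<and> x < c 12 + i * c 3 \<longrightarrow> fmem s' x = fmem s x) \<and>
     (\<forall>j'<j. \<sigma> < c 3 \<longrightarrow> i < N \<longrightarrow> fmem s' (c 12 + i * c 3 + j') = fmem s (10 + (\<sigma> + j') * N + i)) \<and>
     outp s' = outp s \<and> nmem s' 31 = nmem s 31" for j s'
  have loop2: "runs R e (WhileLess 28 3 (seqs [FLoad 0 24, FStore 30 0, NAdd 24 24 5, NAdd 30 30 10, NAdd 28 28 10])) s'
    (c 3 * (5 + 1) + 1) (J (c 3))" if "J 0 s'" for s'
  proof (rule runs_WhileLess[where I = J, OF that])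
    fix j s1 assume j: "j < c 3" and J1: "J j s1"
    show "nmem s1 28 < nmem s1 3" using j J1 by (simp add: J_def env_low[of c])
    \<comment> \<open>The block index \<open>\<sigma> + j\<close> is below \<open>2 * c 3\<close>,
      so the address is inside the tables, which this loop does not overwrite.\<close>
    have addr: "10 + i + (\<sigma> + j) * N < c 12 + i * c 3" if "\<sigma> < c 3" "i < N"
    proof -
      have "(\<sigma> + j + 1) * N \<le> (2 * c 3) * N" using that j by (intro mult_le_mono1) simp
      then show ?thesis using that assms(8) by simp
    qed
    have val: "fmem s1 (10 + i + (\<sigma> + j) * N) = fmem s (10 + (\<sigma> + j) * N + i)" if "\<sigma> < c 3" "i < N"
      using J1 addr[OF that] by (simp add: J_def ac_simps)
    have c12: "2 \<le> c 12" using assms(8) by simp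
    show "runs R e (seqs [FLoad 0 24, FStore 30 0, NAdd 24 24 5, NAdd 30 30 10, NAdd 28 28 10]) s1 5 (J (Suc j))"
      unfolding seqs.simps
      apply (rule runs_time)
       apply (rule runs_seq_atomic runs_atomic)+
      using J1 assms(1,9) c12 val by (auto simp: J_def env_simps env_low[of c] fclosed_def less_Suc_eq)
  qed (simp add: J_def env_low[of c])
  have "runs R e fill_row s (6 * c 4 + 3 + (1 + (1 + (\<sigma> * (2 + 1) + 1 + (1 + (c 3 * (5 + 1) + 1 + 1))))))
    (\<lambda>s'. env c s' \<and> fclosed R s' \<and>
     nmem s' 20 = p + c 4 \<and> nmem s' 26 = i + 1 \<and> nmem s' 30 = c 12 + (i + 1) * c 3 \<and>
     (\<forall>x. 2 \<le> x \<and> x < c 12 + i * c 3 \<longrightarrow> fmem s' x = fmem s x) \<and>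
     (\<forall>j<c 3. \<sigma> < c 3 \<longrightarrow> i < N \<longrightarrow>
        fmem s' (c 12 + i * c 3 + j) = fmem s (10 + (\<sigma> + j) * N + i)) \<and>
     outp s' = outp s \<and> nmem s' 31 = nmem s 31)"
    unfolding fill_row_def seqs.simps
    apply (rule runs_Seq[OF runs_read_bits[OF assms(1)]])
    subgoal by simp
    subgoal using assms by simp
    apply (elim conjE)
    apply (rule runs_seq_atomic)
    apply (rule runs_seq_atomic)
    apply (rule runs_Seq[OF loop1[unfolded seqs.simps]])
    subgoal using assms by (simp add: I_def env_simps env_low[of c] \<sigma>_def)
    apply (rule runs_seq_atomic)
    apply (rule runs_Seq[OF loop2[unfolded seqs.simps]])
    subgoal using closed by (simp add: I_def J_def env_simps fclosed_def)
    apply (rule runs_atomic)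
    using env_const[OF assms(1)] by (auto simp: J_def env_simps env_low[of c] fclosed_def)
  then show ?thesis
    unfolding \<sigma>_def[symmetric] using \<sigma> by (elim runs_time) simp
qed

lemma runs_fill_point:
  assumes "env c s" "fclosed R s" "bits c" "100 \<le> p" "nmem s 20 = p"
    and "c 12 = 10 + 2 * c 3 * N" "c 5 = N" "c 14 = 10" "c 13 = c 12 + n"
    and "n \<le> r * c 3" "\<forall>i<r. i * c 3 < n" "r \<le> N"
  shows "runs R e fill_point s (3 + r * (6 * c 4 + 9 + 3 * 2 ^ c 4 + 6 * c 3)) (\<lambda>s'. env c s' \<and> fclosed R s' \<and>
     nmem s' 20 = p + r * c 4 \<and>
     (\<forall>k<n. num c (p + (k div c 3) * c 4) (c 4) < c 3 \<longrightarrow>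
        fmem s' (c 12 + k) = fmem s (10 + (num c (p + (k div c 3) * c 4) (c 4) + k mod c 3) * N + k div c 3)) \<and>
     outp s' = outp s \<and> nmem s' 31 = nmem s 31)"
proof -
  define \<sigma> where "\<sigma> i = num c (p + i * c 4) (c 4)" for i
  define I where "I i s' \<longleftrightarrow> env c s' \<and> fclosed R s' \<and> nmem s' 20 = p + i * c 4 \<and> nmem s' 26 = i \<and>
     nmem s' 30 = c 12 + i * c 3 \<and>
     (\<forall>x. 2 \<le> x \<and> x < c 12 \<longrightarrow> fmem s' x = fmem s x) \<and>
     (\<forall>k<i * c 3. \<sigma> (k div c 3) < c 3 \<longrightarrow>
        fmem s' (c 12 + k) = fmem s (10 + (\<sigma> (k div c 3) + k mod c 3) * N + k div c 3)) \<and>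
     outp s' = outp s \<and> nmem s' 31 = nmem s 31" for i s'
  have loop: "runs R e (WhileLess 30 13 fill_row) s' (r * ((6 * c 4 + 8 + 3 * 2 ^ c 4 + 6 * c 3) + 1) + 1) (I r)"
    if "I 0 s'" for s'
  proof (rule runs_WhileLess[where I = I, OF that])
    fix i s1 assume i: "i < r" and I1: "I i s1"
    show "nmem s1 30 < nmem s1 13" using I1 assms(9) assms(11)[rule_format, OF i] by (simp add: I_def env_low[of c])
    have h: "env c s1" "fclosed R s1" "100 \<le> p + i * c 4" "nmem s1 20 = p + i * c 4" "nmem s1 26 = i"
      "nmem s1 30 = c 12 + i * c 3" using I1 assms(4) by (auto simp: I_def)
    show "runs R e fill_row s1 (6 * c 4 + 8 + 3 * 2 ^ c 4 + 6 * c 3) (I (Suc i))"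
    proof (rule runs_mono[OF runs_fill_row[OF h(1,2) assms(3) h(3-6) assms(6-8)] _ order_refl], elim conjE)
      fix s2
      assume s2: "env c s2" "fclosed R s2" "nmem s2 20 = p + i * c 4 + c 4" "nmem s2 26 = i + 1"
        "nmem s2 30 = c 12 + (i + 1) * c 3"
        "\<forall>x. 2 \<le> x \<and> x < c 12 + i * c 3 \<longrightarrow> fmem s2 x = fmem s1 x"
        "\<forall>j<c 3. num c (p + i * c 4) (c 4) < c 3 \<longrightarrow> i < N \<longrightarrow>
          fmem s2 (c 12 + i * c 3 + j) = fmem s1 (10 + (num c (p + i * c 4) (c 4) + j) * N + i)"
        "outp s2 = outp s1" "nmem s2 31 = nmem s1 31"
      have iN: "i < N" using i assms(12) by simp
      have old: "fmem s1 x = fmem s x" if "2 \<le> x" "x < c 12" for x using I1 that by (simp add: I_def)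
      have "fmem s2 (c 12 + k) = fmem s (10 + (\<sigma> (k div c 3) + k mod c 3) * N + k div c 3)"
        if k: "k < Suc i * c 3" "\<sigma> (k div c 3) < c 3" for k
      proof (cases "k < i * c 3")
        case True
        then have "fmem s2 (c 12 + k) = fmem s1 (c 12 + k)" using s2(6) assms(6) by simp
        then show ?thesis using I1 True k by (simp add: I_def)
      next
        case False
        define j where "j = k - i * c 3"
        have j: "j < c 3" "k = i * c 3 + j" using False k(1) by (auto simp: j_def)
        have dm: "k div c 3 = i" "k mod c 3 = j" using j by simp_all
        have "(\<sigma> i + j + 1) * N \<le> (2 * c 3) * N" using k(2) dm j(1) by (intro mult_le_mono1) simp
        then have "10 + (\<sigma> i + j) * N + i < c 12" using iN assms(6) by simp
        then have "fmem s1 (10 + (\<sigma> i + j) * N + i) = fmem s (10 + (\<sigma> i + j) * N + i)"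
          by (intro old) auto
        moreover have "fmem s2 (c 12 + i * c 3 + j) = fmem s1 (10 + (\<sigma> i + j) * N + i)"
          using s2(7) j(1) iN k(2) dm by (simp add: \<sigma>_def)
        ultimately show ?thesis using j(2) dm by (simp add: add.assoc)
      qed
      moreover have "fmem s2 x = fmem s x" if "2 \<le> x" "x < c 12" for x using s2(6) old that by simp
      ultimately show "I (Suc i) s2"
        using s2 I1 by (simp add: I_def algebra_simps)
    qed
  next
    fix s1 assume "I r s1"
    then show "\<not> nmem s1 30 < nmem s1 13" using assms(9,10) by (simp add: I_def env_low[of c])
  qed
  have "runs R e fill_point s (1 + (1 + (r * ((6 * c 4 + 8 + 3 * 2 ^ c 4 + 6 * c 3) + 1) + 1))) (I r)"
    unfolding fill_point_def seqs.simps
    apply (rule runs_seq_atomic loop)+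
    using assms by (auto simp: I_def env_simps env_low[of c] fclosed_def)
  then show ?thesis
    by (rule runs_mono) (use assms(10) in \<open>auto simp: I_def \<sigma>_def\<close>)
qed

lemma runs_override_point:
  assumes "env c s" "fclosed R s" "100 \<le> p" "nmem s 20 = p" "2 \<le> c 12"
  shows "runs R e override_point s (2 + c 9 * (6 * c 4 + 11)) (\<lambda>s'. env c s' \<and> fclosed R s' \<and>
     (\<forall>k. fmem s' (c 12 + k) = overrides R (\<lambda>k. fmem s (c 12 + k))
        (\<lambda>d. num c (p + d * (c 4 + 1)) (c 4)) (\<lambda>d. c (p + d * (c 4 + 1) + c 4)) (c 9) k) \<and>
     outp s' = outp s \<and> nmem s' 31 = nmem s 31)"
proof -
  define O' where "O' = overrides R (\<lambda>k. fmem s (c 12 + k))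
        (\<lambda>d. num c (p + d * (c 4 + 1)) (c 4)) (\<lambda>d. c (p + d * (c 4 + 1) + c 4))"
  define I where "I d s' \<longleftrightarrow> env c s' \<and> fclosed R s' \<and> nmem s' 20 = p + d * (c 4 + 1) \<and> nmem s' 26 = d \<and>
     (\<forall>k. fmem s' (c 12 + k) = O' d k) \<and> outp s' = outp s \<and> nmem s' 31 = nmem s 31" for d s'
  let ?body = "seqs [read_bits 4, NAdd 24 12 21, NLoad 23 20,
     IfLess 11 23 (FOne 0) (FZero 0), FStore 24 0, NAdd 20 20 10, NAdd 26 26 10]"
  have loop: "runs R e (WhileLess 26 9 ?body) s' (c 9 * ((6 * c 4 + 10) + 1) + 1) (I (c 9))"
    if "I 0 s'" for s'
  proof (rule runs_WhileLess[where I = I, OF that])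
    fix d s1 assume d: "d < c 9" and I1: "I d s1"
    show "nmem s1 26 < nmem s1 9" using d I1 by (simp add: I_def env_low[of c])
    have e1: "env c s1" using I1 by (simp add: I_def)
    show "runs R e ?body s1 (6 * c 4 + 10) (I (Suc d))"
      unfolding seqs.simps
      apply (rule runs_time)
       apply (rule runs_Seq[OF runs_read_bits[OF e1]])
      subgoal by simp
      subgoal using I1 assms(3) by (simp add: I_def)
       apply (elim conjE)
       apply (rule runs_seq_atomic)
       apply (rule runs_seq_atomic)
       apply (rule runs_Seq[where ?T1.0 = "1 + 1" and ?Q1.0 = "\<lambda>s'. env c s' \<and> fclosed R s' \<and> (\<forall>x. x \<noteq> 0 \<longrightarrow> fmem s' x = fmem s1 x) \<and>
           fmem s' 0 = (if 0 < c (p + d * (c 4 + 1) + c 4) then \<one> else \<zero>) \<and> outp s' = outp s1 \<and>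
           nmem s' 20 = p + d * (c 4 + 1) + c 4 \<and> nmem s' 24 = c 12 + num c (p + d * (c 4 + 1)) (c 4) \<and>
           nmem s' 26 = d \<and> nmem s' 31 = nmem s 31"])
      subgoal using I1 assms(3)
        by (intro runs_IfLess runs_atomic) (auto simp: I_def env_simps env_low[of c] env_high[of c] fclosed_def)
       apply (rule runs_seq_atomic runs_atomic)+
      using I1 assms env_const[OF e1] by (auto simp: I_def env_simps env_low[of c] fclosed_def O'_def)
  qed (simp add: I_def env_low[of c])
  have "runs R e override_point s (1 + (c 9 * ((6 * c 4 + 10) + 1) + 1)) (I (c 9))"
    unfolding override_point_def seqs.simps
    apply (rule runs_seq_atomic loop[unfolded seqs.simps])+
    using assms by (auto simp: I_def env_simps fclosed_def O'_def)
  then show ?thesis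
    by (rule runs_mono) (auto simp: I_def O'_def)
qed

lemma runs_emit_point:
  assumes "env c s" "fclosed R s" "c 13 = c 12 + n" "2 \<le> c 12"
  shows "runs R e emit_point s (2 + n * 4) (\<lambda>s'. env c s' \<and> fclosed R s' \<and>
     outp s' = outp s @ map (\<lambda>k. fmem s (c 12 + k)) [0..<n] \<and> nmem s' 31 = nmem s 31)"
proof -
  define I where "I i s' \<longleftrightarrow> env c s' \<and> fclosed R s' \<and> nmem s' 24 = c 12 + i \<and>
     (\<forall>x\<ge>2. fmem s' x = fmem s x) \<and> outp s' = outp s @ map (\<lambda>k. fmem s (c 12 + k)) [0..<i] \<and>
     nmem s' 31 = nmem s 31" for i s'
  have loop: "runs R e (WhileLess 24 13 (seqs [FLoad 0 24, Emit 0, NAdd 24 24 10])) s' (n * (3 + 1) + 1) (I n)"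
    if "I 0 s'" for s'
  proof (rule runs_WhileLess[where I = I, OF that])
    fix i s1 assume i: "i < n" and I1: "I i s1"
    show "nmem s1 24 < nmem s1 13" using i I1 assms by (simp add: I_def env_low[of c])
    show "runs R e (seqs [FLoad 0 24, Emit 0, NAdd 24 24 10]) s1 3 (I (Suc i))"
      unfolding seqs.simps
      apply (rule runs_time)
       apply (rule runs_seq_atomic runs_atomic)+
      using I1 assms env_const[OF assms(1)] by (auto simp: I_def env_simps env_low[of c] fclosed_def)
  qed (use assms in \<open>simp add: I_def env_low[of c]\<close>)
  have "runs R e emit_point s (1 + (n * (3 + 1) + 1)) (I n)"
    unfolding emit_point_def seqs.simps
    apply (rule runs_seq_atomic loop[unfolded seqs.simps])+
    using assms by (auto simp: I_def env_simps env_low[of c] fclosed_def)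
  then show ?thesis
    by (rule runs_mono) (auto simp: I_def)
qed

end

section \<open>Enumeration of the seeds\<close>

text \<open>Register 8 holds the address of the cell after the seed. The counter carries into it
  only after the last seed, and its copy in register 31 stops the enumeration.\<close>

definition process_seed :: com where
  "process_seed = seqs [NAdd 20 16 11, build_tables, fill_point, override_point, emit_point, next_seed,
     NLoad 31 8]"

definition enumerate_seeds :: com where
  "enumerate_seeds = seqs [NConst 31 0, WhileLess 31 10 process_seed]"

text \<open>The numbers of bits of the multipliers \<open>\<alpha>\<close>, of the base point \<open>t\<close>, of the part of the seed for one
  block and of the whole seed.\<close>

definition mul_bits :: "nat \<Rightarrow> nat \<Rightarrow> nat" where
  "mul_bits k L = 22 * k * L"

definition base_bits :: "nat \<Rightarrow> nat \<Rightarrow> nat" where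
  "base_bits k L = 24 * k * L\<^sup>2"

definition block_bits :: "nat \<Rightarrow> nat \<Rightarrow> nat" where
  "block_bits k L = base_bits k L + L * mul_bits k L"

definition seed_bits :: "nat \<Rightarrow> nat \<Rightarrow> nat \<Rightarrow> nat" where
  "seed_bits m k L = 100 * (m * k * L\<^sup>2)"

definition params :: "nat \<Rightarrow> nat \<Rightarrow> nat \<Rightarrow> nat \<Rightarrow> (nat \<Rightarrow> nat) \<Rightarrow> bool" where
  "params n m k L c \<longleftrightarrow> c 3 = m \<and> c 4 = L \<and> c 5 = 2 ^ L \<and> c 6 = mul_bits k L \<and> c 7 = base_bits k L \<and>
     c 8 = 100 + seed_bits m k L \<and> c 9 = m * k \<and> c 10 = 1 \<and> c 11 = 0 \<and>
     c 12 = 10 + 2 * m * 2 ^ L \<and> c 13 = c 12 + n \<and> c 14 = 10 \<and> c 15 = 2 * m \<and> c 16 = 100"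

definition rows :: "nat \<Rightarrow> nat \<Rightarrow> nat" where
  "rows n m = (n + m - 1) div m"

lemma rows:
  assumes "0 < m"
  shows "n \<le> rows n m * m" "i < rows n m \<Longrightarrow> i * m < n" "rows n m \<le> n"
proof -
  show "n \<le> rows n m * m"
    using assms div_mult_mod_eq[of "n + m - 1" m] mod_less_divisor[OF assms, of "n + m - 1"]
    unfolding rows_def by linarith
  show "i * m < n" if "i < rows n m"
  proof -
    have "Suc i * m \<le> rows n m * m" using that by (intro mult_le_mono1) simp
    also have "\<dots> \<le> n + m - 1" unfolding rows_def by (rule div_times_less_eq_dividend)
    finally show ?thesis using assms by simp
  qed
  show "rows n m \<le> n"
  proof (cases "n = 0")
    case False
    have "n + m - 1 \<le> n * m"
      using False assms by (cases n; cases m) auto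
    then show ?thesis unfolding rows_def using assms div_le_mono[of "n + m - 1" "n * m" m] by simp
  qed (use assms in \<open>simp add: rows_def\<close>)
qed

definition seed_base :: "nat \<Rightarrow> nat \<Rightarrow> (nat \<Rightarrow> nat) \<Rightarrow> nat \<Rightarrow> nat" where
  "seed_base k L c b = num c (100 + b * block_bits k L) (base_bits k L)"

definition seed_mul :: "nat \<Rightarrow> nat \<Rightarrow> (nat \<Rightarrow> nat) \<Rightarrow> nat \<Rightarrow> nat \<Rightarrow> nat" where
  "seed_mul k L c b j = num c (100 + b * block_bits k L + base_bits k L + j * mul_bits k L) (mul_bits k L)"

definition seed_shift :: "nat \<Rightarrow> nat \<Rightarrow> nat \<Rightarrow> (nat \<Rightarrow> nat) \<Rightarrow> nat \<Rightarrow> nat" where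
  "seed_shift m k L c i = num c (100 + 2 * m * block_bits k L + i * L) L"

definition seed_var :: "nat \<Rightarrow> nat \<Rightarrow> nat \<Rightarrow> nat \<Rightarrow> (nat \<Rightarrow> nat) \<Rightarrow> nat \<Rightarrow> nat" where
  "seed_var n m k L c d = num c (100 + 2 * m * block_bits k L + rows n m * L + d * (L + 1)) L"

definition seed_val :: "nat \<Rightarrow> nat \<Rightarrow> nat \<Rightarrow> nat \<Rightarrow> (nat \<Rightarrow> nat) \<Rightarrow> nat \<Rightarrow> nat" where
  "seed_val n m k L c d = c (100 + 2 * m * block_bits k L + rows n m * L + d * (L + 1) + L)"

definition block_point :: "('a, 'b) ring_scheme \<Rightarrow> (nat \<Rightarrow> 'a) \<Rightarrow> nat \<Rightarrow> nat \<Rightarrow> (nat \<Rightarrow> nat) \<Rightarrow>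
    (nat \<Rightarrow> nat) \<Rightarrow> (nat \<Rightarrow> nat \<Rightarrow> nat) \<Rightarrow> nat \<Rightarrow> 'a" where
  "block_point R e m L s t \<alpha> v =
     e (t (blk m s v)) [^]\<^bsub>R\<^esub> (weights (\<alpha> (blk m s v)) L ! (v div m))"

definition seed_point :: "('a, 'b) ring_scheme \<Rightarrow> (nat \<Rightarrow> 'a) \<Rightarrow> nat \<Rightarrow> nat \<Rightarrow> nat \<Rightarrow> nat \<Rightarrow> (nat \<Rightarrow> nat) \<Rightarrow> nat \<Rightarrow> 'a" where
  "seed_point R e n m k L c =
     overrides R (block_point R e m L (seed_shift m k L c) (seed_base k L c) (seed_mul k L c))
       (seed_var n m k L c) (seed_val n m k L c) (m * k)"

text \<open>Shifts occupy \<open>L\<close> bits and can reach \<open>m\<close> or more. Seeds with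
  such shifts still yield points over the field, but nothing else is claimed about them.\<close>

definition seed_ok :: "nat \<Rightarrow> nat \<Rightarrow> nat \<Rightarrow> nat \<Rightarrow> (nat \<Rightarrow> nat) \<Rightarrow> bool" where
  "seed_ok n m k L c \<longleftrightarrow> (\<forall>i<rows n m. seed_shift m k L c i < m)"

lemma overrides_cong: "x i = y i \<Longrightarrow> overrides R x vs ys d i = overrides R y vs ys d i"
  by (induction d) auto

definition seed_time :: "nat \<Rightarrow> nat \<Rightarrow> nat \<Rightarrow> nat \<Rightarrow> nat" where
  "seed_time n m k L = 13 + 2 * m * (table_time L (mul_bits k L) (base_bits k L) + 1) +
     rows n m * (6 * L + 9 + 3 * 2 ^ L + 6 * m) + m * k * (6 * L + 11) + 4 * n + 4 * 2 ^ seed_bits m k L"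

context field
begin

lemma runs_process_seed:
  assumes P: "params n m k L c0" and "0 < m" "n \<le> 2 ^ L" "range e \<subseteq> carrier R"
    and "env (seed_env c0 V) s" "fclosed R s" "V < 2 ^ seed_bits m k L"
  shows "runs R e process_seed s (seed_time n m k L) (\<lambda>s'. env (seed_env c0 (Suc V)) s' \<and> fclosed R s' \<and>
     nmem s' 31 = of_bool (bit (Suc V) (seed_bits m k L)) \<and>
     (\<exists>x. outp s' = outp s @ x \<and> length x = n \<and> set x \<subseteq> carrier R \<and>
        (seed_ok n m k L (seed_env c0 V) \<longrightarrow> x = map (seed_point R e n m k L (seed_env c0 V)) [0..<n])))"
proof -
  define c where "c = seed_env c0 V"
  have c: "c 3 = m" "c 4 = L" "c 5 = 2 ^ L" "c 6 = mul_bits k L" "c 7 = base_bits k L"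
     "c 8 = 100 + seed_bits m k L" "c 9 = m * k" "c 10 = 1" "c 11 = 0"
     "c 12 = 10 + 2 * m * 2 ^ L" "c 13 = c 12 + n" "c 14 = 10" "c 15 = 2 * m" "c 16 = 100"
    using P by (auto simp: c_def seed_env_def params_def)
  have bits: "bits c" by (auto simp: bits_def c_def seed_env_def)
  have env: "env c s" using assms(5) by (simp add: c_def)
  note rw = rows[OF assms(2), where n = n]
  define p1 where "p1 = 100 + 2 * m * block_bits k L"
  define p2 where "p2 = p1 + rows n m * L"
  define s1 where "s1 = s\<lparr>nmem := (nmem s)(20 := nmem s 16 + nmem s 11)\<rparr>"
  have s1: "env c s1" "fclosed R s1" "nmem s1 20 = 100" "outp s1 = outp s"
    using env assms(6) c by (simp_all add: s1_def env_simps env_low[of c] fclosed_def)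
  \<comment> \<open>\<open>BT\<close>, \<open>Y\<close>, \<open>W\<close> and \<open>U\<close>
    describe the state after the tables, the block point, the Boolean overrides and the output,
    respectively.\<close>
  define BT where "BT = (\<lambda>s'. env c s' \<and> fclosed R s' \<and> nmem s' 20 = p1 \<and> outp s' = outp s \<and>
     (\<forall>b<2 * m. \<forall>i<2 ^ L. fmem s' (10 + b * 2 ^ L + i) =
        e (seed_base k L c b) [^] (weights (seed_mul k L c b) L ! i)))"
  have r1: "runs R e build_tables s1 (3 + 2 * m * (table_time L (mul_bits k L) (base_bits k L) + 1)) BT"
  proof -
    have c5: "c 5 = 2 ^ c 4" using c by simp
    have "runs R e build_tables s1 (3 + c 15 * (table_time (c 4) (c 6) (c 7) + 1)) BT"
      by (rule runs_mono[OF runs_build_tables[OF s1(1,2) bits order_refl s1(3) c5 c(12) assms(4)] _ order_refl])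
        (auto simp: BT_def p1_def block_bits_def seed_base_def seed_mul_def[abs_def] c s1(4))
    then show ?thesis using c by simp
  qed
  define Y where "Y = (\<lambda>s'. env c s' \<and> fclosed R s' \<and> nmem s' 20 = p2 \<and> outp s' = outp s \<and>
     (seed_ok n m k L c \<longrightarrow> (\<forall>v<n. fmem s' (c 12 + v) =
        block_point R e m L (seed_shift m k L c) (seed_base k L c) (seed_mul k L c) v)))"
  have r2: "runs R e fill_point s2 (3 + rows n m * (6 * L + 9 + 3 * 2 ^ L + 6 * m)) Y" if BT: "BT s2" for s2
  proof -
    have x: "env c s2" "fclosed R s2" "100 \<le> p1" "nmem s2 20 = p1" using BT by (auto simp: BT_def p1_def)
    have n: "c 12 = 10 + 2 * c 3 * 2 ^ L" "n \<le> rows n m * c 3" "\<forall>i<rows n m. i * c 3 < n"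
      "rows n m \<le> 2 ^ L" using rw assms(3) c by auto
    have "runs R e fill_point s2 (3 + rows n m * (6 * c 4 + 9 + 3 * 2 ^ c 4 + 6 * c 3)) Y"
    proof (rule runs_mono[OF runs_fill_point[OF x(1,2) bits x(3,4) n(1) c(3,12,11) n(2-4)] _ order_refl], elim conjE)
      fix s3
      assume s3: "env c s3" "fclosed R s3" "nmem s3 20 = p1 + rows n m * c 4"
        "\<forall>v<n. num c (p1 + v div c 3 * c 4) (c 4) < c 3 \<longrightarrow>
        fmem s3 (c 12 + v) = fmem s2 (10 + (num c (p1 + v div c 3 * c 4) (c 4) + v mod c 3) * 2 ^ L + v div c 3)"
        "outp s3 = outp s2"
      have "fmem s3 (c 12 + v) = block_point R e m L (seed_shift m k L c) (seed_base k L c) (seed_mul k L c) v"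
        if ok: "seed_ok n m k L c" and v: "v < n" for v
      proof -
        have row: "v div m < rows n m" using v rw(1) by (metis less_le_trans less_mult_imp_div_less)
        have \<sigma>: "num c (p1 + v div m * L) L = seed_shift m k L c (v div m)"
          by (simp add: seed_shift_def p1_def)
        have lt: "seed_shift m k L c (v div m) < m" using ok row by (simp add: seed_ok_def)
        then have "blk m (seed_shift m k L c) v < 2 * m"
          using mod_less_divisor[OF assms(2), of v] unfolding blk_def by linarith
        moreover have "v div m < 2 ^ L" using row n(4) by simp
        moreover have "fmem s3 (c 12 + v) = fmem s2 (10 + blk m (seed_shift m k L c) v * 2 ^ L + v div m)"
          using s3(4) v lt c \<sigma> by (simp add: blk_def)
        ultimately show ?thesis using BT by (simp add: BT_def block_point_def)
      qed
      then show "Y s3" using s3 BT c by (simp add: Y_def BT_def p2_def)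
    qed
    then show ?thesis using c by simp
  qed
  define W where "W = (\<lambda>s'. env c s' \<and> fclosed R s' \<and> outp s' = outp s \<and>
     (seed_ok n m k L c \<longrightarrow> (\<forall>v<n. fmem s' (c 12 + v) = seed_point R e n m k L c v)))"
  have r3: "runs R e override_point s3 (2 + m * k * (6 * L + 11)) W" if Y: "Y s3" for s3
  proof -
    have y: "env c s3" "fclosed R s3" "100 \<le> p2" "nmem s3 20 = p2" using Y by (auto simp: Y_def p2_def p1_def)
    have "2 \<le> c 12" using c by simp
    have "runs R e override_point s3 (2 + c 9 * (6 * c 4 + 11)) W"
    proof (rule runs_mono[OF runs_override_point[OF y \<open>2 \<le> c 12\<close>] _ order_refl], elim conjE)
      fix s4
      assume s4: "env c s4" "fclosed R s4"
        "\<forall>v. fmem s4 (c 12 + v) = overrides R (\<lambda>v. fmem s3 (c 12 + v))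
        (\<lambda>d. num c (p2 + d * (c 4 + 1)) (c 4)) (\<lambda>d. c (p2 + d * (c 4 + 1) + c 4)) (c 9) v"
        "outp s4 = outp s3"
      have "fmem s4 (c 12 + v) = seed_point R e n m k L c v" if "seed_ok n m k L c" "v < n" for v
      proof -
        have pt: "fmem s3 (c 12 + v) = block_point R e m L (seed_shift m k L c) (seed_base k L c) (seed_mul k L c) v"
          using Y that by (simp add: Y_def)
        have sv: "seed_var n m k L c = (\<lambda>d. num c (p2 + d * (L + 1)) L)"
          "seed_val n m k L c = (\<lambda>d. c (p2 + d * (L + 1) + L))"
          by (auto simp: seed_var_def seed_val_def p2_def p1_def)
        show ?thesis
          unfolding s4(3)[rule_format] seed_point_def sv c(2) c(7) by (rule overrides_cong) (rule pt)
      qed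
      then show "W s4" using s4 Y by (simp add: W_def Y_def)
    qed
    then show ?thesis using c by simp
  qed
  define U where "U = (\<lambda>s'. env c s' \<and> fclosed R s' \<and> (\<exists>x. outp s' = outp s @ x \<and> length x = n \<and>
     set x \<subseteq> carrier R \<and> (seed_ok n m k L c \<longrightarrow> x = map (seed_point R e n m k L c) [0..<n])))"
  have r4: "runs R e emit_point s4 (2 + n * 4) U" if W: "W s4" for s4
  proof -
    have w: "env c s4" "fclosed R s4" "2 \<le> c 12" using W c by (auto simp: W_def)
    show ?thesis
    proof (rule runs_mono[OF runs_emit_point[OF w(1,2) c(11) w(3)] _ order_refl], elim conjE)
      fix s5
      assume s5: "env c s5" "fclosed R s5" "outp s5 = outp s4 @ map (\<lambda>k. fmem s4 (c 12 + k)) [0..<n]"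
      then show "U s5"
        using W unfolding U_def
        by (intro conjI exI[of _ "map (\<lambda>k. fmem s4 (c 12 + k)) [0..<n]"]) (auto simp: W_def fclosed_def)
    qed
  qed
  have r5: "runs R e (Seq next_seed (NLoad 31 8)) s5 (4 * V + 4 + 1) (\<lambda>s'. env (seed_env c0 (Suc V)) s' \<and> fclosed R s' \<and>
     nmem s' 31 = of_bool (bit (Suc V) (seed_bits m k L)) \<and>
     (\<exists>x. outp s' = outp s @ x \<and> length x = n \<and> set x \<subseteq> carrier R \<and>
        (seed_ok n m k L c \<longrightarrow> x = map (seed_point R e n m k L c) [0..<n])))" if U: "U s5" for s5
  proof (rule runs_Seq[OF runs_next_seed[where c = c0 and V = V]])
    show "env (seed_env c0 V) s5" using U by (simp add: U_def c_def)
    show "c0 16 = 100" using P by (simp add: params_def)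
    fix s6
    assume "env (seed_env c0 (Suc V)) s6 \<and> fmem s6 = fmem s5 \<and> outp s6 = outp s5 \<and> nmem s6 31 = nmem s5 31"
    moreover from this have "nmem s6 8 = 100 + seed_bits m k L"
      using P env_low[of "seed_env c0 (Suc V)" s6 8] by (simp add: seed_env_def params_def)
    ultimately show "runs R e (NLoad 31 8) s6 1 (\<lambda>s'. env (seed_env c0 (Suc V)) s' \<and> fclosed R s' \<and>
     nmem s' 31 = of_bool (bit (Suc V) (seed_bits m k L)) \<and>
     (\<exists>x. outp s' = outp s @ x \<and> length x = n \<and> set x \<subseteq> carrier R \<and>
        (seed_ok n m k L c \<longrightarrow> x = map (seed_point R e n m k L c) [0..<n])))"
      using U env_high[of "seed_env c0 (Suc V)" s6 "100 + seed_bits m k L"]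
      by (intro runs_atomic) (auto simp: U_def env_simps fclosed_def seed_env_def)
  qed
  show ?thesis
    unfolding c_def[symmetric] process_seed_def seqs.simps
    apply (rule runs_time)
     apply (rule runs_seq_atomic)
     apply (fold s1_def)
     apply (rule runs_Seq[OF r1])
     apply (rule runs_Seq[OF r2], assumption)
     apply (rule runs_Seq[OF r3], assumption)
     apply (rule runs_Seq[OF r4], assumption)
     apply (rule r5, assumption)
    using assms(7) by (simp add: seed_time_def)
qed

lemma runs_enumerate_seeds:
  assumes P: "params n m k L c" and "0 < m" "n \<le> 2 ^ L" "range e \<subseteq> carrier R"
    and "env (seed_env c 0) s" "fclosed R s" "outp s = []"
  shows "runs R e enumerate_seeds s (2 + 2 ^ seed_bits m k L * (seed_time n m k L + 1)) (\<lambda>s'.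
     \<exists>pts. outp s' = concat pts \<and> length pts = 2 ^ seed_bits m k L \<and>
       (\<forall>x\<in>set pts. length x = n \<and> set x \<subseteq> carrier R) \<and>
       (\<forall>V<2 ^ seed_bits m k L. seed_ok n m k L (seed_env c V) \<longrightarrow>
          pts ! V = map (seed_point R e n m k L (seed_env c V)) [0..<n]))"
proof -
  define G where "G = seed_bits m k L"
  define I where "I V s' \<longleftrightarrow> env (seed_env c V) s' \<and> fclosed R s' \<and> nmem s' 31 = of_bool (bit V G) \<and>
     (\<exists>pts. outp s' = concat pts \<and> length pts = V \<and> (\<forall>x\<in>set pts. length x = n \<and> set x \<subseteq> carrier R) \<and>
       (\<forall>V'<V. seed_ok n m k L (seed_env c V') \<longrightarrow>
          pts ! V' = map (seed_point R e n m k L (seed_env c V')) [0..<n]))" for V s'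
  have one: "nmem s' 10 = 1" if "I V s'" for V s' using that by (auto simp: I_def env_10)
  have loop: "runs R e (WhileLess 31 10 process_seed) s' (2 ^ G * (seed_time n m k L + 1) + 1) (I (2 ^ G))"
    if "I 0 s'" for s'
  proof (rule runs_WhileLess[where I = I, OF that])
    fix V s1 assume V: "V < 2 ^ G" and I1: "I V s1"
    have "\<not> bit V G" using V by (simp add: bit_iff_odd)
    then show "nmem s1 31 < nmem s1 10" using I1 one[OF I1] by (simp add: I_def)
    have h: "env (seed_env c V) s1" "fclosed R s1" "V < 2 ^ seed_bits m k L"
      using I1 V by (auto simp: I_def G_def)
    obtain pts where pts: "outp s1 = concat pts" "length pts = V" "\<forall>x\<in>set pts. length x = n \<and> set x \<subseteq> carrier R"
       "\<forall>V'<V. seed_ok n m k L (seed_env c V') \<longrightarrow>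
          pts ! V' = map (seed_point R e n m k L (seed_env c V')) [0..<n]" using I1 by (auto simp: I_def)
    show "runs R e process_seed s1 (seed_time n m k L) (I (Suc V))"
    proof (rule runs_mono[OF runs_process_seed[OF P assms(2-4) h] _ order_refl], elim conjE exE)
      fix s2 x
      assume s2: "env (seed_env c (Suc V)) s2" "fclosed R s2" "nmem s2 31 = of_bool (bit (Suc V) (seed_bits m k L))"
        "outp s2 = outp s1 @ x" "length x = n" "set x \<subseteq> carrier R"
        "seed_ok n m k L (seed_env c V) \<longrightarrow> x = map (seed_point R e n m k L (seed_env c V)) [0..<n]"
      show "I (Suc V) s2"
        unfolding I_def
      proof (intro conjI exI[of _ "pts @ [x]"])
        show "\<forall>V'<Suc V. seed_ok n m k L (seed_env c V') \<longrightarrow>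
          (pts @ [x]) ! V' = map (seed_point R e n m k L (seed_env c V')) [0..<n]"
          using pts(2,4) s2(7) by (auto simp: nth_append less_Suc_eq)
      qed (use s2 pts in \<open>auto simp: G_def\<close>)
    qed
  next
    fix s1 assume I1: "I (2 ^ G) s1"
    have "bit ((2::nat) ^ G) G" by (simp add: bit_iff_odd)
    then show "\<not> nmem s1 31 < nmem s1 10" using I1 one[OF I1] by (simp add: I_def)
  qed
  have "runs R e enumerate_seeds s (1 + (2 ^ G * (seed_time n m k L + 1) + 1)) (I (2 ^ G))"
    unfolding enumerate_seeds_def seqs.simps
    apply (rule runs_seq_atomic loop)+
    using assms(5-7) by (auto simp: I_def env_simps fclosed_def)
  then show ?thesis
    by (rule runs_mono) (auto simp: I_def G_def)
qed

end

section \<open>Computing the parameters from the input\<close>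

definition mult_into :: "nat \<Rightarrow> nat \<Rightarrow> nat \<Rightarrow> com" where
  "mult_into z x y = seqs [NConst 21 0, NConst 22 0,
     WhileLess 22 x (seqs [NAdd 21 21 y, NAdd 22 22 10]), NAdd z 21 11]"

definition upd :: "'a machine \<Rightarrow> nat \<Rightarrow> nat \<Rightarrow> 'a machine \<Rightarrow> bool" where
  "upd s z v s' \<longleftrightarrow> nmem s' z = v \<and> (\<forall>r. r \<notin> {21, 22, z} \<longrightarrow> nmem s' r = nmem s r) \<and>
     fmem s' = fmem s \<and> outp s' = outp s"

text \<open>Repeated addition takes time linear in the first factor. Bounding that factor by
  \<open>B\<close> lets all products of one computation share a time bound.\<close>

lemma runs_mult_into:
  fixes s :: "'a machine"
  assumes "nmem s 10 = 1" "nmem s 11 = 0" "x \<notin> {21, 22}" "y \<notin> {21, 22}"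
    and "nmem s x = vx" "nmem s y = vy" "vx \<le> B"
  shows "runs R e (mult_into z x y) s (3 * B + 4) (upd s z (vx * vy))"
proof -
  define I where "I i s' \<longleftrightarrow> nmem s' 21 = i * vy \<and> nmem s' 22 = i \<and>
     (\<forall>r. r \<notin> {21, 22} \<longrightarrow> nmem s' r = nmem s r) \<and> fmem s' = fmem s \<and> outp s' = outp s"
    for i and s' :: "'a machine"
  have loop: "runs R e (WhileLess 22 x (seqs [NAdd 21 21 y, NAdd 22 22 10])) s' (vx * (2 + 1) + 1) (I vx)"
    if "I 0 s'" for s'
  proof (rule runs_WhileLess[where I = I, OF that])
    fix i s1 assume i: "i < vx" and I1: "I i s1"
    show "nmem s1 22 < nmem s1 x" using i I1 assms by (simp add: I_def)
    show "runs R e (seqs [NAdd 21 21 y, NAdd 22 22 10]) s1 2 (I (Suc i))"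
      unfolding seqs.simps
      apply (rule runs_time)
       apply (rule runs_seq_atomic runs_atomic)+
      using I1 assms by (auto simp: I_def)
  qed (use assms in \<open>simp add: I_def\<close>)
  have "runs R e (mult_into z x y) s (1 + (1 + (vx * (2 + 1) + 1 + 1))) (upd s z (vx * vy))"
    unfolding mult_into_def seqs.simps
    apply (rule runs_seq_atomic)
    apply (rule runs_seq_atomic)
    apply (rule runs_Seq[OF loop[unfolded seqs.simps]])
    subgoal using assms by (simp add: I_def)
    apply (rule runs_atomic)
    using assms by (auto simp: I_def upd_def)
  then show ?thesis by (rule runs_time) (use assms(7) in simp)
qed

lemma seq_mult:
  assumes "nmem s 10 = 1" "nmem s 11 = 0" "x \<notin> {21, 22}" "y \<notin> {21, 22}"
    and "nmem s x = vx" "nmem s y = vy" "vx \<le> B"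
    and "\<And>s'. upd s z (vx * vy) s' \<Longrightarrow> runs R e q s' T Q"
  shows "runs R e (Seq (mult_into z x y) q) s (3 * B + 4 + T) Q"
  by (rule runs_Seq[OF runs_mult_into[OF assms(1-7)] assms(8)])

lemma seq_add:
  assumes "nmem s x = vx" "nmem s y = vy" "\<And>s'. upd s z (vx + vy) s' \<Longrightarrow> runs R e q s' T Q"
  shows "runs R e (Seq (NAdd z x y) q) s (1 + T) Q"
  by (rule runs_seq_atomic, rule assms(3)) (use assms(1,2) in \<open>auto simp: upd_def\<close>)

lemma seq_const:
  assumes "\<And>s'. upd s z vx s' \<Longrightarrow> runs R e q s' T Q"
  shows "runs R e (Seq (NConst z vx) q) s (1 + T) Q"
  by (rule runs_seq_atomic, rule assms) (auto simp: upd_def)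

text \<open>The loop test is a strict inequality, so \<open>x + 1\<close> is stored in register 24;
  doubling then stops at the first power of two above \<open>x\<close>.\<close>

definition log_loop :: "nat \<Rightarrow> nat \<Rightarrow> nat \<Rightarrow> com" where
  "log_loop x a b = seqs [NConst a 0, NConst b 1, NAdd 24 x 10,
     WhileLess b 24 (seqs [NAdd b b b, NAdd a a 10])]"

text \<open>The strict inequality gives \<open>n\<close> itself a code of \<open>num_bits n\<close>
  digits, next to the variables below \<open>n\<close>; it later serves as a dummy variable.\<close>

definition num_bits :: "nat \<Rightarrow> nat" where
  "num_bits n = (LEAST L. n < 2 ^ L)"

lemma num_bits: "n < 2 ^ num_bits n" "i < num_bits n \<Longrightarrow> 2 ^ i \<le> n" "num_bits n \<le> n"
proof -
  show "n < 2 ^ num_bits n" unfolding num_bits_def using less_exp[of n] by (rule LeastI)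
  show "2 ^ i \<le> n" if "i < num_bits n"
    using that not_less_Least[of i "\<lambda>L. n < 2 ^ L"] by (auto simp: num_bits_def)
  show "num_bits n \<le> n" unfolding num_bits_def using less_exp[of n] by (rule Least_le)
qed

lemma num_bits_pos: "0 < n \<Longrightarrow> 0 < num_bits n"
  using num_bits(1)[of n] by (cases "num_bits n") auto

lemma runs_log_loop:
  fixes s :: "'a machine"
  assumes "nmem s 10 = 1" "distinct [x, a, b, 10, 24]"
  shows "runs R e (log_loop x a b) s (3 * nmem s x + 4) (\<lambda>s'. nmem s' a = num_bits (nmem s x) \<and>
     nmem s' b = 2 ^ num_bits (nmem s x) \<and> (\<forall>r. r \<notin> {a, b, 24} \<longrightarrow> nmem s' r = nmem s r) \<and>
     fmem s' = fmem s \<and> outp s' = outp s)"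
proof -
  define L where "L = num_bits (nmem s x)"
  define I where "I i s' \<longleftrightarrow> nmem s' a = i \<and> nmem s' b = 2 ^ i \<and> nmem s' 24 = nmem s x + 1 \<and>
     (\<forall>r. r \<notin> {a, b, 24} \<longrightarrow> nmem s' r = nmem s r) \<and> fmem s' = fmem s \<and> outp s' = outp s"
    for i and s' :: "'a machine"
  have loop: "runs R e (WhileLess b 24 (seqs [NAdd b b b, NAdd a a 10])) s' (L * (2 + 1) + 1) (I L)"
    if "I 0 s'" for s'
  proof (rule runs_WhileLess[where I = I, OF that])
    fix i s1 assume i: "i < L" and I1: "I i s1"
    show "nmem s1 b < nmem s1 24" using I1 num_bits(2)[of i "nmem s x"] i by (simp add: I_def L_def)
    show "runs R e (seqs [NAdd b b b, NAdd a a 10]) s1 2 (I (Suc i))"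
      unfolding seqs.simps
      apply (rule runs_time)
       apply (rule runs_seq_atomic runs_atomic)+
      using I1 assms by (auto simp: I_def)
  next
    fix s1 assume "I L s1"
    then show "\<not> nmem s1 b < nmem s1 24" using num_bits(1)[of "nmem s x"] by (simp add: I_def L_def)
  qed
  have "runs R e (log_loop x a b) s (1 + (1 + (1 + (L * (2 + 1) + 1)))) (I L)"
    unfolding log_loop_def seqs.simps
    apply (rule runs_seq_atomic loop[unfolded seqs.simps])+
    using assms by (auto simp: I_def)
  then show ?thesis
    by (rule runs_mono) (use num_bits(3)[of "nmem s x"] in \<open>auto simp: I_def L_def\<close>)
qed

definition set_params :: com where
  "set_params = seqs [log_loop 0 4 5, mult_into 25 2 4, NConst 26 22, mult_into 6 26 25,
     mult_into 27 25 4, NConst 26 24, mult_into 7 26 27, mult_into 28 3 27, NConst 26 100,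
     mult_into 28 26 28, NConst 16 100, NAdd 8 28 16, mult_into 9 3 2, NAdd 15 3 3,
     mult_into 28 15 5, NConst 14 10, NAdd 12 28 14, NAdd 13 12 0]"

definition ready :: "('a, 'b) ring_scheme \<Rightarrow> nat \<Rightarrow> nat \<Rightarrow> nat \<Rightarrow> 'a machine \<Rightarrow> bool" where
  "ready R n m k s \<longleftrightarrow> nmem s 0 = n \<and> nmem s 2 = k \<and> nmem s 3 = m \<and> nmem s 10 = 1 \<and> nmem s 11 = 0 \<and>
     (\<forall>r\<ge>100. nmem s r = 0) \<and> fclosed R s \<and> outp s = []"

lemma runs_set_params:
  fixes s :: "'a machine"
  assumes "ready R n m k s" "0 < n"
  defines "L \<equiv> num_bits n"
  defines "B \<equiv> 100 + k * L + 2 * m"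
  shows "runs R e set_params s (3 * n + 45 + 24 * B) (\<lambda>s'. fclosed R s' \<and> outp s' = [] \<and>
     (\<exists>c. params n m k L c \<and> env (seed_env c 0) s'))"
proof -
  have s: "nmem s 0 = n" "nmem s 2 = k" "nmem s 3 = m" "nmem s 10 = 1" "nmem s 11 = 0"
    "\<And>r. r \<ge> 100 \<Longrightarrow> nmem s r = 0" "fclosed R s" "outp s = []"
    using assms(1) by (auto simp: ready_def)
  have "0 < L" using assms(2) by (simp add: L_def num_bits_pos)
  then have "k \<le> k * L" by simp
  \<comment> \<open>\<open>B\<close> majorizes the first factor of every product in
    \<open>set_params\<close>, where the potentially large numbers \<open>2 ^ L\<close> and
    \<open>k * L * L\<close> always come second.\<close>
  then have B: "k \<le> B" "22 \<le> B" "k * L \<le> B" "24 \<le> B" "m \<le> B" "100 \<le> B" "m + m \<le> B"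
    unfolding B_def by linarith+
  have run: "runs R e set_params s (3 * nmem s 0 + 4 + (3 * B + 4 + (1 + (3 * B + 4 + (3 * B + 4 + (1 + (3 * B + 4 +
    (3 * B + 4 + (1 + (3 * B + 4 + (1 + (1 + (3 * B + 4 + (1 + (3 * B + 4 + (1 + (1 + 1)))))))))))))))))
    (\<lambda>s'. nmem s' 2 = k \<and> nmem s' 3 = m \<and> nmem s' 4 = L \<and> nmem s' 5 = 2 ^ L \<and> nmem s' 6 = 22 * (k * L) \<and>
      nmem s' 7 = 24 * (k * L * L) \<and> nmem s' 8 = 100 * (m * (k * L * L)) + 100 \<and> nmem s' 9 = m * k \<and>
      nmem s' 10 = 1 \<and> nmem s' 11 = 0 \<and> nmem s' 12 = (m + m) * 2 ^ L + 10 \<and>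
      nmem s' 13 = (m + m) * 2 ^ L + 10 + n \<and> nmem s' 14 = 10 \<and> nmem s' 15 = m + m \<and> nmem s' 16 = 100 \<and>
      (\<forall>r\<ge>100. nmem s' r = 0) \<and> fmem s' = fmem s \<and> outp s' = outp s)"
    unfolding set_params_def seqs.simps
    apply (rule runs_Seq[OF runs_log_loop])
    subgoal by (rule s)
    subgoal by simp
    apply (elim conjE)
    apply (unfold s(1) L_def[symmetric])
    subgoal premises p1 for s1
    proof -
      have q: "nmem s1 2 = k" "nmem s1 3 = m" "nmem s1 10 = 1" "nmem s1 11 = 0" "nmem s1 0 = n"
        "\<And>r. r \<ge> 100 \<Longrightarrow> nmem s1 r = 0"
        using p1(3) s by auto
      show ?thesis
        apply (rule seq_mult[where vx = k and vy = L], simp add: q, simp add: q, simp, simp, simp add: q, simp add: p1, rule B)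
        apply (rule seq_const)
        apply (rule seq_mult[where vx = 22 and vy = "k * L"], simp add: upd_def q, simp add: upd_def q, simp, simp, simp add: upd_def, simp add: upd_def, rule B)
        apply (rule seq_mult[where vx = "k * L" and vy = L], simp add: upd_def q, simp add: upd_def q, simp, simp, simp add: upd_def, simp add: upd_def p1, rule B)
        apply (rule seq_const)
        apply (rule seq_mult[where vx = 24 and vy = "k * L * L"], simp add: upd_def q, simp add: upd_def q, simp, simp, simp add: upd_def, simp add: upd_def, rule B)
        apply (rule seq_mult[where vx = m and vy = "k * L * L"], simp add: upd_def q, simp add: upd_def q, simp, simp, simp add: upd_def q, simp add: upd_def, rule B)
        apply (rule seq_const)
        apply (rule seq_mult[where vx = 100 and vy = "m * (k * L * L)"], simp add: upd_def q, simp add: upd_def q, simp, simp, simp add: upd_def, simp add: upd_def, rule B)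
        apply (rule seq_const)
        apply (rule seq_add[where vx = "100 * (m * (k * L * L))" and vy = 100], simp add: upd_def, simp add: upd_def)
        apply (rule seq_mult[where vx = m and vy = k], simp add: upd_def q, simp add: upd_def q, simp, simp, simp add: upd_def q, simp add: upd_def q, rule B)
        apply (rule seq_add[where vx = m and vy = m], simp add: upd_def q, simp add: upd_def q)
        apply (rule seq_mult[where vx = "m + m" and vy = "2 ^ L"], simp add: upd_def q, simp add: upd_def q, simp, simp, simp add: upd_def q, simp add: upd_def p1, rule B)
        apply (rule seq_const)
        apply (rule seq_add[where vx = "(m + m) * 2 ^ L" and vy = 10], simp add: upd_def, simp add: upd_def)
        apply (rule runs_atomic)
        by (simp add: upd_def p1 q s)
    qed
    done
  show ?thesis
  proof (rule runs_mono[OF run])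
    fix s' :: "'a machine"
    assume *: "nmem s' 2 = k \<and> nmem s' 3 = m \<and> nmem s' 4 = L \<and> nmem s' 5 = 2 ^ L \<and> nmem s' 6 = 22 * (k * L) \<and>
      nmem s' 7 = 24 * (k * L * L) \<and> nmem s' 8 = 100 * (m * (k * L * L)) + 100 \<and> nmem s' 9 = m * k \<and>
      nmem s' 10 = 1 \<and> nmem s' 11 = 0 \<and> nmem s' 12 = (m + m) * 2 ^ L + 10 \<and>
      nmem s' 13 = (m + m) * 2 ^ L + 10 + n \<and> nmem s' 14 = 10 \<and> nmem s' 15 = m + m \<and> nmem s' 16 = 100 \<and>
      (\<forall>r\<ge>100. nmem s' r = 0) \<and> fmem s' = fmem s \<and> outp s' = outp s"
    then have "params n m k L (nmem s')"
      by (simp add: params_def mul_bits_def base_bits_def seed_bits_def power2_eq_square)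
    moreover have "env (seed_env (nmem s') 0) s'"
      using * by (simp add: env_def seed_env_def)
    ultimately show "fclosed R s' \<and> outp s' = [] \<and> (\<exists>c. params n m k L c \<and> env (seed_env c 0) s')"
      using * s by (auto simp: fclosed_def)
  qed (simp add: s)
qed

definition cube :: com where
  "cube = seqs [mult_into 27 3 3, mult_into 27 27 3, mult_into 27 27 2]"

text \<open>\<open>k\<close> is the bit length of the size bound, and \<open>m\<close> is found by
  linear search for \<open>n^2 \<le> m^3 * k\<close>, which replaces a cube root.\<close>

definition choose_blocks :: com where
  "choose_blocks = seqs [NConst 10 1, NConst 11 0, log_loop 1 2 25, mult_into 26 0 0, NConst 3 1, cube,
     WhileLess 27 26 (Seq (NAdd 3 3 10) cube)]"

definition choose_rows :: com where
  "choose_rows = seqs [NConst 10 1, NConst 11 0, NConst 2 1, NAdd 3 0 11]"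

definition block_count :: "nat \<Rightarrow> nat \<Rightarrow> nat" where
  "block_count n k = (LEAST m. 0 < m \<and> n\<^sup>2 \<le> m ^ 3 * k)"

lemma block_count:
  assumes "0 < n" "0 < k"
  shows "0 < block_count n k" "n\<^sup>2 \<le> block_count n k ^ 3 * k" "block_count n k \<le> n"
    "0 < i \<Longrightarrow> i < block_count n k \<Longrightarrow> i ^ 3 * k < n\<^sup>2"
proof -
  have "n\<^sup>2 * 1 \<le> n\<^sup>2 * (n * k)" using assms by (intro mult_le_mono2) simp
  then have n: "0 < n \<and> n\<^sup>2 \<le> n ^ 3 * k" using assms by (simp add: power2_eq_square power3_eq_cube ac_simps)
  from LeastI[of "\<lambda>m. 0 < m \<and> n\<^sup>2 \<le> m ^ 3 * k", OF n]
  show "0 < block_count n k" "n\<^sup>2 \<le> block_count n k ^ 3 * k" by (auto simp: block_count_def)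
  show "block_count n k \<le> n" unfolding block_count_def using n by (rule Least_le)
  show "i ^ 3 * k < n\<^sup>2" if "0 < i" "i < block_count n k"
    using that not_less_Least[of i "\<lambda>m. 0 < m \<and> n\<^sup>2 \<le> m ^ 3 * k"] by (auto simp: block_count_def)
qed

lemma runs_cube:
  fixes s :: "'a machine"
  assumes "nmem s 10 = 1" "nmem s 11 = 0" "nmem s 3 = m" "nmem s 2 = k" "m \<le> n"
  shows "runs R e cube s (9 * n ^ 3 + 12) (upd s 27 (m ^ 3 * k))"
proof -
  have "m * m * m \<le> n * n * n" using assms(5) by (intro mult_le_mono)
  moreover have "m \<le> m * m * m" "m * m \<le> m * m * m" by (cases m; simp)+
  ultimately have B: "m \<le> n ^ 3" "m * m \<le> n ^ 3" "m * m * m \<le> n ^ 3"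
    unfolding power3_eq_cube by linarith+
  have "runs R e cube s (3 * n ^ 3 + 4 + (3 * n ^ 3 + 4 + (3 * n ^ 3 + 4))) (upd s 27 (m ^ 3 * k))"
    unfolding cube_def seqs.simps
    apply (rule seq_mult[where vx = m and vy = m], rule assms, rule assms, simp, simp, rule assms, rule assms, rule B)
    apply (rule seq_mult[where vx = "m * m" and vy = m], simp add: upd_def assms, simp add: upd_def assms, simp, simp, simp add: upd_def, simp add: upd_def assms, rule B)
    subgoal for s1 s2
      apply (rule runs_mono[OF runs_mult_into[where vx = "m * m * m" and vy = k and B = "n ^ 3"]])
      using assms B by (auto simp: upd_def power3_eq_cube)
    done
  then show ?thesis by (rule runs_time) simp
qed

lemma runs_choose_blocks:
  fixes s :: "'a machine"
  assumes "nmem s 0 = n" "nmem s 1 = M" "\<And>r. 2 \<le> r \<Longrightarrow> nmem s r = 0" "fclosed R s" "outp s = []" "0 < n" "0 < M"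
  shows "runs R e choose_blocks s (3 * M + 3 * n + n * (9 * n ^ 3 + 14) + 9 * n ^ 3 + 24)
    (ready R n (block_count n (num_bits M)) (num_bits M))"
proof -
  define k where "k = num_bits M"
  define m where "m = block_count n k"
  have k0: "0 < k" using assms(7) by (simp add: k_def num_bits_pos)
  note m = block_count[OF assms(6) k0, folded m_def]
  define base where "base s' \<longleftrightarrow> nmem s' 0 = n \<and> nmem s' 2 = k \<and> nmem s' 10 = 1 \<and> nmem s' 11 = 0 \<and>
     (\<forall>r\<ge>100. nmem s' r = 0) \<and> fclosed R s' \<and> outp s' = []" for s' :: "'a machine"
  define I where "I i s' \<longleftrightarrow> base s' \<and> nmem s' 26 = n * n \<and> nmem s' 3 = Suc i \<and> nmem s' 27 = Suc i ^ 3 * k"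
    for i and s' :: "'a machine"
  have loop: "runs R e (WhileLess 27 26 (Seq (NAdd 3 3 10) cube)) s' ((m - 1) * ((9 * n ^ 3 + 13) + 1) + 1) (I (m - 1))"
    if "I 0 s'" for s'
  proof (rule runs_WhileLess[where I = I, OF that])
    fix i s1 assume i: "i < m - 1" and I1: "I i s1"
    show "nmem s1 27 < nmem s1 26"
      using I1 m(4)[of "Suc i"] i by (simp add: I_def power2_eq_square)
    have "runs R e (Seq (NAdd 3 3 10) cube) s1 (1 + (9 * n ^ 3 + 12)) (I (Suc i))"
      apply (rule seq_add[where vx = "Suc i" and vy = 1])
      subgoal using I1 by (simp add: I_def)
      subgoal using I1 by (simp add: I_def base_def)
      subgoal for s2
        apply (rule runs_mono[OF runs_cube[where m = "Suc (Suc i)" and k = k and n = n]])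
        using I1 i m(3) by (auto simp: I_def base_def upd_def fclosed_def)
      done
    then show "runs R e (Seq (NAdd 3 3 10) cube) s1 (9 * n ^ 3 + 13) (I (Suc i))"
      by (rule runs_time) simp
  next
    fix s1 assume "I (m - 1) s1"
    then show "\<not> nmem s1 27 < nmem s1 26" using m(1,2) by (simp add: I_def power2_eq_square)
  qed
  have "runs R e choose_blocks s (1 + (1 + (3 * M + 4 + (3 * n + 4 + (1 + (9 * n ^ 3 + 12 +
      ((m - 1) * ((9 * n ^ 3 + 13) + 1) + 1))))))) (I (m - 1))"
    unfolding choose_blocks_def seqs.simps
    apply (rule seq_const)
    apply (rule seq_const)
    subgoal premises p for s1 s2
    proof -
      have q: "nmem s2 0 = n" "nmem s2 1 = M" "nmem s2 10 = 1" "nmem s2 11 = 0" "\<And>r. r \<ge> 100 \<Longrightarrow> nmem s2 r = 0"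
         "fmem s2 = fmem s" "outp s2 = []"
        using p assms(1-3,5) by (auto simp: upd_def)
      have "runs R e (log_loop 1 2 25) s2 (3 * nmem s2 1 + 4) base"
        by (rule runs_mono[OF runs_log_loop]) (use q assms(4) in \<open>auto simp: base_def k_def fclosed_def\<close>)
      then have log: "runs R e (log_loop 1 2 25) s2 (3 * M + 4) base" by (simp only: q(2))
      show ?thesis
        apply (rule runs_Seq[OF log])
        subgoal for s3
          apply (rule seq_mult[where vx = n and vy = n], simp add: base_def, simp add: base_def, simp, simp,
              simp add: base_def, simp add: base_def, simp)
          apply (rule seq_const)
          subgoal for s4 s5
            apply (rule runs_Seq[OF runs_cube[where m = 1 and k = k and n = n]])
            using assms(6) apply (simp_all add: base_def upd_def)[5]
            apply (rule loop)
            by (auto simp: I_def base_def upd_def fclosed_def)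
          done
        done
    qed
    done
  then show ?thesis
  proof (rule runs_mono)
    show "ready R n (block_count n (num_bits M)) (num_bits M) s'" if "I (m - 1) s'" for s'
      using that m(1) by (simp add: I_def base_def ready_def m_def k_def)
    have "(m - 1) * (9 * n ^ 3 + 14) \<le> n * (9 * n ^ 3 + 14)" using m(3) by (intro mult_le_mono1) simp
    moreover have "(9 * n ^ 3 + 13) + 1 = 9 * n ^ 3 + 14" by simp
    ultimately show "1 + (1 + (3 * M + 4 + (3 * n + 4 + (1 + (9 * n ^ 3 + 12 + ((m - 1) * ((9 * n ^ 3 + 13) + 1) + 1))))))
        \<le> 3 * M + 3 * n + n * (9 * n ^ 3 + 14) + 9 * n ^ 3 + 24" by presburger
  qed
qed

lemma runs_choose_rows:
  assumes "nmem s 0 = n" "\<And>r. 2 \<le> r \<Longrightarrow> nmem s r = 0" "fclosed R s" "outp s = []"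
  shows "runs R e choose_rows s 4 (ready R n n 1)"
  unfolding choose_rows_def seqs.simps
  apply (rule runs_time)
   apply (rule runs_seq_atomic runs_atomic)+
  using assms by (auto simp: ready_def fclosed_def)

section \<open>Every choice of parameters is the content of a seed\<close>

lemma exists_bits: "\<exists>V<(2::nat) ^ G. \<forall>i<G. bit V i \<longleftrightarrow> \<tau> i"
proof (induction G arbitrary: \<tau>)
  case (Suc G)
  obtain V :: nat where V: "V < 2 ^ G" "\<forall>i<G. bit V i \<longleftrightarrow> \<tau> (Suc i)" using Suc[of "\<lambda>i. \<tau> (Suc i)"] by blast
  have "bit (of_bool (\<tau> 0) + 2 * V) i \<longleftrightarrow> \<tau> i" if "i < Suc G" for i
    using that V(2) by (cases i) (auto simp: bit_0 bit_Suc)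
  moreover have "of_bool (\<tau> 0) + 2 * V < 2 ^ Suc G" using V(1) by auto
  ultimately show ?case by blast
qed simp

lemma num_eq:
  assumes "v < 2 ^ w" "\<And>u. u < w \<Longrightarrow> c (p + u) = of_bool (odd (v div 2 ^ (w - 1 - u)))"
  shows "num c p w = v"
  using assms
proof (induction w arbitrary: v)
  case (Suc w)
  have "num c p w = v div 2"
  proof (rule Suc.IH)
    show "v div 2 < 2 ^ w" using Suc.prems(1) by auto
    show "c (p + u) = of_bool (odd (v div 2 div 2 ^ (w - 1 - u)))" if "u < w" for u
    proof -
      have "Suc w - 1 - u = Suc (w - 1 - u)" using that by simp
      then show ?thesis using Suc.prems(2)[of u] that by (simp add: div_mult2_eq)
    qed
  qed
  moreover have "c (p + w) = v mod 2" using Suc.prems(2)[of w] by (simp add: odd_iff_mod_2_eq_one)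
  ultimately show ?case by simp
qed simp

lemma div_mod_add:
  fixes u w :: nat
  assumes "u < w"
  shows "(b * w + u) div w = b" "(b * w + u) mod w = u"
  using assms by simp_all

text \<open>The constant 100: in units of \<open>m * k * L^2\<close>, the \<open>2 * m\<close>
  blocks take \<open>2 * (24 + 22) = 92\<close>, the shifts at most 2 and the Boolean settings at
  most 2.\<close>

lemma seed_layout:
  assumes "0 < m" "0 < k" "0 < L" "rows n m \<le> 2 * (m * k)"
  shows "2 * m * block_bits k L + rows n m * L + m * k * (L + 1) \<le> seed_bits m k L"
proof -
  have "rows n m * L \<le> 2 * (m * k * L)" using mult_le_mono1[OF assms(4), of L] by simp
  moreover have "m * k * L \<le> m * k * L\<^sup>2" using assms(3) by (simp add: power2_eq_square)
  moreover have "m * k \<le> m * k * L" using assms(3) by simp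
  moreover have "2 * m * block_bits k L = 92 * (m * k * L\<^sup>2)"
    by (simp add: block_bits_def base_bits_def mul_bits_def power2_eq_square algebra_simps)
  moreover have "m * k * (L + 1) = m * k * L + m * k" by simp
  ultimately show ?thesis unfolding seed_bits_def by linarith
qed

lemma exists_seed_number:
  fixes c :: "nat \<Rightarrow> nat"
  assumes pos: "0 < m" "0 < k" "0 < L" "rows n m \<le> 2 * (m * k)" "m \<le> 2 ^ L"
    and s: "\<And>i. s i < m" and t: "\<And>b. t b < 2 ^ base_bits k L" and \<alpha>: "\<And>b j. \<alpha> b j < 2 ^ mul_bits k L"
    and vs: "\<And>d. vs d < 2 ^ L" and ys: "\<And>d. ys d \<le> (1::nat)"
  shows "\<exists>V<2 ^ seed_bits m k L. (\<forall>i<rows n m. seed_shift m k L (seed_env c V) i = s i) \<and>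
    (\<forall>b<2 * m. seed_base k L (seed_env c V) b = t b) \<and>
    (\<forall>b<2 * m. \<forall>j<L. seed_mul k L (seed_env c V) b j = \<alpha> b j) \<and>
    (\<forall>d<m * k. seed_var n m k L (seed_env c V) d = vs d \<and> seed_val n m k L (seed_env c V) d = ys d)"
proof -
  define q \<beta> S where "q = mul_bits k L" and "\<beta> = base_bits k L" and "S = block_bits k L"
  have S: "S = \<beta> + L * q" by (simp add: S_def block_bits_def q_def \<beta>_def)
  define x1 where "x1 = 2 * m * S"
  define x2 where "x2 = x1 + rows n m * L"
  \<comment> \<open>Digit \<open>u\<close> from the top of \<open>v\<close> in width
    \<open>w\<close>, in the order in which \<open>num\<close> reads.\<close>
  define nb where "nb w v u \<longleftrightarrow> odd (v div 2 ^ (w - 1 - u))" for w v u :: nat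
  \<comment> \<open>The intended seed: base point and multipliers of each block up to
    \<open>x1\<close>, shifts up to \<open>x2\<close>, then for each override \<open>L\<close>
    digits of a variable and one digit for its value.\<close>
  define \<tau> where "\<tau> x = (if x < x1 then
       (let b = x div S; u = x mod S in if u < \<beta> then nb \<beta> (t b) u
          else nb q (\<alpha> b ((u - \<beta>) div q)) ((u - \<beta>) mod q))
     else if x < x2 then nb L (s ((x - x1) div L)) ((x - x1) mod L)
     else (let d = (x - x2) div (L + 1); u = (x - x2) mod (L + 1) in if u < L then nb L (vs d) u else ys d = 1))" for x
  obtain V :: nat where V: "V < 2 ^ seed_bits m k L" "\<And>i. i < seed_bits m k L \<Longrightarrow> bit V i \<longleftrightarrow> \<tau> i"
    using exists_bits[of "seed_bits m k L" \<tau>] by blast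
  have total: "x2 + m * k * (L + 1) \<le> seed_bits m k L"
    using seed_layout[OF pos(1-4)] by (simp add: x2_def x1_def S_def)
  have mem: "seed_env c V (100 + x) = of_bool (\<tau> x)" if "x < seed_bits m k L" for x
    using V(2)[OF that] by (simp add: seed_env_def)
  have in1: "b * S + u < x1" if "b < 2 * m" "u < S" for b u
  proof -
    have "b * S + u < Suc b * S" using that(2) by simp
    also have "\<dots> \<le> 2 * m * S" using that(1) by (intro mult_le_mono1) simp
    finally show ?thesis by (simp add: x1_def)
  qed
  have base: "seed_base k L (seed_env c V) b = t b" if b: "b < 2 * m" for b
    unfolding seed_base_def S_def[symmetric] \<beta>_def[symmetric]
  proof (rule num_eq)
    show "t b < 2 ^ \<beta>" using t by (simp add: \<beta>_def)
    fix u assume u: "u < \<beta>"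
    then have uS: "u < S" by (simp add: S)
    have "seed_env c V (100 + (b * S + u)) = of_bool (\<tau> (b * S + u))"
      using in1[OF b uS] total by (intro mem) (simp add: x2_def)
    also have "\<tau> (b * S + u) \<longleftrightarrow> nb \<beta> (t b) u" using in1[OF b uS] uS u by (simp add: \<tau>_def)
    finally show "seed_env c V (100 + b * S + u) = of_bool (odd (t b div 2 ^ (\<beta> - 1 - u)))"
      by (simp add: nb_def add.assoc)
  qed
  have mul: "seed_mul k L (seed_env c V) b j = \<alpha> b j" if b: "b < 2 * m" and j: "j < L" for b j
    unfolding seed_mul_def S_def[symmetric] \<beta>_def[symmetric] q_def[symmetric]
  proof (rule num_eq)
    show "\<alpha> b j < 2 ^ q" using \<alpha> by (simp add: q_def)
    fix u assume u: "u < q"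
    have "j * q + u < Suc j * q" using u by simp
    also have "\<dots> \<le> L * q" using j by (intro mult_le_mono1) simp
    finally have uS: "\<beta> + (j * q + u) < S" by (simp add: S)
    have "seed_env c V (100 + (b * S + (\<beta> + (j * q + u)))) = of_bool (\<tau> (b * S + (\<beta> + (j * q + u))))"
      using in1[OF b uS] total by (intro mem) (simp add: x2_def)
    also have "\<tau> (b * S + (\<beta> + (j * q + u))) \<longleftrightarrow> nb q (\<alpha> b j) u"
    proof -
      have "(b * S + (\<beta> + (j * q + u))) div S = b" "(b * S + (\<beta> + (j * q + u))) mod S = \<beta> + (j * q + u)"
        by (rule div_mod_add[OF uS])+
      moreover have "(j * q + u) div q = j" "(j * q + u) mod q = u" by (rule div_mod_add[OF u])+
      ultimately show ?thesis using in1[OF b uS] by (simp add: \<tau>_def Let_def)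
    qed
    finally show "seed_env c V (100 + b * S + \<beta> + j * q + u) = of_bool (odd (\<alpha> b j div 2 ^ (q - 1 - u)))"
      by (simp add: nb_def add.assoc)
  qed
  have shift: "seed_shift m k L (seed_env c V) i = s i" if i: "i < rows n m" for i
    unfolding seed_shift_def S_def[symmetric] x1_def[symmetric]
  proof (rule num_eq)
    show "s i < 2 ^ L" using s[of i] pos(5) by simp
    fix u assume u: "u < L"
    have "i * L + u < Suc i * L" using u by simp
    also have "\<dots> \<le> rows n m * L" using i by (intro mult_le_mono1) simp
    finally have lt: "i * L + u < rows n m * L" .
    have "seed_env c V (100 + (x1 + (i * L + u))) = of_bool (\<tau> (x1 + (i * L + u)))"
      using lt total by (intro mem) (simp add: x2_def)
    also have "\<tau> (x1 + (i * L + u)) \<longleftrightarrow> nb L (s i) u" using lt u by (simp add: \<tau>_def x2_def)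
    finally show "seed_env c V (100 + x1 + i * L + u) = of_bool (odd (s i div 2 ^ (L - 1 - u)))"
      by (simp add: nb_def add.assoc)
  qed
  have in3: "d * (L + 1) + u < m * k * (L + 1)" if "d < m * k" "u < L + 1" for d u
  proof -
    have "d * (L + 1) + u < Suc d * (L + 1)" using that(2) by simp
    also have "\<dots> \<le> m * k * (L + 1)" using that(1) by (intro mult_le_mono1) simp
    finally show ?thesis .
  qed
  have memd: "seed_env c V (100 + (x2 + (d * (L + 1) + u))) = of_bool (if u < L then nb L (vs d) u else ys d = 1)"
    if "d < m * k" "u < L + 1" for d u
  proof -
    have "seed_env c V (100 + (x2 + (d * (L + 1) + u))) = of_bool (\<tau> (x2 + (d * (L + 1) + u)))"
      using in3[OF that] total by (intro mem) linarith
    moreover have "(d * (L + 1) + u) div (L + 1) = d" "(d * (L + 1) + u) mod (L + 1) = u"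
      by (rule div_mod_add[OF that(2)])+
    ultimately show ?thesis by (simp add: \<tau>_def x2_def Let_def)
  qed
  have var: "seed_var n m k L (seed_env c V) d = vs d" if d: "d < m * k" for d
    unfolding seed_var_def S_def[symmetric] x1_def[symmetric] add.assoc[of 100 x1] x2_def[symmetric]
  proof (rule num_eq)
    show "vs d < 2 ^ L" by (rule vs)
    fix u assume "u < L"
    then show "seed_env c V (100 + x2 + d * (L + 1) + u) = of_bool (odd (vs d div 2 ^ (L - 1 - u)))"
      using memd[OF d, of u] by (simp add: nb_def add.assoc)
  qed
  have val: "seed_val n m k L (seed_env c V) d = ys d" if d: "d < m * k" for d
    unfolding seed_val_def S_def[symmetric] x1_def[symmetric] add.assoc[of 100 x1] x2_def[symmetric]
    using memd[OF d, of L] ys[of d] by (auto simp: add.assoc)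
  show ?thesis using V(1) base mul shift var val by blast
qed

text \<open>The value depends only on the variable, so repetitions and the order of the overrides do
  not matter.\<close>

lemma overrides_eq:
  assumes "\<And>d. ys d = of_bool (vs d \<in> Y)"
  shows "overrides R x vs ys d i = (if \<exists>d'<d. vs d' = i then (if i \<in> Y then \<one>\<^bsub>R\<^esub> else \<zero>\<^bsub>R\<^esub>) else x i)"
  using assms by (induction d) (auto simp: less_Suc_eq)

lemma overrides_cong_seed:
  "(\<And>d'. d' < d \<Longrightarrow> vs d' = vs' d' \<and> ys d' = ys' d') \<Longrightarrow> overrides R x vs ys d = overrides R x vs' ys' d"
  by (induction d) auto

lemma exists_seed_point:
  fixes c :: "nat \<Rightarrow> nat"
  assumes pos: "0 < m" "0 < k" "0 < L" "rows n m \<le> 2 * (m * k)" "m \<le> 2 ^ L" "n < 2 ^ L"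
    and s: "\<And>i. s i < m" and t: "\<And>b. t b < 2 ^ base_bits k L" and \<alpha>: "\<And>b j. \<alpha> b j < 2 ^ mul_bits k L"
    and A: "A \<subseteq> {..<n}" "card A \<le> m * k"
  shows "\<exists>V<2 ^ seed_bits m k L. seed_ok n m k L (seed_env c V) \<and>
    map (seed_point R e n m k L (seed_env c V)) [0..<n] =
    map (\<lambda>v. if v \<in> A then (if v \<in> Y then \<one>\<^bsub>R\<^esub> else \<zero>\<^bsub>R\<^esub>) else block_point R e m L s t \<alpha> v) [0..<n]"
proof -
  have fA: "finite A" using A(1) finite_subset by blast
  obtain h where h: "bij_betw h {..<card A} A"
    using ex_bij_betw_nat_finite[OF fA] by (auto simp: lessThan_atLeast0)
  \<comment> \<open>Spare slots override position \<open>n\<close>, which has an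
    \<open>L\<close>-digit code by \<open>n < 2 ^ L\<close> and lies outside the emitted
    point.\<close>
  define vs where "vs d = (if d < card A then h d else n)" for d
  define ys :: "nat \<Rightarrow> nat" where "ys d = of_bool (vs d \<in> Y)" for d
  have ys_le: "ys d \<le> 1" for d by (simp add: ys_def)
  have hA: "h d \<in> A" if "d < card A" for d using h that by (auto simp: bij_betw_def)
  have vs_less: "vs d < 2 ^ L" for d
    using hA[of d] subsetD[OF A(1), of "h d"] pos(6) by (auto simp: vs_def)
  have vs_in: "(\<exists>d<m * k. vs d = v) \<longleftrightarrow> v \<in> A" if "v < n" for v
  proof
    assume "v \<in> A"
    then have "v \<in> h ` {..<card A}" using h by (simp add: bij_betw_def)
    then obtain d where "d < card A" "h d = v" by auto
    then show "\<exists>d<m * k. vs d = v" using A(2) by (intro exI[of _ d]) (auto simp: vs_def)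
  qed (use that hA in \<open>auto simp: vs_def split: if_splits\<close>)
  obtain V where V: "V < 2 ^ seed_bits m k L" "\<forall>i<rows n m. seed_shift m k L (seed_env c V) i = s i"
    "\<forall>b<2 * m. seed_base k L (seed_env c V) b = t b"
    "\<forall>b<2 * m. \<forall>j<L. seed_mul k L (seed_env c V) b j = \<alpha> b j"
    "\<forall>d<m * k. seed_var n m k L (seed_env c V) d = vs d \<and> seed_val n m k L (seed_env c V) d = ys d"
    using exists_seed_number[where s = s and t = t and \<alpha> = \<alpha> and vs = vs and ys = ys and c = c, OF pos(1-5) s t \<alpha> vs_less ys_le] by blast
  have "seed_ok n m k L (seed_env c V)" using V(2) s by (simp add: seed_ok_def)
  moreover have "seed_point R e n m k L (seed_env c V) v =
      (if v \<in> A then (if v \<in> Y then \<one>\<^bsub>R\<^esub> else \<zero>\<^bsub>R\<^esub>) else block_point R e m L s t \<alpha> v)" if v: "v < n" for v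
  proof -
    have "v div m < rows n m" using rows(1)[OF pos(1), of n] v by (metis less_le_trans less_mult_imp_div_less)
    then have sh: "seed_shift m k L (seed_env c V) (v div m) = s (v div m)" using V(2) by simp
    have "blk m s v < 2 * m"
      using s[of "v div m"] mod_less_divisor[OF pos(1), of v] unfolding blk_def by linarith
    then have "block_point R e m L (seed_shift m k L (seed_env c V)) (seed_base k L (seed_env c V))
        (seed_mul k L (seed_env c V)) v = block_point R e m L s t \<alpha> v"
      using V(3,4) weights_cong[of L "seed_mul k L (seed_env c V) (blk m s v)" "\<alpha> (blk m s v)"] sh
      by (simp add: block_point_def blk_def)
    moreover have "seed_point R e n m k L (seed_env c V) = overrides R (block_point R e m L
        (seed_shift m k L (seed_env c V)) (seed_base k L (seed_env c V)) (seed_mul k L (seed_env c V))) vs ys (m * k)"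
      unfolding seed_point_def using V(5) by (intro overrides_cong_seed) auto
    ultimately show ?thesis
      using vs_in[OF v] by (simp add: overrides_eq[OF ys_def])
  qed
  ultimately show ?thesis using V(1) by (intro exI[of _ V]) simp
qed

section \<open>The hitting set\<close>

definition hitting_program :: "com \<Rightarrow> com" where
  "hitting_program p = Seq p (Seq set_params enumerate_seeds)"

definition total_time :: "nat \<Rightarrow> nat \<Rightarrow> nat \<Rightarrow> nat \<Rightarrow> nat \<Rightarrow> nat" where
  "total_time T n m k L = T + (3 * n + 45 + 24 * (100 + k * L + 2 * m) +
     (2 + 2 ^ seed_bits m k L * (seed_time n m k L + 1)))"

text \<open>Keeps the digits for the shifts within the budget of \<open>m * k * L\<close>.\<close>

lemma rows_le:
  assumes "0 < m" "n \<le> m\<^sup>2 * k"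
  shows "rows n m \<le> m * k"
proof -
  have "n + m - 1 \<le> m * k * m + (m - 1)" using assms by (simp add: power2_eq_square algebra_simps)
  then have "rows n m \<le> (m * k * m + (m - 1)) div m" unfolding rows_def by (rule div_le_mono)
  also have "\<dots> = m * k" using assms(1) by (intro div_mod_add) simp
  finally show ?thesis .
qed

text \<open>The base points \<open>t\<^sub>b\<close> alone already account for a power of the number of seeds:
  they are the coordinates in the first row of the matrix of variables.\<close>

lemma card_points_ge:
  assumes "field E" "range e \<subseteq> carrier E" "inj_on e {..<2 ^ w}" "0 < m" "m \<le> n" "finite H"
    and "\<And>t. (\<And>b. t b < 2 ^ w) \<Longrightarrow> map (block_point E e m L (\<lambda>_. 0) t (\<lambda>_ _. 0)) [0..<n] \<in> H"
  shows "2 ^ (m * w) \<le> card H"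
proof -
  interpret field E by (rule assms(1))
  define pt where "pt f = map (block_point E e m L (\<lambda>_. 0) (\<lambda>b. if b < m then f b else 0) (\<lambda>_ _. 0)) [0..<n]" for f
  define F where "F = PiE {..<m} (\<lambda>_. {..<(2::nat) ^ w})"
  \<comment> \<open>With shift 0 the variable \<open>v < m\<close> is the one of row 0 in block
    \<open>v\<close>, and the weight of row 0 is 1 for any multipliers, so the base point appears
    unchanged.\<close>
  have coord: "pt f ! v = e (f v)" if "v < m" "f \<in> F" for f v
    using that assms(2,5) by (auto simp: pt_def block_point_def blk_def image_subset_iff)
  have "inj_on pt F"
  proof (rule inj_onI)
    fix f f' assume f: "f \<in> F" "f' \<in> F" "pt f = pt f'"
    show "f = f'"
    proof (rule PiE_ext[OF f(1,2)[unfolded F_def]])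
      fix v assume v: "v \<in> {..<m}"
      then have "e (f v) = e (f' v)" using coord[of v f] coord[of v f'] f by simp
      moreover have "f v < 2 ^ w" "f' v < 2 ^ w" using f(1,2) v by (auto simp: F_def PiE_def)
      ultimately show "f v = f' v" using assms(3) by (auto dest: inj_onD)
    qed
  qed
  moreover have "pt ` F \<subseteq> H"
    unfolding pt_def by (intro image_subsetI assms(7)) (auto simp: F_def PiE_def)
  ultimately have "card F \<le> card H" using assms(6) by (intro card_inj_on_le)
  moreover have "card F = 2 ^ (m * w)" by (simp add: F_def card_PiE power_mult[symmetric] mult.commute)
  ultimately show ?thesis by simp
qed

text \<open>\<open>p\<close> only has to leave \<open>n\<close>, \<open>m\<close> and
  \<open>k\<close> in their registers, and \<open>hit\<close> only asks that suitable seed data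
  exist; so the small and the large values of \<delta> share this argument.\<close>

lemma hitting_program_correct:
  fixes E :: "'a ring"
  assumes "field E" "range e \<subseteq> carrier E" "inj_on e {..<2 ^ base_bits k L}"
    and pos: "0 < n" "0 < m" "m \<le> n" "0 < k" "n \<le> m\<^sup>2 * k" "L = num_bits n"
    and pre: "runs E e p (input_state E inp) T (ready E n m k)"
    and hit: "\<And>P. P \<in> C \<Longrightarrow> P \<noteq> ring.indexed_const E \<zero>\<^bsub>E\<^esub> \<Longrightarrow>
      \<exists>s t \<alpha> A Y. (\<forall>i. s i < m) \<and> (\<forall>b. t b < 2 ^ base_bits k L) \<and> (\<forall>b j. \<alpha> b j < 2 ^ mul_bits k L) \<and>
        A \<subseteq> {..<n} \<and> card A \<le> m * k \<and>
        ring.indexed_value E P (map (\<lambda>v. if v \<in> A then (if v \<in> Y then \<one>\<^bsub>E\<^esub> else \<zero>\<^bsub>E\<^esub>)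
          else block_point E e m L s t \<alpha> v) [0..<n]) \<noteq> \<zero>\<^bsub>E\<^esub>"
  shows "\<exists>H t. finite H \<and> ring.hitting_set E n C H \<and> card H \<le> 2 ^ seed_bits m k L \<and>
    2 ^ (m * base_bits k L) \<le> card H \<and> constructs E e (hitting_program p) inp n H t \<and>
    t \<le> total_time T n m k L"
proof -
  interpret field E by (rule assms(1))
  have L: "0 < L" "n < 2 ^ L" using pos(1) num_bits(1)[of n] by (auto simp: pos(6) num_bits_pos)
  have r: "rows n m \<le> 2 * (m * k)" using rows_le[OF pos(2,5)] by linarith
  have mL: "m \<le> 2 ^ L" "n \<le> 2 ^ L" using pos(3) L(2) by auto
  define Q where "Q c s' \<longleftrightarrow> (\<exists>pts. outp s' = concat pts \<and> length pts = 2 ^ seed_bits m k L \<and>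
       (\<forall>x\<in>set pts. length x = n \<and> set x \<subseteq> carrier E) \<and>
       (\<forall>V<2 ^ seed_bits m k L. seed_ok n m k L (seed_env c V) \<longrightarrow>
          pts ! V = map (seed_point E e n m k L (seed_env c V)) [0..<n]))" for c and s' :: "'a machine"
  have "runs E e (hitting_program p) (input_state E inp) (total_time T n m k L) (\<lambda>s'. \<exists>c. Q c s')"
    unfolding hitting_program_def total_time_def
  proof (rule runs_Seq[OF pre])
    fix s1 assume s1: "ready E n m k s1"
    show "runs E e (Seq set_params enumerate_seeds) s1
      (3 * n + 45 + 24 * (100 + k * L + 2 * m) + (2 + 2 ^ seed_bits m k L * (seed_time n m k L + 1))) (\<lambda>s'. \<exists>c. Q c s')"
      unfolding pos(6)
    proof (rule runs_Seq[OF runs_set_params[OF s1 pos(1)]], elim conjE exE, fold pos(6))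
      fix s2 c assume "fclosed E s2" "outp s2 = []" "params n m k L c" "env (seed_env c 0) s2"
      then show "runs E e enumerate_seeds s2 (2 + 2 ^ seed_bits m k L * (seed_time n m k L + 1)) (\<lambda>s'. \<exists>c. Q c s')"
        by (intro runs_mono[OF runs_enumerate_seeds[OF _ pos(2) mL(2) assms(2)] _ order_refl])
          (auto simp: Q_def)
    qed
  qed
  then obtain t s' c pts where run: "exec E e (hitting_program p) (input_state E inp) t s'"
      "t \<le> total_time T n m k L"
    and pts: "outp s' = concat pts" "length pts = 2 ^ seed_bits m k L"
      "\<And>x. x \<in> set pts \<Longrightarrow> length x = n \<and> set x \<subseteq> carrier E"
      "\<And>V. V < 2 ^ seed_bits m k L \<Longrightarrow> seed_ok n m k L (seed_env c V) \<Longrightarrow>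
          pts ! V = map (seed_point E e n m k L (seed_env c V)) [0..<n]"
    unfolding runs_def Q_def by blast
  have point: "map (\<lambda>v. if v \<in> A then (if v \<in> Y then \<one>\<^bsub>E\<^esub> else \<zero>\<^bsub>E\<^esub>) else block_point E e m L s t \<alpha> v) [0..<n] \<in> set pts"
    if "\<And>i. s i < m" "\<And>b. t b < 2 ^ base_bits k L" "\<And>b j. \<alpha> b j < 2 ^ mul_bits k L"
      "A \<subseteq> {..<n}" "card A \<le> m * k" for s t \<alpha> A Y
  proof -
    note h = that
    obtain V where V: "V < 2 ^ seed_bits m k L" "seed_ok n m k L (seed_env c V)"
      "map (seed_point E e n m k L (seed_env c V)) [0..<n] =
      map (\<lambda>v. if v \<in> A then (if v \<in> Y then \<one>\<^bsub>E\<^esub> else \<zero>\<^bsub>E\<^esub>) else block_point E e m L s t \<alpha> v) [0..<n]"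
      using exists_seed_point[where s = s and t = t and \<alpha> = \<alpha> and A = A and Y = Y and R = E and e = e and c = c,
          OF pos(2,4) L(1) r mL(1) L(2) h] by blast
    show ?thesis using pts(4)[OF V(1,2)] V(3) nth_mem[of V pts] V(1) pts(2) by simp
  qed
  have "hitting_set n C (set pts)"
    unfolding hitting_set_def
  proof (intro conjI ballI impI)
    fix P assume "P \<in> C" "P \<noteq> indexed_const \<zero>\<^bsub>E\<^esub>"
    from hit[OF this] show "\<exists>x\<in>set pts. indexed_value P x \<noteq> \<zero>\<^bsub>E\<^esub>"
      using point by blast
  qed (use pts(3) in auto)
  moreover have "2 ^ (m * base_bits k L) \<le> card (set pts)"
  proof (rule card_points_ge[OF assms(1-3) pos(2,3)])
    show "map (block_point E e m L (\<lambda>_. 0) t (\<lambda>_ _. 0)) [0..<n] \<in> set pts"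
      if "\<And>b. t b < 2 ^ base_bits k L" for t
      using point[of "\<lambda>_. 0" t "\<lambda>_ _. 0" "{}"] that pos(2) by simp
  qed simp
  moreover have "card (set pts) \<le> 2 ^ seed_bits m k L" using card_length[of pts] pts(2) by simp
  moreover have "constructs E e (hitting_program p) inp n (set pts) t"
    unfolding constructs_def using run(1) pts(1,3) by blast
  ultimately show ?thesis using run(2) by (intro exI[of _ "set pts"] exI[of _ t]) simp
qed

text \<open>\<open>U\<close> is the lower bound for the number of points. All quantities in the
  running time are at most a fixed power of \<open>U\<close>, and the rules \<open>add\<close>,
  \<open>mult\<close> and \<open>power\<close> keep account of the exponent, for which 200 is
  generous.\<close>

lemma total_time_le:
  fixes U :: nat
  assumes "0 < n" "0 < m" "m \<le> n" "0 < k" "L = num_bits n" "M < 2 ^ k"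
  defines "U \<equiv> 2 ^ (m * base_bits k L)"
  shows "total_time (3 * M + 3 * n + n * (9 * n ^ 3 + 14) + 9 * n ^ 3 + 24) n m k L \<le> U ^ 200"
proof -
  have L: "0 < L" "n < 2 ^ L" using assms(1) num_bits(1)[of n] by (auto simp: assms(5) num_bits_pos)
  have kL: "k \<le> k * L\<^sup>2" "L \<le> k * L\<^sup>2" "k * L \<le> k * L\<^sup>2" "1 \<le> k * L\<^sup>2"
    using assms(4) L(1) by (auto simp: power2_eq_square)
  have "base_bits k L \<le> m * base_bits k L" using assms(2) by simp
  then have base: "24 * (k * L\<^sup>2) \<le> m * base_bits k L" by (simp add: base_bits_def)
  have pow: "(2::nat) ^ x \<le> U ^ 1" if "x \<le> m * base_bits k L" for x
    using that by (simp add: U_def power_increasing)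
  have small: "x \<le> U ^ 1" if "x \<le> m * base_bits k L" for x
    using pow[OF that] less_exp[of x] by linarith
  have num: "x \<le> U ^ 1" if "x \<le> 2 ^ 24" for x
    using that pow[of 24] base kL(4) by linarith
  have U: "2 \<le> U" using num[of 2] by simp
  \<comment> \<open>The extra 1 in the exponent absorbs the factor 2, as
    \<open>2 \<le> U\<close>.\<close>
  have add: "x + y \<le> U ^ (i + j + 1)" if "x \<le> U ^ i" "y \<le> U ^ j" for x y i j
  proof -
    have "x + y \<le> U ^ (i + j) + U ^ (i + j)"
      using that U by (intro add_mono order_trans[OF that(1) power_increasing] order_trans[OF that(2) power_increasing]) auto
    also have "\<dots> = 2 * U ^ (i + j)" by simp
    also have "\<dots> \<le> U * U ^ (i + j)" using U by (rule mult_le_mono1)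
    finally show ?thesis by simp
  qed
  have mult: "x * y \<le> U ^ (i + j)" if "x \<le> U ^ i" "y \<le> U ^ j" for x y i j
    unfolding power_add using that by (rule mult_le_mono)
  have power: "x ^ d \<le> U ^ (i * d)" if "x \<le> U ^ i" for x i d
    unfolding power_mult using that by (rule power_mono) simp
  have final: "x \<le> U ^ 200" if "x \<le> U ^ i" "i \<le> 200" for x i
    using that U by (meson order_trans power_increasing one_le_numeral)
  have n: "n \<le> U ^ 1" using L(2) pow[of L] base kL(2) by linarith
  have m: "m \<le> U ^ 1" using n assms(3) by linarith
  have M: "M \<le> U ^ 1" using assms(6) pow[of k] base kL(1) by linarith
  have atoms: "k \<le> U ^ 1" "L \<le> U ^ 1" "2 ^ L \<le> U ^ 1" "mul_bits k L \<le> U ^ 1" "2 ^ mul_bits k L \<le> U ^ 1"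
    "base_bits k L \<le> U ^ 1"
  proof -
    have "k \<le> m * base_bits k L" "L \<le> m * base_bits k L" "mul_bits k L \<le> m * base_bits k L"
      "base_bits k L \<le> m * base_bits k L"
      using base kL(1,2) assms(2) apply linarith
      using base kL(1,2) apply linarith
      using base kL(3) unfolding mul_bits_def apply linarith
      using assms(2) by simp
    then show "k \<le> U ^ 1" "L \<le> U ^ 1" "2 ^ L \<le> U ^ 1" "mul_bits k L \<le> U ^ 1" "2 ^ mul_bits k L \<le> U ^ 1"
      "base_bits k L \<le> U ^ 1"
      by (blast intro: pow small)+
  qed
  have rows: "rows n m \<le> U ^ 1" using rows(3)[OF assms(2), of n] n by linarith
  \<comment> \<open>In units of \<open>m * k * L^2\<close>, \<open>seed_bits\<close> is 100 and the
    exponent in \<open>U\<close> is 24, and \<open>100 \<le> 5 * 24\<close>.\<close>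
  have seeds: "2 ^ seed_bits m k L \<le> U ^ 5"
    unfolding U_def power_mult[symmetric] by (intro power_increasing) (auto simp: seed_bits_def base_bits_def)
  have nums: "1 \<le> U ^ 1" "2 \<le> U ^ 1" "3 \<le> U ^ 1" "4 \<le> U ^ 1" "6 \<le> U ^ 1" "9 \<le> U ^ 1" "11 \<le> U ^ 1" "12 \<le> U ^ 1"
    "13 \<le> U ^ 1" "14 \<le> U ^ 1" "24 \<le> U ^ 1" "45 \<le> U ^ 1" "100 \<le> U ^ 1"
    by (rule num; simp)+
  show ?thesis
    unfolding total_time_def seed_time_def table_time_def
    \<comment> \<open>The exponent stays schematic while the rules build it up; the last step
      compares it with 200.\<close>
    apply (rule final)
     apply (rule atoms n m M rows seeds nums add mult power)+
    by simp
qed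

section \<open>Numerical estimates\<close>

lemma num_bits_le_log:
  assumes "1 \<le> n"
  shows "real (num_bits n) \<le> log 2 (real n) + 1"
proof -
  have "0 < num_bits n" using assms by (simp add: num_bits_pos)
  then have "2 ^ (num_bits n - 1) \<le> n" by (intro num_bits(2)) simp
  then have "real (2 ^ (num_bits n - 1)) \<le> real n" by (simp only: of_nat_le_iff)
  then have "2 powr real (num_bits n - 1) \<le> real n" by (simp add: powr_realpow)
  then have "real (num_bits n - 1) \<le> log 2 (real n)" using assms by (simp add: le_log_iff)
  then show ?thesis using \<open>0 < num_bits n\<close> by simp
qed

text \<open>From \<open>num_bits n \<le> log 2 n + 1 \<le> 2 * log 2 (n + 1)\<close>. As
  \<open>polylog c n\<close> has the factor \<open>c\<close>, a multiple \<open>q * L^2\<close> is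
  absorbed by choosing \<open>c = 4 * q\<close>.\<close>

lemma num_bits_sq_le_polylog:
  assumes "1 \<le> n" "2 \<le> c"
  shows "real c * (real (num_bits n))\<^sup>2 \<le> 4 * polylog c n"
proof -
  define l where "l = log 2 (real n + 1)"
  have l: "1 \<le> l" using assms(1) by (simp add: l_def le_log_iff)
  have "log 2 (real n) \<le> l" using assms(1) by (simp add: l_def)
  then have "real (num_bits n) \<le> 2 * l" using num_bits_le_log[OF assms(1)] l by simp
  then have "(real (num_bits n))\<^sup>2 \<le> (2 * l)\<^sup>2" by (intro power_mono) auto
  also have "\<dots> = 4 * l ^ 2" by (simp add: power_mult_distrib)
  also have "l ^ 2 \<le> l ^ c" using l assms(2) by (intro power_increasing)
  finally have "(real (num_bits n))\<^sup>2 \<le> 4 * l ^ c" by simp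
  then have "real c * (real (num_bits n))\<^sup>2 \<le> real c * (4 * l ^ c)" by (intro mult_left_mono) auto
  then show ?thesis by (simp add: polylog_def l_def)
qed

text \<open>Minimality of \<open>m\<close> gives \<open>(m - 1)^3 * k < n^2\<close> for
  \<open>m > 1\<close>. Multiplying by \<open>k^2\<close> bounds the cube of
  \<open>(m - 1) * k\<close> by \<open>n^2 * k^2\<close>, whose cube root is the claimed power of
  \<open>n\<close> up to a constant.\<close>

lemma block_count_bounds:
  fixes \<delta> :: real
  assumes "0 < \<delta>" "\<delta> \<le> 2" "1 \<le> n"
  defines "M \<equiv> nat \<lfloor>2 powr (real n powr \<delta>)\<rfloor>"
  defines "k \<equiv> num_bits M"
  defines "m \<equiv> block_count n k"
  shows "0 < M" "real k \<le> 2 * real n powr \<delta>" "real (m * k) \<le> 4 * real n powr (2/3 + 2/3 * \<delta>)" "n \<le> m\<^sup>2 * k"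
proof -
  have n1: "1 \<le> real n powr \<delta>" using assms(1,3) by (simp add: ge_one_powr_ge_zero)
  have "(2::real) powr 0 \<le> 2 powr (real n powr \<delta>)" by (rule powr_mono) auto
  then have "1 \<le> (2::real) powr (real n powr \<delta>)" by simp
  then show M0: "0 < M" by (simp add: M_def)
  have Mle: "real M \<le> 2 powr (real n powr \<delta>)" by (simp add: M_def)
  have "log 2 (real M) \<le> real n powr \<delta>" using M0 Mle by (simp add: log_le_iff)
  then have "real k \<le> real n powr \<delta> + 1" using num_bits_le_log[of M] M0 by (simp add: k_def)
  then show k: "real k \<le> 2 * real n powr \<delta>" using n1 by simp
  have k0: "0 < k" using M0 by (simp add: k_def num_bits_pos)
  have "0 < n" using assms(3) by simp
  note m = block_count[OF this k0, folded m_def]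
  define y where "y = real n powr (2/3 + 2/3 * \<delta>)"
  have y: "y ^ 3 = real n ^ 2 * (real n powr \<delta>)\<^sup>2"
  proof -
    have "y ^ 3 = real n powr (2 + 2 * \<delta>)" using assms(3) by (simp add: y_def powr_power algebra_simps)
    also have "\<dots> = real n powr 2 * real n powr (2 * \<delta>)" by (rule powr_add)
    also have "real n powr 2 = real n ^ 2" using assms(3) by simp
    also have "real n powr (2 * \<delta>) = (real n powr \<delta>)\<^sup>2" using assms(3) by (simp add: powr_power mult.commute)
    finally show ?thesis .
  qed
  have "real (m * k) \<le> 4 * y"
  proof (cases "m = 1")
    \<comment> \<open>Here \<open>m * k = k\<close>, and \<open>\<delta> \<le> 2\<close> makes
      \<open>real n powr \<delta>\<close> at most \<open>y\<close>.\<close>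
    case True
    have "real n powr \<delta> \<le> y" unfolding y_def using assms(2,3) by (intro powr_mono) auto
    then show ?thesis using k True powr_ge_zero[of "real n" \<delta>] by simp
  next
    case False
    define i where "i = m - 1"
    have i: "0 < i" "m = Suc i" using m(1) False by (auto simp: i_def)
    have "real (i ^ 3 * k) < real (n\<^sup>2)" using m(4)[of i] i unfolding of_nat_less_iff by simp
    then have "real i ^ 3 * real k < real n ^ 2" by simp
    then have "real i ^ 3 * real k * (real k)\<^sup>2 \<le> real n ^ 2 * (2 * real n powr \<delta>)\<^sup>2"
      using k by (intro mult_mono power_mono) auto
    also have "\<dots> \<le> (2 * y) ^ 3" using y by (simp add: power_mult_distrib)
    finally have "(real i * real k) ^ 3 \<le> (2 * y) ^ 3"
      by (simp add: power_mult_distrib power2_eq_square power3_eq_cube ac_simps)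
    then have "real i * real k \<le> 2 * y"
      using power_mono_iff[of "real i * real k" "2 * y" 3] by (simp add: y_def)
    moreover have "m * k \<le> 2 * (i * k)" using i by simp
    then have "real (m * k) \<le> 2 * (real i * real k)" by (metis of_nat_le_iff of_nat_mult of_nat_numeral)
    ultimately show ?thesis by simp
  qed
  then show "real (m * k) \<le> 4 * real n powr (2/3 + 2/3 * \<delta>)" by (simp add: y_def)
  have "n\<^sup>2 \<le> m ^ 3 * k * (m * k)"
    using m(1,2) k0 by (metis le_trans mult_le_mono2 mult.right_neutral nat_0_less_mult_iff Suc_leI One_nat_def)
  also have "\<dots> = (m\<^sup>2 * k)\<^sup>2" by (simp add: power2_eq_square power3_eq_cube ac_simps)
  finally show "n \<le> m\<^sup>2 * k" by (simp add: power2_nat_le_eq_le)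
qed

lemma hit_with_seed:
  fixes E :: "'a ring"
  assumes E: "field E" and K: "subfield K E" and e: "range e \<subseteq> carrier E" "inj_on e {..<2 ^ base_bits k L}"
    and pos: "1 \<le> k" "1 \<le> L" "0 < n" "0 < m" "m \<le> n" "n < 2 ^ L" "n\<^sup>2 \<le> m ^ 3 * k"
    and small: "\<And>x::nat. real x \<le> S \<Longrightarrow> x < 2 ^ k"
    and P: "P \<in> ring.multilinear_depth3_class E K n S" "P \<noteq> ring.indexed_const E \<zero>\<^bsub>E\<^esub>"
  shows "\<exists>s t \<alpha> A Y. (\<forall>i. s i < m) \<and> (\<forall>b. t b < 2 ^ base_bits k L) \<and> (\<forall>b j. \<alpha> b j < 2 ^ mul_bits k L) \<and>
    A \<subseteq> {..<n} \<and> card A \<le> m * k \<and>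
    ring.indexed_value E P (map (\<lambda>v. if v \<in> A then (if v \<in> Y then \<one>\<^bsub>E\<^esub> else \<zero>\<^bsub>E\<^esub>)
      else block_point E e m L s t \<alpha> v) [0..<n]) \<noteq> \<zero>\<^bsub>E\<^esub>"
proof -
  interpret field E by (rule E)
  interpret prime_zero "\<lambda>x. proj E x = \<zero>\<^bsub>E\<^esub>" by (rule prime_zero_proj[OF E])
  obtain \<Phi> :: "'a total aff list list" where \<Phi>: "\<forall>g\<in>set \<Phi>. disj_gate n g"
    "real (1 + length \<Phi> + length (concat \<Phi>)) \<le> S"
    "\<And>x. indexed_value P (map (\<lambda>i. proj E (x i)) [0..<n]) = proj E (form_val n \<Phi> x)"
    "P \<noteq> indexed_const \<zero>\<^bsub>E\<^esub> \<Longrightarrow> \<exists>Y. proj E (form_val n \<Phi> (\<lambda>i. of_bool (i \<in> Y))) \<noteq> \<zero>\<^bsub>E\<^esub>"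
    using multilinear_depth3_class_lift[OF E K P(1)] by blast
  obtain x where x: "proj E (form_val n \<Phi> x) \<noteq> \<zero>\<^bsub>E\<^esub>" using \<Phi>(4)[OF P(2)] by blast
  have ec: "e i \<in> carrier E" for i using e(1) by auto
  have dist: "proj E (emb E (e i) - emb E (e j)) \<noteq> \<zero>\<^bsub>E\<^esub>"
    if "i < 2 ^ (24 * k * L\<^sup>2)" "j < 2 ^ (24 * k * L\<^sup>2)" "i \<noteq> j" for i j
  proof -
    have "e i \<noteq> e j" using that inj_onD[OF e(2), of i j] by (auto simp: base_bits_def)
    then show ?thesis using ec by (simp add: proj_diff[OF E] proj_emb[OF E] r_right_minus_eq)
  qed
  have size: "length \<Phi> + length (concat \<Phi>) < 2 ^ k" using small[OF \<Phi>(2)] by simp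
  have le: "n \<le> m * 2 ^ L" "m \<le> 2 ^ L"
    using pos(4-6) mult_le_mono1[of 1 m "2 ^ L"] by (auto intro: order_trans[of n "2 ^ L"])
  obtain s t \<alpha> A Y where seed: "\<forall>i. s i < m" "\<forall>b. t b < 2 ^ (24 * k * L\<^sup>2)" "\<forall>b j. \<alpha> b j < 2 ^ (22 * k * L)"
    "A \<subseteq> {..<n}" "card A \<le> m * k"
    "proj E (form_val n \<Phi> (\<lambda>v. if v \<in> A then of_bool (v \<in> Y)
        else emb E (e (t (blk m s v))) ^ (weights (\<alpha> (blk m s v)) L ! (v div m)))) \<noteq> \<zero>\<^bsub>E\<^esub>"
    using exists_seed[where e = "\<lambda>i. emb E (e i)", OF pos(1-4) le pos(7) dist \<Phi>(1) size x] by blast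
  have eq: "map (\<lambda>i. proj E (if i \<in> A then of_bool (i \<in> Y)
        else emb E (e (t (blk m s i))) ^ (weights (\<alpha> (blk m s i)) L ! (i div m)))) [0..<n] =
    map (\<lambda>v. if v \<in> A then (if v \<in> Y then \<one>\<^bsub>E\<^esub> else \<zero>\<^bsub>E\<^esub>) else block_point E e m L s t \<alpha> v) [0..<n]"
    using ec by (simp add: block_point_def proj_power[OF E] proj_emb[OF E] proj_simps[OF E])
  have "indexed_value P (map (\<lambda>v. if v \<in> A then (if v \<in> Y then \<one>\<^bsub>E\<^esub> else \<zero>\<^bsub>E\<^esub>)
      else block_point E e m L s t \<alpha> v) [0..<n]) \<noteq> \<zero>\<^bsub>E\<^esub>"
    unfolding eq[symmetric] \<Phi>(3) by (rule seed(6))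
  then show ?thesis using seed(1-5) unfolding base_bits_def mul_bits_def by blast
qed

text \<open>With \<open>n \<le> m * k\<close> the overrides can set every variable, so every point
  of the Boolean cube comes from a seed.\<close>

lemma hit_boolean:
  fixes E :: "'a ring"
  assumes E: "field E" and K: "subfield K E" and "0 < m" "n \<le> m * k"
    and P: "P \<in> ring.multilinear_depth3_class E K n S" "P \<noteq> ring.indexed_const E \<zero>\<^bsub>E\<^esub>"
  shows "\<exists>s t \<alpha> A Y. (\<forall>i. s i < m) \<and> (\<forall>b. t b < 2 ^ base_bits k L) \<and> (\<forall>b j. \<alpha> b j < 2 ^ mul_bits k L) \<and>
    A \<subseteq> {..<n} \<and> card A \<le> m * k \<and>
    ring.indexed_value E P (map (\<lambda>v. if v \<in> A then (if v \<in> Y then \<one>\<^bsub>E\<^esub> else \<zero>\<^bsub>E\<^esub>)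
      else block_point E e m L s t \<alpha> v) [0..<n]) \<noteq> \<zero>\<^bsub>E\<^esub>"
proof -
  interpret field E by (rule E)
  obtain \<Phi> :: "'a total aff list list" and Y where \<Phi>:
    "\<And>x. indexed_value P (map (\<lambda>i. proj E (x i)) [0..<n]) = proj E (form_val n \<Phi> x)"
    "proj E (form_val n \<Phi> (\<lambda>i. of_bool (i \<in> Y))) \<noteq> \<zero>\<^bsub>E\<^esub>"
    using multilinear_depth3_class_lift[OF E K P(1)] P(2) by metis
  have eq: "map (\<lambda>i. proj E (of_bool (i \<in> Y))) [0..<n] =
    map (\<lambda>v. if v \<in> {..<n} then (if v \<in> Y then \<one>\<^bsub>E\<^esub> else \<zero>\<^bsub>E\<^esub>)
      else block_point E e m L (\<lambda>_. 0) (\<lambda>_. 0) (\<lambda>_ _. 0) v) [0..<n]"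
    by (simp add: proj_simps[OF E])
  have "indexed_value P (map (\<lambda>v. if v \<in> {..<n} then (if v \<in> Y then \<one>\<^bsub>E\<^esub> else \<zero>\<^bsub>E\<^esub>)
      else block_point E e m L (\<lambda>_. 0) (\<lambda>_. 0) (\<lambda>_ _. 0) v) [0..<n]) \<noteq> \<zero>\<^bsub>E\<^esub>"
    unfolding eq[symmetric] \<Phi>(1) by (rule \<Phi>(2))
  then show ?thesis
    using assms(3,4)
    by (intro exI[of _ "\<lambda>_. 0"] exI[of _ "\<lambda>_ _. 0"] exI[of _ "{..<n}"] exI[of _ Y]) simp
qed

lemma inj_on_enumeration:
  assumes "enumerates_field E e" "card_at_least (carrier E) (2 powr x)" "real w \<le> x"
  shows "inj_on e {..<2 ^ w}"
proof (rule inj_on_subset)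
  show "inj_on e {i. infinite (carrier E) \<or> i < card (carrier E)}"
    using assms(1) by (simp add: enumerates_field_def)
  have "real (2 ^ w) \<le> real (card (carrier E))" if "finite (carrier E)"
  proof -
    have "real (2 ^ w) = 2 powr real w" by (simp add: powr_realpow)
    also have "\<dots> \<le> 2 powr x" using assms(3) by (intro powr_mono) auto
    also have "\<dots> \<le> real (card (carrier E))" using assms(2) that by (simp add: card_at_least_def)
    finally show ?thesis .
  qed
  then have "2 ^ w \<le> card (carrier E)" if "finite (carrier E)" using that by (simp only: of_nat_le_iff)
  then show "{..<2 ^ w} \<subseteq> {i. infinite (carrier E) \<or> i < card (carrier E)}" by fastforce
qed

lemma hitting_set_construction:
  fixes E :: "'a ring" and \<delta> :: real
  assumes "field E" "range e \<subseteq> carrier E" "inj_on e {..<2 ^ base_bits k L}"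
    and pos: "1 \<le> n" "0 < m" "m \<le> n" "0 < k" "n \<le> m\<^sup>2 * k" "L = num_bits n" "M < 2 ^ k"
    and pre: "runs E e p (input_state E inp) T (ready E n m k)"
      "T \<le> 3 * M + 3 * n + n * (9 * n ^ 3 + 14) + 9 * n ^ 3 + 24"
    and mk: "real (m * k) \<le> 4 * real n powr (2/3 + 2/3 * \<delta>)"
    and hit: "\<And>P. P \<in> C \<Longrightarrow> P \<noteq> ring.indexed_const E \<zero>\<^bsub>E\<^esub> \<Longrightarrow>
      \<exists>s t \<alpha> A Y. (\<forall>i. s i < m) \<and> (\<forall>b. t b < 2 ^ base_bits k L) \<and> (\<forall>b j. \<alpha> b j < 2 ^ mul_bits k L) \<and>
        A \<subseteq> {..<n} \<and> card A \<le> m * k \<and>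
        ring.indexed_value E P (map (\<lambda>v. if v \<in> A then (if v \<in> Y then \<one>\<^bsub>E\<^esub> else \<zero>\<^bsub>E\<^esub>)
          else block_point E e m L s t \<alpha> v) [0..<n]) \<noteq> \<zero>\<^bsub>E\<^esub>"
  shows "\<exists>H t. finite H \<and> ring.hitting_set E n C H \<and>
    real (card H) \<le> 2 powr (real n powr (2/3 + 2/3 * \<delta>) * polylog 1600 n) \<and>
    constructs E e (hitting_program p) inp n H t \<and> t \<le> 200 * card H ^ 200"
proof -
  have n0: "0 < n" using pos(1) by simp
  obtain H t where H: "finite H" "ring.hitting_set E n C H" "card H \<le> 2 ^ seed_bits m k L"
    "2 ^ (m * base_bits k L) \<le> card H" "constructs E e (hitting_program p) inp n H t"
    "t \<le> total_time T n m k L"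
    using hitting_program_correct[OF assms(1-3) n0 pos(2-6) pre(1) hit] by blast
  have "t \<le> total_time (3 * M + 3 * n + n * (9 * n ^ 3 + 14) + 9 * n ^ 3 + 24) n m k L"
    using H(6) pre(2) by (simp add: total_time_def)
  also have "\<dots> \<le> (2 ^ (m * base_bits k L)) ^ 200"
    by (rule total_time_le[OF n0 pos(2-4,6,7)])
  also have "\<dots> \<le> card H ^ 200" using H(4) by (rule power_mono) simp
  also have "\<dots> \<le> 200 * card H ^ 200" by simp
  finally have time: "t \<le> 200 * card H ^ 200" .
  define y where "y = real n powr (2/3 + 2/3 * \<delta>)"
  have "real (seed_bits m k L) = 100 * (real (m * k) * (real L)\<^sup>2)"
    by (simp add: seed_bits_def mult.assoc)
  also have "\<dots> \<le> 100 * (4 * y * (real L)\<^sup>2)"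
    using mk by (intro mult_left_mono mult_right_mono) (auto simp: y_def)
  also have "\<dots> = y * (400 * (real L)\<^sup>2)" by simp
  also have "\<dots> \<le> y * polylog 1600 n"
    using num_bits_sq_le_polylog[OF pos(1), of 1600] pos(6) by (intro mult_left_mono) (auto simp: y_def)
  finally have seed: "real (seed_bits m k L) \<le> y * polylog 1600 n" .
  have "real (card H) \<le> real (2 ^ seed_bits m k L)" using H(3) by (simp only: of_nat_le_iff)
  also have "\<dots> = 2 powr real (seed_bits m k L)" by (simp add: powr_realpow)
  also have "\<dots> \<le> 2 powr (y * polylog 1600 n)" using seed by (intro powr_mono) auto
  finally show ?thesis using H(1,2,5) time unfolding y_def by blast
qed

lemma base_bits_le:
  assumes "0 < \<delta>" "1 \<le> n" "real k \<le> 2 * real n powr \<delta>"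
  shows "real (base_bits k (num_bits n)) \<le> real n powr (2 * \<delta>) * polylog 192 n"
proof -
  have "real (base_bits k (num_bits n)) = 24 * (real k * (real (num_bits n))\<^sup>2)"
    by (simp add: base_bits_def mult.assoc)
  also have "\<dots> \<le> 24 * (2 * real n powr (2 * \<delta>) * (real (num_bits n))\<^sup>2)"
  proof (intro mult_left_mono mult_right_mono)
    have "real n powr \<delta> \<le> real n powr (2 * \<delta>)" using assms(1,2) by (intro powr_mono) auto
    then show "real k \<le> 2 * real n powr (2 * \<delta>)" using assms(3) by simp
  qed auto
  also have "\<dots> = real n powr (2 * \<delta>) * (48 * (real (num_bits n))\<^sup>2)" by simp
  also have "\<dots> \<le> real n powr (2 * \<delta>) * polylog 192 n"
    using num_bits_sq_le_polylog[OF assms(2), of 192] by (intro mult_left_mono) auto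
  finally show ?thesis .
qed

theorem theorem1p1:
  fixes \<delta> :: real
  assumes "0 < \<delta>"
  shows "\<exists>(p :: com) (a :: nat) (b :: nat) (c :: nat).
    \<forall>(n :: nat) (E :: 'a ring) (K :: 'a set) (e :: nat \<Rightarrow> 'a).
      n \<ge> 1 \<longrightarrow> field E \<longrightarrow> subfield K E \<longrightarrow>
      card_at_least (carrier E) (2 powr (real n powr (2 * \<delta>) * polylog a n)) \<longrightarrow>
      enumerates_field E e \<longrightarrow>
      (\<exists>(H :: 'a list set) (t :: nat).
         finite H \<and>
         ring.hitting_set E n
           (ring.multilinear_depth3_class E K n (2 powr (real n powr \<delta>))) H \<and>
         real (card H) \<le> 2 powr (real n powr (2/3 + 2/3 * \<delta>) * polylog b n) \<and>
         constructs E e p [n, nat \<lfloor>2 powr (real n powr \<delta>)\<rfloor>] n H t \<and>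
         t \<le> c * card H ^ c)"
proof (rule exI[of _ "hitting_program (if \<delta> < 1/2 then choose_blocks else choose_rows)"],
    rule exI[of _ 192], rule exI[of _ 1600], rule exI[of _ 200], intro allI impI)
  \<comment> \<open>The constants: 192 = 4 * 48, as \<open>base_bits\<close> is at most
    \<open>48 * n powr (2 * \<delta>) * L^2\<close>; 1600 = 4 * 400, from the 100 in
    \<open>seed_bits\<close> and the 4 in the bound on \<open>m * k\<close>; 200 is the exponent of
    \<open>total_time_le\<close>.\<close>
  fix n :: nat and E :: "'a ring" and K :: "'a set" and e :: "nat \<Rightarrow> 'a"
  assume n: "n \<ge> 1" and E: "field E" and K: "subfield K E"
    and card: "card_at_least (carrier E) (2 powr (real n powr (2 * \<delta>) * polylog 192 n))"
    and enum: "enumerates_field E e"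
  define M where "M = nat \<lfloor>2 powr (real n powr \<delta>)\<rfloor>"
  define S where "S = 2 powr (real n powr \<delta>)"
  define L where "L = num_bits n"
  have e: "range e \<subseteq> carrier E" using enum by (simp add: enumerates_field_def)
  have L: "1 \<le> L" "n < 2 ^ L" using n num_bits(1)[of n] num_bits_pos[of n] by (auto simp: L_def)
  define s where "s = input_state E [n, M]"
  have s: "nmem s 0 = n" "nmem s 1 = M" "\<And>r. 2 \<le> r \<Longrightarrow> nmem s r = 0" "fclosed E s" "outp s = []"
    using E by (auto simp: s_def input_state_def fclosed_def field_def domain_def cring_def ring.ring_simprules(2))
  show "\<exists>H t. finite H \<and> ring.hitting_set E n
           (ring.multilinear_depth3_class E K n (2 powr (real n powr \<delta>))) H \<and>
         real (card H) \<le> 2 powr (real n powr (2/3 + 2/3 * \<delta>) * polylog 1600 n) \<and>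
         constructs E e (hitting_program (if \<delta> < 1/2 then choose_blocks else choose_rows))
           [n, nat \<lfloor>2 powr (real n powr \<delta>)\<rfloor>] n H t \<and> t \<le> 200 * card H ^ 200"
    unfolding M_def[symmetric] unfolding S_def[symmetric]
  proof (cases "\<delta> < 1/2")
    case True
    define k where "k = num_bits M"
    define m where "m = block_count n k"
    have "\<delta> \<le> 2" using True by simp
    note bounds = block_count_bounds[OF assms this n, folded M_def, folded k_def, folded m_def]
    have k0: "0 < k" using bounds(1) by (simp add: k_def num_bits_pos)
    have "0 < n" using n by simp
    note m = block_count[OF this k0, folded m_def]
    have inj: "inj_on e {..<2 ^ base_bits k L}"
      using inj_on_enumeration[OF enum card] base_bits_le[OF assms n bounds(2)] by (simp add: L_def)
    have M: "M < 2 ^ k" using num_bits(1)[of M] by (simp add: k_def)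
    \<comment> \<open>The program receives the size bound rounded down, which loses nothing since
      sizes are integers.\<close>
    have small: "x < 2 ^ k" if "real x \<le> S" for x
    proof -
      have "x \<le> M" using that by (simp add: M_def S_def le_nat_floor)
      then show ?thesis using M by simp
    qed
    have pre: "runs E e choose_blocks (input_state E [n, M])
        (3 * M + 3 * n + n * (9 * n ^ 3 + 14) + 9 * n ^ 3 + 24) (ready E n m k)"
      using runs_choose_blocks[OF s(1-5) \<open>0 < n\<close> bounds(1), of e] by (simp add: s_def m_def k_def)
    have k1: "1 \<le> k" using k0 by simp
    from hitting_set_construction[OF E e inj n m(1,3) k0 bounds(4) L_def M pre order_refl bounds(3)
        hit_with_seed[OF E K e inj k1 L(1) \<open>0 < n\<close> m(1,3) L(2) m(2) small]]
    show "\<exists>H t. finite H \<and> ring.hitting_set E n (ring.multilinear_depth3_class E K n S) H \<and>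
         real (card H) \<le> 2 powr (real n powr (2/3 + 2/3 * \<delta>) * polylog 1600 n) \<and>
         constructs E e (hitting_program (if \<delta> < 1/2 then choose_blocks else choose_rows)) [n, M] n H t \<and>
         t \<le> 200 * card H ^ 200"
      using True by simp
  next
    \<comment> \<open>Now \<open>2/3 + 2/3 * \<delta>\<close> is at least 1, so \<open>2 ^ n\<close>
      Boolean points are affordable whatever the size of the formula. Blocks would not do for
      \<open>\<delta> > 2\<close>, where \<open>k\<close> alone eventually exceeds the allowed
      number of bits.\<close>
    case False
    have n0: "0 < n" "n \<le> n\<^sup>2 * 1" "n \<le> n * 1" using n by (auto simp: power2_eq_square)
    have "1 \<le> real n powr \<delta>" using assms n by (simp add: ge_one_powr_ge_zero)
    then have "real 1 \<le> 2 * real n powr \<delta>" by simp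
    then have inj: "inj_on e {..<2 ^ base_bits 1 L}"
      using inj_on_enumeration[OF enum card] base_bits_le[OF assms n] by (simp add: L_def)
    have "real n powr 1 \<le> real n powr (2/3 + 2/3 * \<delta>)" using n False by (intro powr_mono) auto
    then have mk: "real (n * 1) \<le> 4 * real n powr (2/3 + 2/3 * \<delta>)" using n by simp
    have pre: "runs E e choose_rows (input_state E [n, M]) 4 (ready E n n 1)"
      using runs_choose_rows[OF s(1,3-5)] by (simp add: s_def)
    have T: "4 \<le> 3 * 0 + 3 * n + n * (9 * n ^ 3 + 14) + 9 * n ^ 3 + 24" by simp
    \<comment> \<open>\<open>k = 1\<close> is set here without reference to the size bound, so the
      time estimate is taken with \<open>M = 0\<close>, which satisfies
      \<open>M < 2 ^ k\<close>.\<close>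
    from hitting_set_construction[where M = 0, OF E e inj n n0(1) order_refl zero_less_one n0(2) L_def _ pre T mk
        hit_boolean[OF E K n0(1,3)]]
    show "\<exists>H t. finite H \<and> ring.hitting_set E n (ring.multilinear_depth3_class E K n S) H \<and>
         real (card H) \<le> 2 powr (real n powr (2/3 + 2/3 * \<delta>) * polylog 1600 n) \<and>
         constructs E e (hitting_program (if \<delta> < 1/2 then choose_blocks else choose_rows)) [n, M] n H t \<and>
         t \<le> 200 * card H ^ 200"
      using False by simp
  qed
qed

end
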